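(* Let $k,m$ be positive integers, and let $G_1=N(\mu_1,I+\Sigma_1),\dots,G_k=N(\mu_k,I+\Sigma_k)$ be Gaussians on $\mathbb{R}^d$ in $(\alpha,\beta)$-regular form. Let $Q_1,\dots,Q_k$ be real polynomials in $d$ variables of degree at most $m$, and define $g:\mathbb{R}^d\to\mathbb{R}$ by $g(x)=Q_1(x)G_1(x)+\dots+Q_k(x)G_k(x)$ (here $G_j(x)$ denotes the density). There exists a constant $C$ depending only on $k,m$ such that the following holds: if $\|v(h_{j,g}(X))\|\le\epsilon$ for all integers $0\le j\le C$, then \[\|g\|_1=\int_{\mathbb{R}^d}|g(x)|\,dx\le (2+\alpha+\beta)^C\,\epsilon.\]
   Context: A set of Gaussians $N(\mu_j,I+\Sigma_j)$, $j\in[k]$, is in $(\alpha,\beta)$-regular form if for all $j$: $\|\mu_j\|\le\alpha$, $\|\Sigma_j\|_2\le\alpha$ (with $\|\cdot\|_2$ the Frobenius/entrywise Euclidean norm), and $\beta^{-1}I\preceq I+\Sigma_j\preceq\beta I$. Multivariate Hermite polynomials: for formal variables $X=(X_1,\dots,X_d)$ and $z\in\mathbb{R}^d$, $H_m(X,z)$ is defined by $\exp\big(t(z\cdot X)-\tfrac12t^2(X_1^2+\dots+X_d^2)\big)=\sum_{m\ge0}\frac{t^m}{m!}H_m(X,z)$; equivalently $H_m(X,z)=\mathcal{H}_m(z_1X_1+\dots+z_dX_d,\;X_1^2+\dots+X_d^2)$, where $\mathcal{H}_m(x,y^2)$ is the homogenized univariate Hermite polynomial ($\mathcal{H}_0=1$,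 $\mathcal{H}_1=x$, $\mathcal{H}_m(x)=x\mathcal{H}_{m-1}(x)-(m-1)\mathcal{H}_{m-2}(x)$; e.g. $\mathcal{H}_2(x,y^2)=x^2-y^2$, $\mathcal{H}_3(x,y^2)=x^3-3xy^2$). $H_m(X,z)$ is homogeneous of degree $m$ in $X$. For $f:\mathbb{R}^d\to\mathbb{R}$, the Hermite moment polynomial is $h_{m,f}(X)=\int_{\mathbb{R}^d}f(z)H_m(X,z)\,dz$, a homogeneous degree-$m$ polynomial in $X$. For a homogeneous real polynomial $p$ of degree $r$ in $X$, $T(p)$ is the unique symmetric real tensor in $(\mathbb{R}^d)^{\otimes r}$ with $\langle T(p),X^{\otimes r}\rangle=p(X)$, $v(p)$ is its flattening into a vector, and $\|v(p)\|$ its Euclidean norm. *)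

theory Defs
  imports "HOL-Analysis.Analysis" "HOL-Probability.Probability"
begin

(* Points of R^d are functions nat => real, only coordinates i < d matter.
   Lebesgue measure on R^d is the finite product measure of lborel. *)
abbreviation lebd :: "nat \<Rightarrow> (nat \<Rightarrow> real) measure" where
  "lebd d \<equiv> PiM {..<d} (\<lambda>_. lborel)"

definition vnorm :: "nat \<Rightarrow> (nat \<Rightarrow> real) \<Rightarrow> real" where
  "vnorm d x = sqrt (\<Sum>i<d. (x i)^2)"

definition frob :: "nat \<Rightarrow> (nat \<Rightarrow> nat \<Rightarrow> real) \<Rightarrow> real" where
  "frob d S = sqrt (\<Sum>i<d. \<Sum>l<d. (S i l)^2)"

definition quadform :: "nat \<Rightarrow> (nat \<Rightarrow> nat \<Rightarrow> real) \<Rightarrow> (nat \<Rightarrow> real) \<Rightarrow> real" where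
  "quadform d S x = (\<Sum>i<d. \<Sum>l<d. x i * S i l * x l)"

definition idm :: "nat \<Rightarrow> nat \<Rightarrow> real" where
  "idm i l = (if i = l then 1 else 0)"

definition mdet :: "nat \<Rightarrow> (nat \<Rightarrow> nat \<Rightarrow> real) \<Rightarrow> real" where
  "mdet d S = (\<Sum>p\<in>{p. p permutes {..<d}}. of_int (sign p) * (\<Prod>i<d. S i (p i)))"

definition minv :: "nat \<Rightarrow> (nat \<Rightarrow> nat \<Rightarrow> real) \<Rightarrow> (nat \<Rightarrow> nat \<Rightarrow> real)" where
  "minv d S = (THE B. (\<forall>i l. (d \<le> i \<or> d \<le> l) \<longrightarrow> B i l = 0) \<and>
                      (\<forall>i<d. \<forall>l<d. (\<Sum>r<d. S i r * B r l) = idm i l))"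

definition gauss_density :: "nat \<Rightarrow> (nat \<Rightarrow> real) \<Rightarrow> (nat \<Rightarrow> nat \<Rightarrow> real) \<Rightarrow> (nat \<Rightarrow> real) \<Rightarrow> real" where
  "gauss_density d mu Sig x =
     (let S = (\<lambda>i l. idm i l + Sig i l) in
      exp (- quadform d (minv d S) (\<lambda>i. x i - mu i) / 2) / sqrt ((2 * pi) ^ d * mdet d S))"

definition regular_form :: "nat \<Rightarrow> real \<Rightarrow> real \<Rightarrow> (nat \<Rightarrow> real) \<Rightarrow> (nat \<Rightarrow> nat \<Rightarrow> real) \<Rightarrow> bool" where
  "regular_form d \<alpha> \<beta> mu Sig \<longleftrightarrow>
     (\<forall>i<d. \<forall>l<d. Sig i l = Sig l i) \<and>
     vnorm d mu \<le> \<alpha> \<and> frob d Sig \<le> \<alpha> \<and>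
     (\<forall>x. (1 / \<beta>) * (\<Sum>i<d. (x i)^2) \<le> quadform d (\<lambda>i l. idm i l + Sig i l) x \<and>
          quadform d (\<lambda>i l. idm i l + Sig i l) x \<le> \<beta> * (\<Sum>i<d. (x i)^2))"

definition mono_exps :: "nat \<Rightarrow> nat \<Rightarrow> (nat \<Rightarrow> nat) set" where
  "mono_exps d m = {e. (\<forall>i. d \<le> i \<longrightarrow> e i = 0) \<and> (\<Sum>i<d. e i) \<le> m}"

definition poly_eval :: "nat \<Rightarrow> nat \<Rightarrow> ((nat \<Rightarrow> nat) \<Rightarrow> real) \<Rightarrow> (nat \<Rightarrow> real) \<Rightarrow> real" where
  "poly_eval d m c x = (\<Sum>e\<in>mono_exps d m. c e * (\<Prod>i<d. (x i) ^ e i))"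

(* homogenized univariate Hermite polynomial  hh n x s = H_n(x, y^2) with s = y^2 *)
fun hh :: "nat \<Rightarrow> real \<Rightarrow> real \<Rightarrow> real" where
  "hh 0 x s = 1"
| "hh (Suc 0) x s = x"
| "hh (Suc (Suc n)) x s = x * hh (Suc n) x s - real (Suc n) * s * hh n x s"

definition hermite_multi :: "nat \<Rightarrow> nat \<Rightarrow> (nat \<Rightarrow> real) \<Rightarrow> (nat \<Rightarrow> real) \<Rightarrow> real" where
  "hermite_multi d n X z = hh n (\<Sum>i<d. z i * X i) (\<Sum>i<d. (X i)^2)"

definition hermite_moment :: "nat \<Rightarrow> nat \<Rightarrow> ((nat \<Rightarrow> real) \<Rightarrow> real) \<Rightarrow> (nat \<Rightarrow> real) \<Rightarrow> real" where
  "hermite_moment d n f X = (\<integral>z. f z * hermite_multi d n X z \<partial>lebd d)"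

definition idx :: "nat \<Rightarrow> nat \<Rightarrow> nat list set" where
  "idx d r = {is. length is = r \<and> set is \<subseteq> {..<d}}"

definition tensor_pair :: "nat \<Rightarrow> nat \<Rightarrow> (nat list \<Rightarrow> real) \<Rightarrow> (nat \<Rightarrow> real) \<Rightarrow> real" where
  "tensor_pair d r T X = (\<Sum>is\<in>idx d r. T is * (\<Prod>k<r. X (is ! k)))"

definition sym_tensor :: "nat \<Rightarrow> nat \<Rightarrow> (nat list \<Rightarrow> real) \<Rightarrow> bool" where
  "sym_tensor d r T \<longleftrightarrow> (\<forall>is. is \<notin> idx d r \<longrightarrow> T is = 0) \<and>
     (\<forall>is\<in>idx d r. \<forall>js\<in>idx d r. mset is = mset js \<longrightarrow> T is = T js)"

definition tensor_of :: "nat \<Rightarrow> nat \<Rightarrow> ((nat \<Rightarrow> real) \<Rightarrow> real) \<Rightarrow> (nat list \<Rightarrow> real)" where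
  "tensor_of d r p = (THE T. sym_tensor d r T \<and> (\<forall>X. tensor_pair d r T X = p X))"

definition vnorm_poly :: "nat \<Rightarrow> nat \<Rightarrow> ((nat \<Rightarrow> real) \<Rightarrow> real) \<Rightarrow> real" where
  "vnorm_poly d r p = sqrt (\<Sum>is\<in>idx d r. (tensor_of d r p is)^2)"

end

theory Submission
  imports Defs "Jordan_Normal_Form.Determinant" "HOL-Computational_Algebra.Formal_Power_Series"
begin

text \<open>
  Each \<open>Q\<^sub>j G\<^sub>j\<close> can be written \<open>P\<^sub>j(-\<partial>) G\<^sub>j\<close> with \<open>deg P\<^sub>j \<le> m\<close>, and then \<open>h\<^sub>n\<close> is
  \<open>n!\<close> times the part of degree \<open>n\<close> of \<open>F = \<Sum>\<^sub>j P\<^sub>j exp E\<^sub>j\<close>, where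
  \<open>E\<^sub>j(X) = \<mu>\<^sub>j\<cdot>X + X\<cdot>\<Sigma>\<^sub>jX / 2\<close>. Induct on the number of Gaussians. Write \<open>F = exp E\<^sub>k \<cdot> H\<close> and
  let \<open>g\<^sub>s\<close> be the function belonging to \<open>exp E\<^sub>k(X) \<cdot> H(sX)\<close>, so that \<open>g\<^sub>1 = g\<close>. Its Gaussians have
  means \<open>\<mu>\<^sub>k + s(\<mu>\<^sub>j - \<mu>\<^sub>k)\<close> and covariances \<open>I + \<Sigma>\<^sub>k + s\<^sup>2(\<Sigma>\<^sub>j - \<Sigma>\<^sub>k)\<close>; regular form is a convex
  condition, so it is kept. The \<open>k\<close>-th summand of \<open>H\<close> is a polynomial of degree at most \<open>m\<close>, hence
  \<open>\<partial>\<^sub>s\<close> applied \<open>m + 1\<close> times removes it: the result is a mixture of the other Gaussians whose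
  Hermite moments are controlled by those of \<open>g\<close>, and the induction hypothesis bounds its L1 norm
  uniformly in \<open>s\<close>. Taylor's formula in \<open>s\<close> at \<open>0\<close> recovers \<open>g\<close>; the Taylor
  coefficients at \<open>s = 0\<close> are homogeneous Hermite functions of \<open>G\<^sub>k\<close> alone, and their L1 norm is at
  most their norm in \<open>L\<^sup>2(G\<^sub>k)\<close>, which is bounded by the tensor norm independently of the dimension.
\<close>

subsection \<open>Tensors\<close>

text \<open>Dividing F by exp E_k outright is not an option: the summands of H carry the forms
  \<open>\<Sigma>_j - \<Sigma>_k\<close>, and \<open>I + \<Sigma>_j - \<Sigma>_k\<close> may fail to
  be positive definite, so H need not belong to an integrable function. Restoring exp E_k after the
  dilation X -> s X avoids this, at the price of a whole path of mixtures. The other obstacle is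
  dimension. The P_j have no bound at all, since large terms may cancel in F; only the homogeneous
  parts of F are controlled. Tensor norms of forms are submultiplicative without a factor d, and
  d/ds acts by a scalar on the part of H of each degree, so these bounds pass from F to every
  derivative along the path. Monomials are labelled by lists of indices because these are the
  entries of tensors. Each elimination turns the degree bound m into m + 2 (m + 1). Numerical
  factors are absorbed by Q \<le> 2^Q \<le> (2 + \<alpha> + \<beta>)^Q, so one C can be both the
  exponent and the order of the moments.\<close>

definition mon :: "(nat \<Rightarrow> real) \<Rightarrow> nat list \<Rightarrow> real" where
  "mon X is = prod_list (map X is)"

lemma mon_simps [simp]: "mon X [] = 1" "mon X (a # is) = X a * mon X is"
  by (simp_all add: mon_def)

lemma mon_append: "mon X (is @ js) = mon X is * mon X js"
  by (simp add: mon_def)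

lemma mon_cong_mset: "mset is = mset js \<Longrightarrow> mon X is = mon X js"
proof -
  assume "mset is = mset js"
  hence "prod_mset (image_mset X (mset is)) = prod_mset (image_mset X (mset js))" by simp
  thus ?thesis by (simp add: mon_def flip: prod_mset_prod_list)
qed

lemma finite_idx [simp]: "finite (idx d r)"
  using finite_lists_length_eq[of "{..<d}" r] by (simp add: idx_def conj_commute)

lemma idx_0 [simp]: "idx d 0 = {[]}"
  by (auto simp: idx_def)

lemma tensor_pair_mon: "tensor_pair d r T X = (\<Sum>is\<in>idx d r. T is * mon X is)"
  unfolding tensor_pair_def
proof (rule sum.cong[OF refl])
  fix "is" assume "is \<in> idx d r"
  hence l: "length is = r" by (simp add: idx_def)
  have "mon X is = (\<Prod>k<r. X (is ! k))"
    by (simp add: mon_def prod.list_conv_set_nth l atLeast0LessThan)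
  thus "T is * (\<Prod>k<r. X (is ! k)) = T is * mon X is" by simp
qed

text \<open>The split-off entry may sit at any position l: differentiating a monomial, and
  integrating a Hermite function by parts, deletes an index wherever it stands.\<close>

lemma sum_idx_insert:
  fixes f :: "nat list \<Rightarrow> real"
  assumes "l \<le> r"
  shows "sum f (idx d (Suc r)) = (\<Sum>i<d. \<Sum>js\<in>idx d r. f (take l js @ i # drop l js))"
proof -
  have "sum f (idx d (Suc r)) = (\<Sum>(i,js)\<in>{..<d} \<times> idx d r. f (take l js @ i # drop l js))"
  proof (rule sum.reindex_bij_witness[of _ "\<lambda>(i,js). take l js @ i # drop l js"
        "\<lambda>is. (is ! l, take l is @ drop (Suc l) is)"], goal_cases)
    case (1 a)
    hence "l < length a" using assms by (auto simp: idx_def)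
    thus ?case by (simp add: min_absorb2 min_absorb1 Suc_diff_Suc id_take_nth_drop[symmetric])
  next
    case (2 a)
    hence *: "length a = Suc r" "set a \<subseteq> {..<d}" by (auto simp: idx_def)
    hence "a ! l \<in> set a" using assms by (intro nth_mem) simp
    hence "a ! l < d" using *(2) by blast
    moreover have "set (take l a @ drop (Suc l) a) \<subseteq> {..<d}"
      using *(2) set_take_subset[of l a] set_drop_subset[of "Suc l" a] by auto
    ultimately show ?case using * assms by (auto simp: idx_def)
  next
    case (3 b)
    then obtain i js where b: "b = (i,js)" "i < d" "length js = r" "set js \<subseteq> {..<d}"
      by (auto simp: idx_def)
    thus ?case using assms by (simp add: nth_append min_absorb2)
  next
    case (4 b)
    then obtain i js where b: "b = (i,js)" "i < d" "length js = r" "set js \<subseteq> {..<d}"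
      by (auto simp: idx_def)
    have "set (take l js) \<subseteq> {..<d}" "set (drop l js) \<subseteq> {..<d}"
      using b(4) set_take_subset[of l js] set_drop_subset[of l js] by auto
    thus ?case using assms b by (auto simp: idx_def)
  next
    case (5 a)
    hence "l < length a" using assms by (auto simp: idx_def)
    thus ?case by (simp add: min_absorb2 min_absorb1 Suc_diff_Suc id_take_nth_drop[symmetric])
  qed
  thus ?thesis by (simp add: sum.cartesian_product)
qed

lemma sum_idx_Suc:
  fixes f :: "nat list \<Rightarrow> real"
  shows "sum f (idx d (Suc r)) = (\<Sum>i<d. \<Sum>js\<in>idx d r. f (i # js))"
  using sum_idx_insert[of 0 r f d] by simp

lemma sum_idx_add:
  fixes f :: "nat list \<Rightarrow> real"
  shows "sum f (idx d (r + s)) = (\<Sum>is\<in>idx d r. \<Sum>js\<in>idx d s. f (is @ js))"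
proof (induction r arbitrary: f)
  case (Suc r)
  show ?case
    using Suc[of "\<lambda>is. f (_ # is)"] by (simp add: sum_idx_Suc)
qed simp

lemma mon_has_derivative:
  "((\<lambda>t. mon (X(i := t)) is) has_real_derivative
     (\<Sum>l<length is. if is ! l = i then mon X (take l is @ drop (Suc l) is) else 0)) (at (X i))"
proof (induction "is")
  case (Cons a "is")
  have 1: "((\<lambda>t. (X(i := t)) a) has_real_derivative (if a = i then 1 else 0)) (at (X i))"
    by (cases "a = i") auto
  have "mon (X(i := t)) (a # is) = (X(i := t)) a * mon (X(i := t)) is" for t
    by simp
  moreover have "(\<Sum>l<length (a # is). if (a # is) ! l = i then mon X (take l (a # is) @ drop (Suc l) (a # is)) else 0)
     = (if a = i then 1 else 0) * mon (X(i := X i)) is +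
       (\<Sum>l<length is. if is ! l = i then mon X (take l is @ drop (Suc l) is) else 0) * (X(i := X i)) a"
    unfolding list.size add_Suc_right add_0_right sum.lessThan_Suc_shift
    by (auto simp: sum_distrib_right intro!: sum.cong)
  ultimately show ?case
    using DERIV_mult[OF 1 Cons] by (simp only:)
qed simp

text \<open>U need not be symmetric. Its form determines only its symmetrization, and a pairing with
  a symmetric \<phi> sees nothing else. The induction differentiates the vanishing form once in each
  variable. Besides uniqueness of symmetric tensors, this carries identities between forms over to
  Hermite functions, which are symmetric in their indices.\<close>

lemma tensor_pair_zero_symmetric:
  assumes "\<And>X. tensor_pair d r U X = 0"
    and "\<And>is js. is \<in> idx d r \<Longrightarrow> mset is = mset js \<Longrightarrow> \<phi> is = \<phi> js"
  shows "(\<Sum>is\<in>idx d r. U is * \<phi> is) = (0::real)"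
  using assms
proof (induction r arbitrary: U \<phi>)
  case 0
  from 0(1)[of "\<lambda>_. 0"] show ?case by (simp add: tensor_pair_mon)
next
  case (Suc r)
  let ?ins = "\<lambda>l i js. take l js @ i # drop l js"
  \<comment> \<open>The form of \<open>V i\<close> is the partial derivative in X_i of the form of
    U: l runs over the positions at which i is deleted.\<close>
  define V where "V i js = (\<Sum>l\<le>r. U (?ins l i js))" for i js
  have pz: "tensor_pair d r (V i) X = 0" if i: "i < d" for i X
  proof -
    have len: "length is = Suc r" if "is \<in> idx d (Suc r)" for "is"
      using that by (simp add: idx_def)
    define D where "D is = (\<Sum>l<length is. if is ! l = i then mon X (take l is @ drop (Suc l) is) else 0)" for "is"
    have "((\<lambda>t. U is * mon (X(i := t)) is) has_real_derivative U is * D is) (at (X i))" for "is"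
      unfolding D_def by (rule DERIV_cmult[OF mon_has_derivative])
    hence "((\<lambda>t. \<Sum>is\<in>idx d (Suc r). U is * mon (X(i := t)) is) has_real_derivative
        (\<Sum>is\<in>idx d (Suc r). U is * D is)) (at (X i))"
      by (rule DERIV_sum)
    moreover have "(\<lambda>t. \<Sum>is\<in>idx d (Suc r). U is * mon (X(i := t)) is) = (\<lambda>t. 0)"
      using Suc.prems(1) by (simp add: tensor_pair_mon)
    ultimately have "((\<lambda>t. 0) has_real_derivative (\<Sum>is\<in>idx d (Suc r). U is * D is)) (at (X i))"
      by simp
    hence "0 = (\<Sum>is\<in>idx d (Suc r). U is * D is)"
      by (rule DERIV_unique[OF DERIV_const])
    also have "\<dots> = (\<Sum>is\<in>idx d (Suc r). \<Sum>l\<le>r. U is * (if is ! l = i then mon X (take l is @ drop (Suc l) is) else 0))"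
      by (intro sum.cong refl) (simp add: D_def sum_distrib_left len lessThan_Suc_atMost)
    also have "\<dots> = (\<Sum>l\<le>r. \<Sum>is\<in>idx d (Suc r). U is * (if is ! l = i then mon X (take l is @ drop (Suc l) is) else 0))"
      by (rule sum.swap)
    also have "\<dots> = (\<Sum>l\<le>r. \<Sum>js\<in>idx d r. U (?ins l i js) * mon X js)"
    proof (rule sum.cong[OF refl])
      fix l assume "l \<in> {..r}"
      hence l: "l \<le> r" by simp
      have "(\<Sum>is\<in>idx d (Suc r). U is * (if is ! l = i then mon X (take l is @ drop (Suc l) is) else 0))
        = (\<Sum>i'<d. \<Sum>js\<in>idx d r. if i' = i then U (?ins l i js) * mon X js else 0)"
        unfolding sum_idx_insert[OF l]
        by (intro sum.cong refl) (use l in \<open>auto simp: idx_def nth_append min_absorb2\<close>)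
      also have "\<dots> = (\<Sum>i'<d. if i' = i then (\<Sum>js\<in>idx d r. U (?ins l i js) * mon X js) else 0)"
        by (intro sum.cong refl) auto
      also have "\<dots> = (\<Sum>js\<in>idx d r. U (?ins l i js) * mon X js)"
        using i by simp
      finally show "(\<Sum>is\<in>idx d (Suc r). U is * (if is ! l = i then mon X (take l is @ drop (Suc l) is) else 0))
        = (\<Sum>js\<in>idx d r. U (?ins l i js) * mon X js)" .
    qed
    also have "\<dots> = (\<Sum>js\<in>idx d r. V i js * mon X js)"
      unfolding V_def sum_distrib_right by (rule sum.swap)
    finally show ?thesis by (simp add: tensor_pair_mon)
  qed
  have ms: "mset (?ins l i js) = mset (i # js)" for l i js
  proof -
    have "mset (take l js) + mset (drop l js) = mset js"
      by (simp flip: mset_append)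
    thus ?thesis by simp
  qed
  have mem: "?ins l i js \<in> idx d (Suc r)" if "i < d" "js \<in> idx d r" for l i js
    using that mset_eq_length[OF ms[of l js i]] mset_eq_setD[OF ms[of l js i]]
    unfolding idx_def by simp
  have z: "(\<Sum>js\<in>idx d r. V i js * \<phi> (i # js)) = 0" if i: "i < d" for i
  proof (rule Suc.IH)
    show "tensor_pair d r (V i) X = 0" for X by (rule pz[OF i])
    show "\<phi> (i # is) = \<phi> (i # js)" if "is \<in> idx d r" "mset is = mset js" for "is" js
      using that i by (intro Suc.prems(2)) (auto simp: idx_def)
  qed
  \<comment> \<open>Euler's identity: splitting off the entry at each of the r + 1 positions counts
    the sum r + 1 times, and the symmetry of \<phi> moves the inserted index to the front.\<close>
  have "real (Suc r) * (\<Sum>is\<in>idx d (Suc r). U is * \<phi> is) = (\<Sum>l\<le>r. \<Sum>is\<in>idx d (Suc r). U is * \<phi> is)"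
    by simp
  also have "\<dots> = (\<Sum>l\<le>r. \<Sum>i<d. \<Sum>js\<in>idx d r. U (?ins l i js) * \<phi> (?ins l i js))"
    by (intro sum.cong refl sum_idx_insert) simp
  also have "\<dots> = (\<Sum>l\<le>r. \<Sum>i<d. \<Sum>js\<in>idx d r. U (?ins l i js) * \<phi> (i # js))"
  proof (intro sum.cong refl)
    fix l i js assume "i \<in> {..<d}" "js \<in> idx d r"
    thus "U (?ins l i js) * \<phi> (?ins l i js) = U (?ins l i js) * \<phi> (i # js)"
      using Suc.prems(2)[OF mem ms] by simp
  qed
  also have "\<dots> = (\<Sum>i<d. \<Sum>js\<in>idx d r. V i js * \<phi> (i # js))"
    unfolding V_def sum_distrib_right
    by (subst sum.swap, intro sum.cong refl, rule sum.swap)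
  also have "\<dots> = 0" using z by simp
  finally show ?case by simp
qed

section \<open>Forms given by tensors of bounded norm\<close>

definition tnorm :: "nat \<Rightarrow> nat \<Rightarrow> (nat list \<Rightarrow> real) \<Rightarrow> real" where
  "tnorm d r T = L2_set T (idx d r)"

text \<open>Any tensor with the form p may witness the bound, not just the symmetric one, so that
  sums and products require no symmetrization.\<close>

definition form_bound :: "nat \<Rightarrow> nat \<Rightarrow> ((nat \<Rightarrow> real) \<Rightarrow> real) \<Rightarrow> real \<Rightarrow> bool" where
  "form_bound d r p e \<longleftrightarrow> (\<exists>T. (\<forall>X. tensor_pair d r T X = p X) \<and> tnorm d r T \<le> e)"

lemma form_bound_nonneg: "form_bound d r p e \<Longrightarrow> 0 \<le> e"
  unfolding form_bound_def tnorm_def using L2_set_nonneg order_trans by blast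

lemma form_bound_mono: "form_bound d r p e \<Longrightarrow> e \<le> e' \<Longrightarrow> form_bound d r p e'"
  unfolding form_bound_def by (meson order_trans)

lemma form_bound_zero: "form_bound d r (\<lambda>X. 0) 0"
  unfolding form_bound_def by (rule exI[of _ "\<lambda>_. 0"]) (simp add: tensor_pair_mon tnorm_def L2_set_def)

lemma form_bound_const: "form_bound d 0 (\<lambda>X. c) \<bar>c\<bar>"
  unfolding form_bound_def by (rule exI[of _ "\<lambda>_. c"]) (simp add: tensor_pair_mon tnorm_def L2_set_def)

lemma form_bound_add:
  assumes "form_bound d r p e" "form_bound d r p' e'"
  shows "form_bound d r (\<lambda>X. p X + p' X) (e + e')"
proof -
  from assms obtain T T' where T: "\<And>X. tensor_pair d r T X = p X" "tnorm d r T \<le> e"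
    "\<And>X. tensor_pair d r T' X = p' X" "tnorm d r T' \<le> e'"
    unfolding form_bound_def by blast
  show ?thesis unfolding form_bound_def
  proof (intro exI conjI allI)
    show "tensor_pair d r (\<lambda>is. T is + T' is) X = p X + p' X" for X
      using T(1,3) by (simp add: tensor_pair_mon sum.distrib distrib_right)
    show "tnorm d r (\<lambda>is. T is + T' is) \<le> e + e'"
      using T(2,4) L2_set_triangle_ineq[of T T' "idx d r"] by (simp add: tnorm_def)
  qed
qed

lemma form_bound_scale:
  assumes "form_bound d r p e"
  shows "form_bound d r (\<lambda>X. c * p X) (\<bar>c\<bar> * e)"
proof -
  from assms obtain T where T: "\<And>X. tensor_pair d r T X = p X" "tnorm d r T \<le> e"
    unfolding form_bound_def by blast
  show ?thesis unfolding form_bound_def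
  proof (intro exI conjI allI)
    show "tensor_pair d r (\<lambda>is. c * T is) X = c * p X" for X
      using T(1)[of X, symmetric] by (simp add: tensor_pair_mon sum_distrib_left mult.assoc)
    have "tnorm d r (\<lambda>is. c * T is) = \<bar>c\<bar> * tnorm d r T"
      by (simp add: tnorm_def L2_set_def power_mult_distrib real_sqrt_mult flip: sum_distrib_left)
    thus "tnorm d r (\<lambda>is. c * T is) \<le> \<bar>c\<bar> * e"
      using T(2) by (simp add: mult_left_mono)
  qed
qed

lemma form_bound_sum:
  assumes "finite A" "\<And>a. a \<in> A \<Longrightarrow> form_bound d r (p a) (e a)"
  shows "form_bound d r (\<lambda>X. \<Sum>a\<in>A. p a X) (\<Sum>a\<in>A. e a)"
  using assms by (induction A rule: finite_induct) (auto intro: form_bound_zero form_bound_add)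

text \<open>The tensor product is a witness, and its Euclidean norm is exactly the product of the
  two norms. This is why no estimate for forms picks up a factor d.\<close>

lemma form_bound_mult:
  assumes "form_bound d r p e" "form_bound d s p' e'"
  shows "form_bound d (r + s) (\<lambda>X. p X * p' X) (e * e')"
proof -
  from assms obtain T T' where T: "\<And>X. tensor_pair d r T X = p X" "tnorm d r T \<le> e"
    "\<And>X. tensor_pair d s T' X = p' X" "tnorm d s T' \<le> e'"
    unfolding form_bound_def by blast
  define U where "U is = T (take r is) * T' (drop r is)" for "is"
  have U: "U (is @ js) = T is * T' js" if "is \<in> idx d r" for "is" js
    using that by (simp add: U_def idx_def)
  show ?thesis unfolding form_bound_def
  proof (intro exI conjI allI)
    show "tensor_pair d (r + s) U X = p X * p' X" for X
      unfolding T(1,3)[symmetric] tensor_pair_mon sum_idx_add sum_product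
      by (intro sum.cong refl) (simp add: U mon_append)
    have "tnorm d (r + s) U = tnorm d r T * tnorm d s T'"
      by (simp add: tnorm_def L2_set_def sum_idx_add U power_mult_distrib
          sum_product real_sqrt_mult[symmetric] cong: sum.cong)
    thus "tnorm d (r + s) U \<le> e * e'"
      using T(2,4) by (simp add: mult_mono' tnorm_def)
  qed
qed

lemma form_bound_linear: "form_bound d 1 (\<lambda>X. \<Sum>i<d. mu i * X i) (vnorm d mu)"
  unfolding form_bound_def
  by (rule exI[of _ "\<lambda>is. mu (hd is)"])
    (simp add: tensor_pair_mon tnorm_def L2_set_def vnorm_def sum_idx_Suc)

lemma form_bound_quadform: "form_bound d 2 (quadform d S) (frob d S)"
  unfolding form_bound_def
  by (rule exI[of _ "\<lambda>is. S (is ! 0) (is ! 1)"])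
    (simp add: tensor_pair_mon tnorm_def L2_set_def frob_def quadform_def numeral_2_eq_2 sum_idx_Suc mult_ac)

lemma form_bound_mon:
  assumes "set is \<subseteq> {..<d}"
  shows "form_bound d (length is) (\<lambda>X. mon X is) 1"
  unfolding form_bound_def
proof (intro exI conjI allI)
  let ?T = "\<lambda>js. if js = is then 1 else 0 :: real"
  have i: "is \<in> idx d (length is)" using assms by (simp add: idx_def)
  show "tensor_pair d (length is) ?T X = mon X is" for X
  proof -
    have "tensor_pair d (length is) ?T X = (\<Sum>js\<in>idx d (length is). if js = is then mon X is else 0)"
      unfolding tensor_pair_mon by (rule sum.cong) auto
    thus ?thesis using i by simp
  qed
  have "(\<Sum>js\<in>idx d (length is). (?T js)\<^sup>2) = (\<Sum>js\<in>idx d (length is). if js = is then 1 else 0)"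
    by (rule sum.cong) auto
  thus "tnorm d (length is) ?T \<le> 1" using i by (simp add: tnorm_def L2_set_def)
qed

text \<open>\<open>form_bound\<close> provides some tensor for p; averaging it over the
  rearrangements of each index list makes it symmetric without changing its form. Together with
  uniqueness, this shows that the description defining \<open>tensor_of\<close> is met.\<close>

lemma tensor_of_pair:
  assumes "form_bound d r p e"
  shows "tensor_pair d r (tensor_of d r p) X = p X"
proof -
  from assms obtain T where T: "\<And>X. tensor_pair d r T X = p X"
    unfolding form_bound_def by blast
  define cls where "cls is = {js \<in> idx d r. mset js = mset is}" for "is"
  define U where "U is = (if is \<in> idx d r then (\<Sum>js\<in>cls is. T js) / card (cls is) else 0)" for "is"
  have "sym_tensor d r U"
    by (auto simp: sym_tensor_def U_def cls_def)
  moreover have "tensor_pair d r U X = p X" for X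
  proof -
    have "tensor_pair d r U X = (\<Sum>is\<in>idx d r. \<Sum>js\<in>idx d r. if mset js = mset is then T js * mon X js / card (cls js) else 0)"
      unfolding tensor_pair_mon
    proof (rule sum.cong[OF refl])
      fix "is" assume i: "is \<in> idx d r"
      have "U is * mon X is = (\<Sum>js\<in>cls is. T js * mon X is / card (cls is))"
        using i by (simp add: U_def sum_distrib_right sum_divide_distrib)
      also have "\<dots> = (\<Sum>js\<in>cls is. T js * mon X js / card (cls js))"
      proof (intro sum.cong refl)
        fix js assume "js \<in> cls is"
        hence "mset js = mset is" by (simp add: cls_def)
        thus "T js * mon X is / card (cls is) = T js * mon X js / card (cls js)"
          using mon_cong_mset[of js "is" X] by (simp add: cls_def)
      qed
      also have "\<dots> = (\<Sum>js\<in>idx d r. if mset js = mset is then T js * mon X js / card (cls js) else 0)"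
        unfolding cls_def by (rule sum.inter_filter) simp
      finally show "U is * mon X is = \<dots>" .
    qed
    also have "\<dots> = (\<Sum>js\<in>idx d r. \<Sum>is\<in>idx d r. if mset js = mset is then T js * mon X js / card (cls js) else 0)"
      by (rule sum.swap)
    also have "\<dots> = (\<Sum>js\<in>idx d r. T js * mon X js)"
    proof (rule sum.cong[OF refl])
      fix js assume j: "js \<in> idx d r"
      have "(\<Sum>is\<in>idx d r. if mset js = mset is then T js * mon X js / card (cls js) else 0)
          = (\<Sum>is\<in>cls js. T js * mon X js / card (cls js))"
        unfolding cls_def by (subst sum.inter_filter) (auto intro: sum.cong)
      also have "\<dots> = T js * mon X js"
        using j by (auto simp: cls_def card_eq_0_iff)
      finally show "(\<Sum>is\<in>idx d r. if mset js = mset is then T js * mon X js / card (cls js) else 0)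
          = T js * mon X js" .
    qed
    finally show ?thesis using T by (simp add: tensor_pair_mon)
  qed
  moreover have "V = W" if V: "sym_tensor d r V" "\<forall>X. tensor_pair d r V X = p X"
    and W: "sym_tensor d r W" "\<forall>X. tensor_pair d r W X = p X" for V W
  proof -
    \<comment> \<open>The difference of two symmetric candidates is symmetric, so it may be paired
      with itself, giving a vanishing sum of squares.\<close>
    have "(\<Sum>is\<in>idx d r. (V is - W is) * (V is - W is)) = 0"
    proof (rule tensor_pair_zero_symmetric)
      show "tensor_pair d r (\<lambda>is. V is - W is) X = 0" for X
        using V(2) W(2) by (simp add: tensor_pair_mon left_diff_distrib sum_subtractf)
      show "V is - W is = V js - W js" if "is \<in> idx d r" "mset is = mset js" for "is" js
      proof -
        have "js \<in> idx d r"
          using that mset_eq_length[OF that(2)] mset_eq_setD[OF that(2)] by (auto simp: idx_def)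
        thus ?thesis using V(1) W(1) that unfolding sym_tensor_def by metis
      qed
    qed
    hence "\<forall>is\<in>idx d r. (V is - W is) * (V is - W is) = 0"
      by (subst (asm) sum_nonneg_eq_0_iff) auto
    hence "\<forall>is\<in>idx d r. V is = W is" by simp
    thus ?thesis using V(1) W(1) unfolding sym_tensor_def by (intro ext) metis
  qed
  ultimately have "\<exists>!V. sym_tensor d r V \<and> (\<forall>X. tensor_pair d r V X = p X)" by blast
  from theI'[OF this] show ?thesis unfolding tensor_of_def by blast
qed

text \<open>The bound e certifies that p is a form, so that \<open>tensor_of\<close> denotes its
  tensor; the norm of that tensor then yields e'.\<close>

lemma form_bound_vnorm_poly:
  assumes "form_bound d r p e" "vnorm_poly d r p \<le> e'"
  shows "form_bound d r p e'"
  using tensor_of_pair[OF assms(1)] assms(2)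
  unfolding form_bound_def vnorm_poly_def tnorm_def L2_set_def by blast

subsection \<open>Positive definite matrices\<close>

definition pdm :: "nat \<Rightarrow> real \<Rightarrow> (nat \<Rightarrow> nat \<Rightarrow> real) \<Rightarrow> bool" where
  "pdm d \<beta> S \<longleftrightarrow> 0 < \<beta> \<and> (\<forall>i<d. \<forall>l<d. S i l = S l i) \<and>
     (\<forall>x. (1 / \<beta>) * (\<Sum>i<d. (x i)^2) \<le> quadform d S x \<and> quadform d S x \<le> \<beta> * (\<Sum>i<d. (x i)^2))"

definition mv :: "nat \<Rightarrow> (nat \<Rightarrow> nat \<Rightarrow> real) \<Rightarrow> (nat \<Rightarrow> real) \<Rightarrow> nat \<Rightarrow> real" where
  "mv d A x i = (\<Sum>l<d. A i l * x l)"

lemma quadform_mv: "quadform d A x = (\<Sum>i<d. x i * mv d A x i)"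
  by (simp add: quadform_def mv_def sum_distrib_left mult_ac)

lemma sum_idm [simp]:
  "l < d \<Longrightarrow> (\<Sum>r<d. f r * idm r l) = f l" "i < d \<Longrightarrow> (\<Sum>r<d. idm i r * f r) = f i"
  by (auto simp: idm_def if_distrib[of "(*) _"] if_distrib[of "\<lambda>x. x * _"] sum.delta sum.delta' cong: if_cong)

lemma sum_mult_assoc:
  fixes A B C :: "nat \<Rightarrow> nat \<Rightarrow> real"
  shows "(\<Sum>r<d. (\<Sum>q<d. A i q * B q r) * C r l) = (\<Sum>q<d. A i q * (\<Sum>r<d. B q r * C r l))"
  by (simp add: sum_distrib_left sum_distrib_right mult.assoc, rule sum.swap)

lemma quadform_shift:
  assumes "\<forall>i<d. \<forall>l<d. S i l = S l i"
  shows "quadform d S (\<lambda>i. x i + c * y i) = quadform d S x + 2 * c * (\<Sum>i<d. y i * mv d S x i) + c\<^sup>2 * quadform d S y"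
proof -
  have "(\<Sum>i<d. \<Sum>l<d. x i * S i l * y l) = (\<Sum>l<d. \<Sum>i<d. x i * S i l * y l)"
    by (rule sum.swap)
  also have "\<dots> = (\<Sum>l<d. \<Sum>i<d. y l * S l i * x i)"
    using assms by (intro sum.cong refl) (simp add: mult_ac)
  finally have *: "(\<Sum>i<d. \<Sum>l<d. x i * S i l * y l) = (\<Sum>i<d. y i * mv d S x i)"
    by (simp add: mv_def sum_distrib_left mult_ac)
  have "quadform d S (\<lambda>i. x i + c * y i) = (\<Sum>i<d. \<Sum>l<d. x i * S i l * x l) + c * (\<Sum>i<d. \<Sum>l<d. x i * S i l * y l)
     + c * (\<Sum>i<d. \<Sum>l<d. y i * S i l * x l) + c\<^sup>2 * (\<Sum>i<d. \<Sum>l<d. y i * S i l * y l)"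
    by (simp add: quadform_def sum_distrib_left flip: sum.distrib) (intro sum.cong refl, simp add: algebra_simps power2_eq_square)
  also have "(\<Sum>i<d. \<Sum>l<d. y i * S i l * x l) = (\<Sum>i<d. y i * mv d S x i)"
    by (simp add: mv_def sum_distrib_left mult_ac)
  finally show ?thesis unfolding * by (simp add: quadform_def)
qed

lemma pdm_combine:
  assumes "pdm d \<beta> S" "pdm d \<beta> T" "0 \<le> a" "a \<le> 1"
  shows "pdm d \<beta> (\<lambda>i l. S i l + a * (T i l - S i l))"
proof -
  have q: "quadform d (\<lambda>i l. S i l + a * (T i l - S i l)) x = (1 - a) * quadform d S x + a * quadform d T x" for x
    by (simp add: quadform_def sum_distrib_left flip: sum.distrib) (simp add: algebra_simps)
  have "1 / \<beta> * (\<Sum>i<d. (x i)^2) \<le> (1 - a) * quadform d S x + a * quadform d T x" for x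
  proof -
    have "(1 - a) * (1 / \<beta> * (\<Sum>i<d. (x i)^2)) \<le> (1 - a) * quadform d S x"
      and "a * (1 / \<beta> * (\<Sum>i<d. (x i)^2)) \<le> a * quadform d T x"
      using assms unfolding pdm_def by (intro mult_left_mono; simp)+
    from add_mono[OF this] show ?thesis by (simp add: left_diff_distrib diff_divide_distrib)
  qed
  moreover have "(1 - a) * quadform d S x + a * quadform d T x \<le> \<beta> * (\<Sum>i<d. (x i)^2)" for x
    using assms unfolding pdm_def by (intro convex_bound_le) auto
  ultimately show ?thesis using assms unfolding pdm_def q by simp
qed

lemma permutes_lt: "p permutes {..<d} \<Longrightarrow> i < d \<Longrightarrow> p i < (d::nat)"
  using permutes_in_image[of p "{..<d}" i] by simp

section \<open>Determinants, and their derivative at the identity\<close>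

lemma mdet_det: "mdet d S = det (mat d d (\<lambda>(i,l). S i l))"
  unfolding mdet_def
  by (subst det_def'[OF mat_carrier])
    (auto simp: atLeast0LessThan permutes_lt intro!: sum.cong arg_cong2[where f = "(*)"] prod.cong)

lemma mdet_mult: "mdet d (\<lambda>i l. \<Sum>r<d. A i r * B r l) = mdet d A * mdet d B"
proof -
  have "mat d d (\<lambda>(i,l). \<Sum>r<d. A i r * B r l) = mat d d (\<lambda>(i,l). A i l) * mat d d (\<lambda>(i,l). B i l)"
    by (rule eq_matI) (auto simp: scalar_prod_def atLeast0LessThan intro!: sum.cong)
  thus ?thesis unfolding mdet_det by (simp add: det_mult[OF mat_carrier mat_carrier])
qed

lemma mdet_cong: "(\<And>i l. i < d \<Longrightarrow> l < d \<Longrightarrow> A i l = B i l) \<Longrightarrow> mdet d A = mdet d B"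
  unfolding mdet_def by (auto intro!: sum.cong prod.cong arg_cong2[where f = "(*)"] simp: permutes_lt)

text \<open>A permutation fixing every index but one fixes that one too. Hence only the identity
  permutation contributes to the derivative of the determinant at the identity matrix, which becomes
  a trace.\<close>

lemma prod_idm_permutes:
  assumes p: "p permutes {..<d}" and i: "i < d"
  shows "(\<Prod>l\<in>{..<d} - {i}. idm l (p l)) = (if p = id then 1 else 0)"
proof (cases "\<forall>l\<in>{..<d} - {i}. p l = l")
  case True
  have pi: "p i \<in> {..<d}" using permutes_in_image[OF p] i by blast
  have "p i = i"
  proof (rule ccontr)
    assume "p i \<noteq> i"
    hence "p (p i) = p i" using True pi by blast
    hence "p i = i" using permutes_inj[OF p] by (metis injD)
    thus False using \<open>p i \<noteq> i\<close> by simp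
  qed
  hence "p l = l" for l
    using True permutes_not_in[OF p, of l] by blast
  hence "p = id" by auto
  thus ?thesis by (simp add: idm_def)
next
  case False
  hence "(\<Prod>l\<in>{..<d} - {i}. idm l (p l)) = 0"
    by (subst prod_zero_iff) (simp, force simp: idm_def)
  thus ?thesis using False by auto
qed

lemma mdet_idm [simp]: "mdet d idm = 1"
proof -
  have "mat d d (\<lambda>(i,l). idm i l) = 1\<^sub>m d" by (rule eq_matI) (auto simp: idm_def)
  thus ?thesis by (simp add: mdet_det)
qed

lemma has_real_derivative_prod_within:
  fixes f :: "real \<Rightarrow> 'a \<Rightarrow> real"
  assumes "finite I" "\<And>i. i \<in> I \<Longrightarrow> ((\<lambda>s. f s i) has_real_derivative f' i) (at s0 within A)"
  shows "((\<lambda>s. \<Prod>i\<in>I. f s i) has_real_derivative (\<Sum>i\<in>I. f' i * (\<Prod>l\<in>I - {i}. f s0 l))) (at s0 within A)"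
  using assms
proof (induction I rule: finite_induct)
  case (insert x I)
  have 1: "(\<Prod>l\<in>insert x I - {i}. f s0 l) = f s0 x * (\<Prod>l\<in>I - {i}. f s0 l)" if "i \<in> I" for i
  proof -
    have "insert x I - {i} = insert x (I - {i})" using that insert.hyps by auto
    thus ?thesis using insert.hyps by simp
  qed
  have 2: "insert x I - {x} = I" using insert.hyps by auto
  have "(\<Sum>i\<in>insert x I. f' i * (\<Prod>l\<in>insert x I - {i}. f s0 l))
      = f' x * (\<Prod>i\<in>I. f s0 i) + (\<Sum>i\<in>I. f' i * (\<Prod>l\<in>I - {i}. f s0 l)) * f s0 x"
    using insert.hyps 2 by (simp add: 1 sum_distrib_right sum_distrib_left mult_ac)
  thus ?case
    using insert.hyps DERIV_mult[OF insert.prems[of x] insert.IH] insert.prems by simp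
qed simp

lemma mdet_derivative_idm:
  assumes N: "\<And>i l. i < d \<Longrightarrow> l < d \<Longrightarrow> ((\<lambda>s. N s i l) has_real_derivative N' i l) (at s0 within A)"
    and N0: "\<And>i l. i < d \<Longrightarrow> l < d \<Longrightarrow> N s0 i l = idm i l"
  shows "((\<lambda>s. mdet d (N s)) has_real_derivative (\<Sum>i<d. N' i i)) (at s0 within A)"
proof -
  have "((\<lambda>s. of_int (sign p) * (\<Prod>i<d. N s i (p i))) has_real_derivative
     (if p = id then (\<Sum>i<d. N' i i) else 0)) (at s0 within A)" if p: "p permutes {..<d}" for p
  proof -
    have pl: "p i < d" if "i < d" for i using permutes_in_image[OF p] that by blast
    have "((\<lambda>s. \<Prod>i<d. N s i (p i)) has_real_derivative
        (\<Sum>i<d. N' i (p i) * (\<Prod>l\<in>{..<d} - {i}. N s0 l (p l)))) (at s0 within A)"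
      by (rule has_real_derivative_prod_within) (use N pl in auto)
    moreover have "(\<Prod>l\<in>{..<d} - {i}. N s0 l (p l)) = (if p = id then 1 else 0)" if "i < d" for i
    proof -
      have "(\<Prod>l\<in>{..<d} - {i}. N s0 l (p l)) = (\<Prod>l\<in>{..<d} - {i}. idm l (p l))"
        using N0 pl by (intro prod.cong) auto
      thus ?thesis using prod_idm_permutes[OF p that] by simp
    qed
    hence "(\<Sum>i<d. N' i (p i) * (\<Prod>l\<in>{..<d} - {i}. N s0 l (p l))) = (if p = id then (\<Sum>i<d. N' i i) else 0)"
      by auto
    ultimately have "((\<lambda>s. \<Prod>i<d. N s i (p i)) has_real_derivative (if p = id then (\<Sum>i<d. N' i i) else 0)) (at s0 within A)"
      by (simp only:)
    from DERIV_cmult[OF this, of "of_int (sign p)"] show ?thesis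
      by (cases "p = id") auto
  qed
  note * = this
  have "((\<lambda>s. mdet d (N s)) has_real_derivative
     (\<Sum>p\<in>{p. p permutes {..<d}}. (if p = id then (\<Sum>i<d. N' i i) else 0))) (at s0 within A)"
    unfolding mdet_def by (rule DERIV_sum) (rule *, simp)
  moreover have "(\<Sum>p\<in>{p. p permutes {..<d}}. (if p = id then (\<Sum>i<d. N' i i) else 0)) = (\<Sum>i<d. N' i i)"
    by (simp add: finite_permutations permutes_id)
  ultimately show ?thesis by (simp only:)
qed

lemma mdet_nonzero:
  assumes "pdm d \<beta> S"
  shows "mdet d S \<noteq> 0"
proof
  let ?A = "mat d d (\<lambda>(i,l). S i l)"
  assume "mdet d S = 0"
  then obtain v where v: "v \<in> carrier_vec d" "v \<noteq> 0\<^sub>v d" "?A *\<^sub>v v = 0\<^sub>v d"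
    unfolding mdet_det det_0_iff_vec_prod_zero_field[OF mat_carrier] by blast
  have "mv d S (\<lambda>i. v $ i) i = 0" if "i < d" for i
  proof -
    have "(?A *\<^sub>v v) $ i = mv d S (\<lambda>i. v $ i) i"
      using that v(1) by (auto simp: scalar_prod_def mv_def atLeast0LessThan intro!: sum.cong)
    thus ?thesis using v(3) that by simp
  qed
  hence "quadform d S (\<lambda>i. v $ i) = 0" by (simp add: quadform_mv)
  hence "1 / \<beta> * (\<Sum>i<d. (v $ i)\<^sup>2) \<le> 0" and "0 < \<beta>"
    using assms unfolding pdm_def by (metis, simp)
  hence "(\<Sum>i<d. (v $ i)\<^sup>2) \<le> 0"
    by (simp add: divide_le_0_iff)
  hence "(\<Sum>i<d. (v $ i)\<^sup>2) = 0"
    by (intro antisym sum_nonneg) auto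
  hence "\<forall>i<d. v $ i = 0"
    by (subst (asm) sum_nonneg_eq_0_iff) auto
  hence "v = 0\<^sub>v d" using v(1) by (intro eq_vecI) auto
  thus False using v(2) by simp
qed

section \<open>Inverses and the bounds they inherit\<close>

lemma minv_spec:
  assumes "pdm d \<beta> S"
  defines "B \<equiv> minv d S"
  shows "d \<le> i \<or> d \<le> l \<Longrightarrow> B i l = 0"
    and "i < d \<Longrightarrow> l < d \<Longrightarrow> (\<Sum>r<d. S i r * B r l) = idm i l"
    and "i < d \<Longrightarrow> l < d \<Longrightarrow> (\<Sum>r<d. B i r * S r l) = idm i l"
    and "B i l = B l i"
proof -
  let ?A = "mat d d (\<lambda>(i,l). S i l)"
  let ?P = "\<lambda>B. (\<forall>i l. (d \<le> i \<or> d \<le> l) \<longrightarrow> B i l = 0) \<and>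
                      (\<forall>i<d. \<forall>l<d. (\<Sum>r<d. S i r * B r l) = idm i l)"
  have "det ?A \<noteq> 0" using mdet_nonzero[OF assms(1)] by (simp add: mdet_det)
  from det_non_zero_imp_unit[OF mat_carrier this, of "()"]
  obtain C where C: "C \<in> carrier_mat d d" "?A * C = 1\<^sub>m d" "C * ?A = 1\<^sub>m d"
    unfolding Units_def ring_mat_simps by auto
  define D where "D i l = (if i < d \<and> l < d then C $$ (i,l) else 0)" for i l
  have r: "(\<Sum>r<d. S i r * D r l) = idm i l" if "i < d" "l < d" for i l
  proof -
    have "(?A * C) $$ (i,l) = (\<Sum>r<d. S i r * D r l)"
      using that C(1) by (auto simp: scalar_prod_def atLeast0LessThan D_def intro!: sum.cong)
    thus ?thesis using that C(2) by (simp add: idm_def)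
  qed
  have l: "(\<Sum>r<d. D i r * S r l) = idm i l" if "i < d" "l < d" for i l
  proof -
    have "(C * ?A) $$ (i,l) = (\<Sum>r<d. D i r * S r l)"
      using that C(1) by (auto simp: scalar_prod_def atLeast0LessThan D_def intro!: sum.cong)
    thus ?thesis using that C(3) by (simp add: idm_def)
  qed
  have uniq: "E = D" if E: "?P E" for E
  proof (intro ext)
    fix i l
    show "E i l = D i l"
    proof (cases "i < d \<and> l < d")
      case True
      have "E i l = (\<Sum>r<d. idm i r * E r l)" using True by simp
      also have "\<dots> = (\<Sum>r<d. (\<Sum>q<d. D i q * S q r) * E r l)" using l True by simp
      also have "\<dots> = (\<Sum>q<d. D i q * (\<Sum>r<d. S q r * E r l))" by (rule sum_mult_assoc)
      also have "\<dots> = (\<Sum>q<d. D i q * idm q l)" using E True by simp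
      also have "\<dots> = D i l" using True by simp
      finally show ?thesis .
    qed (use E in \<open>auto simp: D_def not_less\<close>)
  qed
  have PD: "?P D" using r by (auto simp: D_def)
  have BD: "B = D" unfolding B_def minv_def
    by (rule the_equality) (use PD uniq in blast)+
  show "d \<le> i \<or> d \<le> l \<Longrightarrow> B i l = 0" using PD BD by blast
  show "i < d \<Longrightarrow> l < d \<Longrightarrow> (\<Sum>r<d. S i r * B r l) = idm i l" using r BD by blast
  show "i < d \<Longrightarrow> l < d \<Longrightarrow> (\<Sum>r<d. B i r * S r l) = idm i l" using l BD by blast
  \<comment> \<open>The inverse is symmetric because its transpose meets the same description, S
    being symmetric.\<close>
  have "?P (\<lambda>i l. D l i)"
  proof (intro conjI allI impI)
    fix i l assume il: "i < d" "l < d"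
    have "(\<Sum>r<d. S i r * D l r) = (\<Sum>r<d. D l r * S r i)"
      using assms(1) il by (intro sum.cong refl) (simp add: pdm_def mult.commute)
    thus "(\<Sum>r<d. S i r * D l r) = idm i l" using l il by (simp add: idm_def)
  qed (auto simp: D_def)
  from uniq[OF this] show "B i l = B l i" unfolding BD by metis
qed

lemma minv_unique:
  assumes "pdm d \<beta> S" "\<And>i l. d \<le> i \<or> d \<le> l \<Longrightarrow> D i l = 0"
    "\<And>i l. i < d \<Longrightarrow> l < d \<Longrightarrow> (\<Sum>r<d. S i r * D r l) = idm i l"
  shows "minv d S = D"
proof (intro ext)
  fix i l
  note B = minv_spec[OF assms(1)]
  show "minv d S i l = D i l"
  proof (cases "i < d \<and> l < d")
    case True
    have "D i l = (\<Sum>r<d. idm i r * D r l)" using True by simp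
    also have "\<dots> = (\<Sum>r<d. (\<Sum>q<d. minv d S i q * S q r) * D r l)" using B(3) True by simp
    also have "\<dots> = (\<Sum>q<d. minv d S i q * (\<Sum>r<d. S q r * D r l))" by (rule sum_mult_assoc)
    also have "\<dots> = minv d S i l" using assms(3) True by simp
    finally show ?thesis by simp
  next
    case False
    hence "d \<le> i \<or> d \<le> l" by auto
    thus ?thesis using B(1) assms(2) by simp
  qed
qed

lemma mv_minv:
  assumes "pdm d \<beta> S" "i < d"
  shows "mv d S (mv d (minv d S) u) i = u i"
proof -
  have "mv d S (mv d (minv d S) u) i = (\<Sum>l<d. (\<Sum>r<d. S i r * minv d S r l) * u l)"
    unfolding mv_def by (rule sum_mult_assoc[where C = "\<lambda>l _. u l", symmetric])
  thus ?thesis using minv_spec(2)[OF assms(1)] assms(2) by simp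
qed

text \<open>With w the image of u under the inverse, w . S w = w . u. The lower bound on S makes the
  left side at least |w|^2 / \<beta>, half of which absorbs the w-part of Young's inequality for the
  right side.\<close>

lemma minv_norm_le:
  assumes p: "pdm d \<beta> S"
  shows "(\<Sum>i<d. (mv d (minv d S) u i)\<^sup>2) \<le> \<beta>\<^sup>2 * (\<Sum>i<d. (u i)\<^sup>2)"
proof -
  define w where "w = mv d (minv d S) u"
  have b: "0 < \<beta>" using p by (simp add: pdm_def)
  have "1 / \<beta> * (\<Sum>i<d. (w i)^2) \<le> quadform d S w" using p by (simp add: pdm_def)
  also have "\<dots> = (\<Sum>i<d. w i * u i)"
    unfolding quadform_mv using mv_minv[OF p] by (simp add: w_def)
  also have "\<dots> \<le> (\<Sum>i<d. (w i)\<^sup>2 / (2 * \<beta>) + \<beta> * (u i)\<^sup>2 / 2)"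
  proof (rule sum_mono)
    fix i
    have "0 \<le> (w i - \<beta> * u i)\<^sup>2 / (2 * \<beta>)" using b by simp
    also have "(w i - \<beta> * u i)\<^sup>2 / (2 * \<beta>) = (w i)\<^sup>2 / (2 * \<beta>) + \<beta> * (u i)\<^sup>2 / 2 - w i * u i"
      using b by (simp add: field_simps power2_eq_square)
    finally show "w i * u i \<le> (w i)\<^sup>2 / (2 * \<beta>) + \<beta> * (u i)\<^sup>2 / 2" by simp
  qed
  also have "\<dots> = (\<Sum>i<d. (w i)\<^sup>2) / (2 * \<beta>) + \<beta> * (\<Sum>i<d. (u i)\<^sup>2) / 2"
    by (simp add: sum.distrib sum_divide_distrib sum_distrib_left)
  finally show ?thesis using b unfolding w_def[symmetric]
    by (simp add: field_simps power2_eq_square)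
qed

text \<open>Evaluate S at w - u / \<beta>, where w is the image of u under the inverse: the cross
  term is -2 |u|^2 / \<beta>, and the upper bound on S returns at most |u|^2 / \<beta>.\<close>

lemma minv_quadform_ge:
  assumes p: "pdm d \<beta> S"
  shows "1 / \<beta> * (\<Sum>i<d. (u i)\<^sup>2) \<le> quadform d (minv d S) u"
proof -
  define w where "w = mv d (minv d S) u"
  have b: "0 < \<beta>" using p by (simp add: pdm_def)
  have "0 \<le> quadform d S (\<lambda>i. w i + (- 1 / \<beta>) * u i)"
    using p b unfolding pdm_def
    by (meson order_trans mult_nonneg_nonneg sum_nonneg zero_le_power2 divide_nonneg_pos zero_le_one)
  also have "\<dots> = quadform d S w + 2 * (- 1 / \<beta>) * (\<Sum>i<d. u i * mv d S w i) + (- 1 / \<beta>)\<^sup>2 * quadform d S u"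
    using p by (intro quadform_shift) (simp add: pdm_def)
  also have "(\<Sum>i<d. u i * mv d S w i) = (\<Sum>i<d. (u i)\<^sup>2)"
    unfolding w_def using mv_minv[OF p] by (simp add: power2_eq_square)
  also have "quadform d S w = quadform d (minv d S) u"
    unfolding quadform_mv using mv_minv[OF p] by (simp add: w_def mult.commute)
  also have "(- 1 / \<beta>)\<^sup>2 * quadform d S u \<le> (- 1 / \<beta>)\<^sup>2 * (\<beta> * (\<Sum>i<d. (u i)^2))"
    using p by (intro mult_left_mono) (simp_all add: pdm_def)
  also have "(- 1 / \<beta>)\<^sup>2 * (\<beta> * (\<Sum>i<d. (u i)^2)) = 1 / \<beta> * (\<Sum>i<d. (u i)^2)"
    using b by (simp add: power2_eq_square field_simps)
  finally show ?thesis by simp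
qed

lemma minv_entry_le:
  assumes p: "pdm d \<beta> S"
  shows "\<bar>minv d S i l\<bar> \<le> \<beta>"
proof (cases "i < d \<and> l < d")
  case True
  have b: "0 < \<beta>" using p by (simp add: pdm_def)
  have "(minv d S i l)\<^sup>2 = (mv d (minv d S) (\<lambda>r. idm r l) i)\<^sup>2"
    using True by (simp add: mv_def)
  also have "\<dots> \<le> (\<Sum>i<d. (mv d (minv d S) (\<lambda>r. idm r l) i)\<^sup>2)"
    using True by (intro member_le_sum) auto
  also have "\<dots> \<le> \<beta>\<^sup>2 * (\<Sum>i<d. (idm i l)\<^sup>2)" by (rule minv_norm_le[OF p])
  also have "(\<Sum>i<d. (idm i l)\<^sup>2) = 1"
    using True by (simp add: idm_def if_distrib[of "\<lambda>x. x^2"] cong: if_cong)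
  finally show ?thesis using b by (simp add: abs_le_square_iff[symmetric])
next
  case False
  thus ?thesis using minv_spec(1)[OF p, of i l] p by (auto simp: pdm_def)
qed

text \<open>\<open>pdm d \<beta> S\<close> forces \<beta> \<ge> 1 if d > 0, but for d = 0 it leaves
  \<beta> an arbitrary positive number; the maximum is at least 1 in every case.\<close>

lemma pdm_idm: "0 < \<beta> \<Longrightarrow> pdm d (max \<beta> (1 / \<beta>)) idm"
proof -
  assume b: "0 < \<beta>"
  have q: "quadform d idm x = (\<Sum>i<d. (x i)\<^sup>2)" for x
    by (simp add: quadform_mv mv_def power2_eq_square)
  have m: "1 \<le> max \<beta> (1 / \<beta>)"
    using b by (cases "1 \<le> \<beta>") (auto simp: le_max_iff_disj)
  define \<gamma> where "\<gamma> = max \<beta> (1 / \<beta>)"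
  have "1 / \<gamma> * u \<le> u" "u \<le> \<gamma> * u" if "0 \<le> u" for u
    using m that mult_right_mono[of 1 \<gamma> u] mult_right_mono[of "1 / \<gamma>" 1 u] by (simp_all add: \<gamma>_def[symmetric])
  hence "1 / \<gamma> * (\<Sum>i<d. (x i)\<^sup>2) \<le> (\<Sum>i<d. (x i)\<^sup>2) \<and> (\<Sum>i<d. (x i)\<^sup>2) \<le> \<gamma> * (\<Sum>i<d. (x i)\<^sup>2)"
    for x :: "nat \<Rightarrow> real" by (simp add: sum_nonneg)
  moreover have "0 < \<gamma>" using m unfolding \<gamma>_def by linarith
  moreover have "idm i l = idm l i" for i l by (simp add: idm_def)
  ultimately show ?thesis unfolding pdm_def q \<gamma>_def[symmetric] by blast
qed

lemma pdm_mono: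
  assumes "pdm d \<beta> S" "\<beta> \<le> \<gamma>"
  shows "pdm d \<gamma> S"
proof -
  have b: "0 < \<beta>" using assms by (simp add: pdm_def)
  have "1 / \<gamma> * u \<le> 1 / \<beta> * u" "\<beta> * u \<le> \<gamma> * u" if "0 \<le> u" for u
    using b assms(2) that by (auto intro!: mult_right_mono divide_left_mono)
  moreover have "0 \<le> (\<Sum>i<d. (x i)\<^sup>2)" for x :: "nat \<Rightarrow> real" by (intro sum_nonneg) auto
  ultimately show ?thesis using assms b unfolding pdm_def by (meson order_trans less_le_trans)
qed

lemma minv_idm: "minv d idm i l = (if i < d \<and> l < d then idm i l else 0)"
proof -
  have "minv d idm = (\<lambda>i l. if i < d \<and> l < d then idm i l else 0)"
  proof (rule minv_unique[OF pdm_idm[of 1]])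
    fix i l assume "i < d" "l < d"
    have "(\<Sum>r<d. idm i r * (if r < d \<and> l < d then idm r l else 0)) = (\<Sum>r<d. idm i r * idm r l)"
      using \<open>l < d\<close> by (intro sum.cong) auto
    thus "(\<Sum>r<d. idm i r * (if r < d \<and> l < d then idm r l else 0)) = idm i l"
      using \<open>l < d\<close> by simp
  qed auto
  thus ?thesis by simp
qed

text \<open>The determinant is 1 at the identity and cannot vanish on the segment from there to S,
  all of whose matrices are positive definite.\<close>

lemma mdet_pos:
  assumes "pdm d \<beta> S"
  shows "0 < mdet d S"
proof (rule ccontr)
  define \<gamma> where "\<gamma> = max \<beta> (1 / \<beta>)"
  define T where "T t i l = idm i l + t * (S i l - idm i l)" for t i l
  have b: "0 < \<beta>" using assms by (simp add: pdm_def)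
  have p: "pdm d \<gamma> (T t)" if "0 \<le> t" "t \<le> 1" for t
    unfolding T_def
    by (rule pdm_combine[OF _ pdm_mono[OF assms]]) (use that pdm_idm[OF b] in \<open>auto simp: \<gamma>_def\<close>)
  have c: "continuous_on {0..1} (\<lambda>t. mdet d (T t))"
    unfolding mdet_def T_def by (intro continuous_intros)
  assume "\<not> 0 < mdet d S"
  moreover have "mdet d (T 1) = mdet d S" by (rule mdet_cong) (simp add: T_def)
  ultimately have "mdet d (T 1) \<le> 0" by simp
  moreover have "mdet d (T 0) = mdet d idm" by (rule mdet_cong) (simp add: T_def)
  ultimately obtain t where "0 \<le> t" "t \<le> 1" "mdet d (T t) = 0"
    using IVT2'[of "\<lambda>t. mdet d (T t)" 1 0 0, OF _ _ _ c] by auto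
  thus False using mdet_nonzero[OF p] by blast
qed

section \<open>Derivatives of determinant and inverse along a path\<close>

lemma mdet_derivative:
  assumes S: "\<And>i l. i < d \<Longrightarrow> l < d \<Longrightarrow> ((\<lambda>s. S s i l) has_real_derivative S' i l) (at s0 within A)"
    and p: "pdm d \<beta> (S s0)"
  shows "((\<lambda>s. mdet d (S s)) has_real_derivative
     mdet d (S s0) * (\<Sum>i<d. \<Sum>l<d. minv d (S s0) i l * S' l i)) (at s0 within A)"
proof -
  define B where "B = minv d (S s0)"
  \<comment> \<open>Jacobi's formula: multiplication by the fixed inverse B makes the path run
    through the identity at s0, where the derivative is a trace.\<close>
  define N where "N s i l = (\<Sum>r<d. B i r * S s r l)" for s i l
  have N: "((\<lambda>s. mdet d (N s)) has_real_derivative (\<Sum>i<d. \<Sum>l<d. B i l * S' l i)) (at s0 within A)"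
  proof (rule mdet_derivative_idm[where N' = "\<lambda>i l. \<Sum>r<d. B i r * S' r l"])
    fix i l assume "i < d" "l < d"
    show "((\<lambda>s. N s i l) has_real_derivative (\<Sum>r<d. B i r * S' r l)) (at s0 within A)"
      unfolding N_def by (rule DERIV_sum, rule DERIV_cmult, rule S) (use \<open>l < d\<close> in auto)
    show "N s0 i l = idm i l"
      unfolding N_def B_def using minv_spec(3)[OF p] \<open>i < d\<close> \<open>l < d\<close> by simp
  qed
  have N1: "mdet d (N s) = mdet d B * mdet d (S s)" for s
    unfolding N_def by (rule mdet_mult)
  have "mdet d (N s0) = 1"
    using mdet_cong[of d "N s0" idm] minv_spec(3)[OF p] by (simp add: N_def B_def)
  hence "mdet d (S s0) * mdet d B = 1" using N1[of s0] by (simp add: mult.commute)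
  hence "(\<lambda>s. mdet d (S s)) = (\<lambda>s. mdet d (S s0) * mdet d (N s))"
    unfolding N1 by (simp add: mult.assoc[symmetric])
  thus ?thesis using DERIV_cmult[OF N, of "mdet d (S s0)"] by (simp only: B_def)
qed

text \<open>From the identity B(s) - B(s0) = - B(s) (S(s) - S(s0)) B(s0). Since all entries of the
  inverses are bounded by \<beta>, it first gives continuity and then, divided by s - s0, the
  derivative. It is taken within A because positive definiteness is known only there.\<close>

lemma minv_derivative:
  assumes S: "\<And>i l. i < d \<Longrightarrow> l < d \<Longrightarrow> ((\<lambda>s. S s i l) has_real_derivative S' i l) (at s0 within A)"
    and p: "\<And>s. s \<in> A \<Longrightarrow> pdm d \<beta> (S s)" and s0: "s0 \<in> A"
  shows "((\<lambda>s. minv d (S s) i l) has_real_derivative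
     - (\<Sum>q<d. \<Sum>r<d. minv d (S s0) i q * S' q r * minv d (S s0) r l)) (at s0 within A)"
proof (cases "i < d \<and> l < d")
  case il: True
  define B where "B s = minv d (S s)" for s
  have b: "0 < \<beta>" using p[OF s0] by (simp add: pdm_def)
  have diff: "B s i l - B s0 i l = - (\<Sum>q<d. \<Sum>r<d. B s i q * (S s q r - S s0 q r) * B s0 r l)"
    if s: "s \<in> A" "i < d" "l < d" for s i l
  proof -
    have "B s i l = (\<Sum>q<d. B s i q * idm q l)" using s by simp
    also have "\<dots> = (\<Sum>q<d. B s i q * (\<Sum>r<d. S s0 q r * B s0 r l))"
      using minv_spec(2)[OF p[OF s0]] s by (simp add: B_def)
    finally have 1: "B s i l = (\<Sum>q<d. \<Sum>r<d. B s i q * S s0 q r * B s0 r l)"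
      by (simp add: sum_distrib_left mult.assoc)
    have "B s0 i l = (\<Sum>r<d. idm i r * B s0 r l)" using s by simp
    also have "\<dots> = (\<Sum>r<d. (\<Sum>q<d. B s i q * S s q r) * B s0 r l)"
      using minv_spec(3)[OF p[OF s(1)]] s by (simp add: B_def)
    finally have 2: "B s0 i l = (\<Sum>q<d. \<Sum>r<d. B s i q * S s q r * B s0 r l)"
      unfolding sum_mult_assoc by (simp add: sum_distrib_left mult.assoc)
    show ?thesis by (subst 1, subst 2) (simp add: algebra_simps sum_subtractf)
  qed
  have evA: "eventually (\<lambda>s. s \<in> A \<and> s \<noteq> s0) (at s0 within A)"
    by (simp add: eventually_at_filter)
  have Slim: "((\<lambda>s. S s q r - S s0 q r) \<longlongrightarrow> 0) (at s0 within A)" if "q < d" "r < d" for q r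
    using DERIV_continuous[OF S[OF that]] by (simp add: continuous_within LIM_zero_iff)
  have Blim: "((\<lambda>s. B s i q) \<longlongrightarrow> B s0 i q) (at s0 within A)" if q: "q < d" for q
  proof -
    have "((\<lambda>s. B s i q - B s0 i q) \<longlongrightarrow> 0) (at s0 within A)"
    proof (rule Lim_null_comparison)
      show "eventually (\<lambda>s. norm (B s i q - B s0 i q) \<le> (\<Sum>q'<d. \<Sum>r<d. \<beta> * \<bar>S s q' r - S s0 q' r\<bar> * \<beta>)) (at s0 within A)"
        using evA
      proof eventually_elim
        case (elim s)
        have "norm (B s i q - B s0 i q) \<le> (\<Sum>q'<d. \<Sum>r<d. \<bar>B s i q' * (S s q' r - S s0 q' r) * B s0 r q\<bar>)"
          using elim il q by (auto simp: diff intro!: order_trans[OF sum_abs] sum_mono)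
        also have "\<dots> \<le> (\<Sum>q'<d. \<Sum>r<d. \<beta> * \<bar>S s q' r - S s0 q' r\<bar> * \<beta>)"
          unfolding abs_mult using elim b s0
          by (intro sum_mono mult_mono) (auto simp: B_def intro!: minv_entry_le[OF p])
        finally show ?case .
      qed
      have "((\<lambda>s. \<Sum>q'<d. \<Sum>r<d. \<beta> * \<bar>S s q' r - S s0 q' r\<bar> * \<beta>) \<longlongrightarrow> (\<Sum>q'<d. \<Sum>r<d. \<beta> * \<bar>0\<bar> * \<beta>)) (at s0 within A)"
        by (intro tendsto_intros Slim) auto
      thus "((\<lambda>s. \<Sum>q'<d. \<Sum>r<d. \<beta> * \<bar>S s q' r - S s0 q' r\<bar> * \<beta>) \<longlongrightarrow> 0) (at s0 within A)"
        by simp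
    qed
    thus ?thesis by (simp add: LIM_zero_iff)
  qed
  have "((\<lambda>s. - (\<Sum>q<d. \<Sum>r<d. B s i q * ((S s q r - S s0 q r) / (s - s0)) * B s0 r l)) \<longlongrightarrow>
      - (\<Sum>q<d. \<Sum>r<d. B s0 i q * S' q r * B s0 r l)) (at s0 within A)"
    by (intro tendsto_intros Blim S[unfolded has_field_derivative_iff]) auto
  moreover have "eventually (\<lambda>s. - (\<Sum>q<d. \<Sum>r<d. B s i q * ((S s q r - S s0 q r) / (s - s0)) * B s0 r l)
      = (B s i l - B s0 i l) / (s - s0)) (at s0 within A)"
    using evA by eventually_elim (use il in \<open>simp add: diff sum_divide_distrib\<close>)
  ultimately have "((\<lambda>s. (B s i l - B s0 i l) / (s - s0)) \<longlongrightarrow>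
      - (\<Sum>q<d. \<Sum>r<d. B s0 i q * S' q r * B s0 r l)) (at s0 within A)"
    by (rule Lim_transform_eventually)
  thus ?thesis by (simp add: has_field_derivative_iff B_def)
next
  case False
  hence z: "minv d (S s) i l = 0" if "s \<in> A" for s
    using minv_spec(1)[OF p[OF that]] by auto
  have "minv d (S s0) i q * S' q r * minv d (S s0) r l = 0" if "q < d" "r < d" for q r
    using False minv_spec(1)[OF p[OF s0]] by auto
  hence "- (\<Sum>q<d. \<Sum>r<d. minv d (S s0) i q * S' q r * minv d (S s0) r l) = 0"
    by (simp add: sum.neutral)
  moreover have "((\<lambda>s. minv d (S s) i l) has_real_derivative 0) (at s0 within A)"
    by (rule has_field_derivative_transform_within[of "\<lambda>_. 0" _ _ _ 1]) (use z s0 in auto)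
  ultimately show ?thesis by (simp only:)
qed

subsection \<open>Multivariate Hermite functions\<close>

text \<open>
  With \<open>B = S\<^sup>-\<^sup>1\<close> and \<open>y = B(x - \<mu>)\<close>, the value \<open>herm d B y is\<close> is the polynomial by which
  \<open>(-\<partial>)\<close> in the directions \<open>is\<close> multiplies the density of \<open>N(\<mu>, S)\<close>.
\<close>

function herm :: "nat \<Rightarrow> (nat \<Rightarrow> nat \<Rightarrow> real) \<Rightarrow> (nat \<Rightarrow> real) \<Rightarrow> nat list \<Rightarrow> real" where
  "herm d B y [] = 1"
| "herm d B y (i # is) = y i * herm d B y is - (\<Sum>b<d. real (count_list is b) * B i b * herm d B y (remove1 b is))"
  by pat_completeness auto
termination
  by (relation "Wellfounded.measure (\<lambda>(d, B, y, is). length is)") (auto simp: length_remove1 less_Suc_eq)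

text \<open>For empty p this is the derivative of \<open>herm d B y is\<close> when y moves with
  velocity v, see \<open>herm_derivative\<close>. The prefix p is a block of indices from which none
  is removed.\<close>

definition lower :: "nat \<Rightarrow> (nat \<Rightarrow> nat \<Rightarrow> real) \<Rightarrow> (nat \<Rightarrow> real) \<Rightarrow> (nat \<Rightarrow> real) \<Rightarrow> nat list \<Rightarrow> nat list \<Rightarrow> real" where
  "lower d B y v p is = (\<Sum>b<d. real (count_list is b) * v b * herm d B y (p @ remove1 b is))"

lemma herm_Cons: "herm d B y (i # is) = y i * herm d B y is - lower d B y (B i) [] is"
  by (simp add: lower_def)

declare herm.simps(2) [simp del]

lemma count_list_remove1: "count_list (remove1 b is) c = count_list is c - (if b = c then 1 else 0)"
  by (induction "is") (auto simp: count_list_0_iff)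

lemma count_count_remove1_commute:
  "real (count_list is b) * real (count_list (remove1 b is) c) = real (count_list is c) * real (count_list (remove1 c is) b)"
  by (auto simp: count_list_remove1)

lemma set_remove1_le: "set is \<subseteq> {..<d} \<Longrightarrow> set (remove1 b is) \<subseteq> {..<d}"
  using set_remove1_subset[of b "is"] by blast

text \<open>Removing b and then c has the same multiplicity as removing c and then b: directional
  derivatives commute.\<close>

lemma lower_lower_commute:
  "(\<Sum>b<d. real (count_list r b) * v b * lower d B y w p (remove1 b r))
   = (\<Sum>b<d. real (count_list r b) * w b * lower d B y v p (remove1 b r))"
proof -
  have "(\<Sum>b<d. real (count_list r b) * v b * lower d B y w p (remove1 b r))
    = (\<Sum>b<d. \<Sum>c<d. (real (count_list r b) * real (count_list (remove1 b r) c)) * v b * w c * herm d B y (p @ remove1 c (remove1 b r)))"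
    by (simp add: lower_def sum_distrib_left mult_ac)
  also have "\<dots> = (\<Sum>c<d. \<Sum>b<d. (real (count_list r b) * real (count_list (remove1 b r) c)) * v b * w c * herm d B y (p @ remove1 c (remove1 b r)))"
    by (rule sum.swap)
  also have "\<dots> = (\<Sum>c<d. \<Sum>b<d. (real (count_list r c) * real (count_list (remove1 c r) b)) * v b * w c * herm d B y (p @ remove1 b (remove1 c r)))"
    by (intro sum.cong refl) (simp only: count_count_remove1_commute remove1_commute)
  also have "\<dots> = (\<Sum>b<d. real (count_list r b) * w b * lower d B y v p (remove1 b r))"
    by (simp add: lower_def sum_distrib_left mult_ac)
  finally show ?thesis .
qed

text \<open>The hypothesis on \<open>herm\<close> is its permutation invariance, which is itself proved by
  induction through this identity.\<close>

lemma lower_Cons_aux: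
  assumes j: "j < d"
    and perm: "j \<in> set r \<Longrightarrow> herm d B y (p @ j # remove1 j r) = herm d B y (p @ r)"
  shows "lower d B y v p (j # r) = v j * herm d B y (p @ r) + lower d B y v (p @ [j]) r"
proof -
  have "lower d B y v p (j # r)
      = (\<Sum>b<d. (if b = j then v j * herm d B y (p @ r) else 0) + real (count_list r b) * v b * herm d B y (p @ j # remove1 b r))"
    unfolding lower_def
    by (intro sum.cong refl) (use perm in \<open>auto simp: algebra_simps count_list_0_iff\<close>)
  also have "\<dots> = v j * herm d B y (p @ r) + lower d B y v (p @ [j]) r"
    using j by (simp add: sum.distrib lower_def)
  finally show ?thesis .
qed

lemma lower_Cons_left:
  "lower d B y v [j] r = y j * lower d B y v [] r - (\<Sum>b<d. real (count_list r b) * v b * lower d B y (B j) [] (remove1 b r))"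
  by (simp add: lower_def[of d B y v] herm_Cons right_diff_distrib sum_subtractf sum_distrib_left mult_ac)

text \<open>The recursion singles out the first index, so symmetry has to be proved. It suffices to
  exchange the first two indices; by induction the rest may already be rearranged.\<close>

lemma herm_perm:
  assumes sym: "\<And>i l. B i l = B l i"
  shows "set is \<subseteq> {..<d} \<Longrightarrow> mset is = mset js \<Longrightarrow> herm d B y is = herm d B y js"
proof (induction "length is" arbitrary: "is" js rule: less_induct)
  case less
  have cong: "herm d B y (i # u) = herm d B y (i # w)" if uw: "mset u = mset w" "mset (i # u) = mset is" for i u w
  proof -
    have l: "length u < length is" "length u = length w" "set u \<subseteq> {..<d}"
      using mset_eq_length[OF uw(1)] mset_eq_length[OF uw(2)] mset_eq_setD[OF uw(2)] less.prems(1)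
      by auto
    have "count_list u b = count_list w b" for b
      using uw(1) by (metis count_mset)
    moreover have "herm d B y (remove1 b u) = herm d B y (remove1 b w)" for b
      using l set_remove1_le[OF l(3)] uw(1)
      by (intro less.hyps) (auto simp: length_remove1)
    moreover have "herm d B y u = herm d B y w"
      using l uw(1) by (intro less.hyps) auto
    ultimately show ?thesis by (simp add: herm_Cons lower_def)
  qed
  show ?case
  proof (cases "is")
    case Nil
    thus ?thesis using less.prems by simp
  next
    case (Cons i "is'")
    then obtain j js' where js: "js = j # js'" using less.prems(2) by (cases js) auto
    show ?thesis
    proof (cases "i = j")
      case True
      thus ?thesis using less.prems(2) cong[of is' js' i] unfolding Cons js by simp
    next
      case False
      define r where "r = remove1 j is'"
      have ji: "j \<in> set is'"
        using less.prems(2) False mset_eq_setD[OF less.prems(2)] unfolding Cons js by auto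
      have m1: "mset is' = mset (j # r)" using ji by (simp add: r_def)
      have m2: "mset js' = mset (i # r)" using less.prems(2) m1 unfolding Cons js by (simp add: add_mset_commute)
      have d: "i < d" "j < d" using less.prems(1) ji unfolding Cons by auto
      have sr: "set r \<subseteq> {..<d}" and lr: "length r < length is"
        using less.prems(1) ji set_remove1_subset[of j is'] unfolding Cons r_def by (auto simp: length_remove1)
      \<comment> \<open>Two unfoldings of the recursion. The result is symmetric in a and b, its
        last term by \<open>lower_lower_commute\<close> and \<open>B a b\<close> by the symmetry of
        B.\<close>
      have two: "herm d B y (a # b # r) = y a * y b * herm d B y r - y a * lower d B y (B b) [] r - B a b * herm d B y r
          - y b * lower d B y (B a) [] r + (\<Sum>c<d. real (count_list r c) * B a c * lower d B y (B b) [] (remove1 c r))"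
        if "b < d" for a b
      proof -
        have "herm d B y ([] @ b # remove1 b r) = herm d B y ([] @ r)" if "b \<in> set r"
          using that sr lr \<open>b < d\<close> set_remove1_subset[of b r]
          by (intro less.hyps) (auto simp: length_remove1 dest: length_pos_if_in_set)
        from lower_Cons_aux[OF \<open>b < d\<close> this, of "B a"]
        show ?thesis unfolding herm_Cons[of d B y a] 
          by (simp add: herm_Cons[of d B y b] lower_Cons_left algebra_simps)
      qed
      have "herm d B y is = herm d B y (i # j # r)"
        using cong[OF m1] Cons by simp
      also have "\<dots> = herm d B y (j # i # r)"
        unfolding two[OF d(1)] two[OF d(2)]
        using lower_lower_commute[of r "B i" d B y "B j" "[]"] sym[of i j] by (simp add: mult_ac)
      also have "\<dots> = herm d B y js"
        using cong[of "i # r" js' j] m2 less.prems(2) unfolding js by simp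
      finally show ?thesis .
    qed
  qed
qed

lemma lower_Cons:
  assumes "\<And>i l. B i l = B l i" "j < d" "set p \<subseteq> {..<d}" "set r \<subseteq> {..<d}"
  shows "lower d B y v p (j # r) = v j * herm d B y (p @ r) + lower d B y v (p @ [j]) r"
proof (rule lower_Cons_aux[OF assms(2)])
  assume "j \<in> set r"
  thus "herm d B y (p @ j # remove1 j r) = herm d B y (p @ r)"
    using assms set_remove1_subset[of j r] by (intro herm_perm) auto
qed

lemma herm_swap:
  assumes "\<And>i l. B i l = B l i" "set is \<subseteq> {..<d}" "i < d" "set p \<subseteq> {..<d}"
  shows "herm d B y (p @ i # is) = herm d B y (i # p @ is)"
  using assms by (intro herm_perm) auto

text \<open>Differentiating the recursion yields two removals in the opposite order to that in
  \<open>lower\<close>, which \<open>lower_lower_commute\<close> repairs.\<close>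

lemma herm_derivative:
  assumes sym: "\<And>i l. B i l = B l i"
    and y: "\<And>i. i < d \<Longrightarrow> ((\<lambda>t. y t i) has_real_derivative v i) (at t0 within A)"
  shows "set is \<subseteq> {..<d} \<Longrightarrow>
    ((\<lambda>t. herm d B (y t) is) has_real_derivative lower d B (y t0) v [] is) (at t0 within A)"
proof (induction "length is" arbitrary: "is" rule: less_induct)
  case less
  show ?case
  proof (cases "is")
    case Nil
    thus ?thesis by (simp add: lower_def)
  next
    case (Cons j r)
    hence jr: "j < d" "set r \<subseteq> {..<d}" using less.prems by auto
    have IH: "((\<lambda>t. herm d B (y t) r') has_real_derivative lower d B (y t0) v [] r') (at t0 within A)"
      if "length r' \<le> length r" "set r' \<subseteq> {..<d}" for r'
      using less.hyps[of r'] that Cons by simp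
    have "((\<lambda>t. y t j * herm d B (y t) r - lower d B (y t) (B j) [] r) has_real_derivative
       (v j * herm d B (y t0) r + lower d B (y t0) v [] r * y t0 j) -
       (\<Sum>b<d. real (count_list r b) * B j b * lower d B (y t0) v [] ([] @ remove1 b r))) (at t0 within A)"
      unfolding lower_def[of d B _ "B j"]
      by (intro DERIV_diff DERIV_mult y jr IH DERIV_sum DERIV_cmult)
        (use set_remove1_le[OF jr(2)] in \<open>auto simp: length_remove1\<close>)
    moreover have "lower d B (y t0) v [] (j # r) =
       (v j * herm d B (y t0) r + lower d B (y t0) v [] r * y t0 j) -
       (\<Sum>b<d. real (count_list r b) * B j b * lower d B (y t0) v [] ([] @ remove1 b r))"
      using lower_Cons[OF sym jr(1) _ jr(2), of "[]"] lower_lower_commute[of r v d B "y t0" "B j" "[]"]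
      by (simp add: lower_Cons_left)
    ultimately show ?thesis unfolding Cons herm_Cons by (simp only:)
  qed
qed

text \<open>
  \<open>heat\<close> is what the heat equation predicts for the derivative along a path with velocity
  \<open>m'\<close> of the mean and \<open>S'\<close> of the covariance.
\<close>

definition heat :: "nat \<Rightarrow> (nat \<Rightarrow> nat \<Rightarrow> real) \<Rightarrow> (nat \<Rightarrow> real) \<Rightarrow> (nat \<Rightarrow> real) \<Rightarrow> (nat \<Rightarrow> nat \<Rightarrow> real) \<Rightarrow> nat list \<Rightarrow> real" where
  "heat d B y m' S' is = (\<Sum>a<d. m' a * herm d B y (a # is)) + 1 / 2 * (\<Sum>a<d. \<Sum>b<d. S' a b * herm d B y (a # b # is))"

text \<open>Permutation invariance brings i to the front, past the indices a and b, where the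
  recursion applies. The resulting coefficients are those that arise when the recursion of
  \<open>herm\<close> is differentiated along a path: B S' y + B m' is minus the velocity of y, and
  B S' B minus that of B.\<close>

lemma heat_Cons:
  assumes sym: "\<And>i l. B i l = B l i" and sym': "\<forall>i<d. \<forall>l<d. S' i l = S' l i"
    and i: "i < d" and r: "set r \<subseteq> {..<d}"
  shows "heat d B y m' S' (i # r) = y i * heat d B y m' S' r
    - ((\<Sum>q<d. \<Sum>l<d. B i q * S' q l * y l) + (\<Sum>a<d. B i a * m' a)) * herm d B y r
    + (\<Sum>c<d. real (count_list r c) * (\<Sum>q<d. \<Sum>l<d. B i q * S' q l * B l c) * herm d B y (remove1 c r))
    - (\<Sum>c<d. real (count_list r c) * B i c * heat d B y m' S' (remove1 c r))"
proof -
  let ?H = "herm d B y" and ?c = "\<lambda>b. real (count_list r b)"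
  have h1: "?H (a # i # r) = y i * ?H (a # r) - B i a * ?H r - (\<Sum>c<d. ?c c * B i c * ?H (a # remove1 c r))"
    if a: "a < d" for a
  proof -
    have "?H (a # i # r) = ?H (i # a # r)" using herm_swap[OF sym r i, of "[a]"] a by simp
    also have "\<dots> = y i * ?H (a # r) - lower d B y (B i) [] (a # r)" by (rule herm_Cons)
    also have "lower d B y (B i) [] (a # r) = B i a * ?H r + (\<Sum>c<d. ?c c * B i c * ?H (a # remove1 c r))"
      using lower_Cons[OF sym a _ r, where p = "[]"] by (simp add: lower_def)
    finally show ?thesis by simp
  qed
  have h2: "?H (a # b # i # r) = y i * ?H (a # b # r) - B i a * ?H (b # r) - B i b * ?H (a # r)
      - (\<Sum>c<d. ?c c * B i c * ?H (a # b # remove1 c r))" if a: "a < d" and b: "b < d" for a b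
  proof -
    have "?H (a # b # i # r) = ?H (i # a # b # r)" using herm_swap[OF sym r i, of "[a,b]"] a b by simp
    also have "\<dots> = y i * ?H (a # b # r) - lower d B y (B i) [] (a # b # r)" by (rule herm_Cons)
    also have "lower d B y (B i) [] (a # b # r) = B i a * ?H (b # r) + lower d B y (B i) [a] (b # r)"
      using lower_Cons[OF sym a, where p = "[]" and r = "b # r"] b r by simp
    also have "lower d B y (B i) [a] (b # r) = B i b * ?H (a # r) + (\<Sum>c<d. ?c c * B i c * ?H (a # b # remove1 c r))"
      using lower_Cons[OF sym b _ r, where p = "[a]"] a by (simp add: lower_def)
    finally show ?thesis by simp
  qed
  have "heat d B y m' S' (i # r) = (\<Sum>a<d. m' a * (y i * ?H (a # r) - B i a * ?H r - (\<Sum>c<d. ?c c * B i c * ?H (a # remove1 c r))))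
     + 1 / 2 * (\<Sum>a<d. \<Sum>b<d. S' a b * (y i * ?H (a # b # r) - B i a * ?H (b # r) - B i b * ?H (a # r)
      - (\<Sum>c<d. ?c c * B i c * ?H (a # b # remove1 c r))))"
    unfolding heat_def
    by (intro arg_cong2[where f = "(+)"] arg_cong2[where f = "(*)"] sum.cong refl) (simp_all add: h1 h2)
  also have "\<dots> = y i * heat d B y m' S' r - (\<Sum>a<d. B i a * m' a) * ?H r
      - (\<Sum>c<d. ?c c * B i c * heat d B y m' S' (remove1 c r))
      - 1 / 2 * ((\<Sum>a<d. \<Sum>b<d. S' a b * B i a * ?H (b # r)) + (\<Sum>a<d. \<Sum>b<d. S' a b * B i b * ?H (a # r)))"
  proof -
    have e1: "(\<Sum>a<d. m' a * (\<Sum>c<d. ?c c * B i c * ?H (a # remove1 c r))) = (\<Sum>c<d. ?c c * B i c * (\<Sum>a<d. m' a * ?H (a # remove1 c r)))"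
      unfolding sum_distrib_left by (subst sum.swap) (simp add: mult_ac)
    have e2: "(\<Sum>a<d. \<Sum>b<d. S' a b * (\<Sum>c<d. ?c c * B i c * ?H (a # b # remove1 c r)))
      = (\<Sum>c<d. ?c c * B i c * (\<Sum>a<d. \<Sum>b<d. S' a b * ?H (a # b # remove1 c r)))"
    proof -
      have "(\<Sum>a<d. \<Sum>b<d. S' a b * (\<Sum>c<d. ?c c * B i c * ?H (a # b # remove1 c r)))
        = (\<Sum>a<d. \<Sum>b<d. \<Sum>c<d. ?c c * B i c * (S' a b * ?H (a # b # remove1 c r)))"
        by (simp add: sum_distrib_left mult_ac)
      also have "\<dots> = (\<Sum>a<d. \<Sum>c<d. \<Sum>b<d. ?c c * B i c * (S' a b * ?H (a # b # remove1 c r)))"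
        by (rule sum.cong[OF refl], rule sum.swap)
      also have "\<dots> = (\<Sum>c<d. \<Sum>a<d. \<Sum>b<d. ?c c * B i c * (S' a b * ?H (a # b # remove1 c r)))"
        by (rule sum.swap)
      finally show ?thesis by (simp add: sum_distrib_left)
    qed
    have e3: "(\<Sum>a<d. m' a * (B i a * ?H r)) = (\<Sum>a<d. B i a * m' a) * ?H r"
      by (simp add: sum_distrib_left sum_distrib_right mult_ac)
    have e4: "(\<Sum>a<d. m' a * (y i * ?H (a # r))) = y i * (\<Sum>a<d. m' a * ?H (a # r))"
      "(\<Sum>a<d. \<Sum>b<d. S' a b * (y i * ?H (a # b # r))) = y i * (\<Sum>a<d. \<Sum>b<d. S' a b * ?H (a # b # r))"
      by (simp_all add: sum_distrib_left mult_ac)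
    have e5: "(\<Sum>c<d. ?c c * B i c * (U c + 1 / 2 * V c)) = (\<Sum>c<d. ?c c * B i c * U c) + 1 / 2 * (\<Sum>c<d. ?c c * B i c * V c)"
      for U V by (simp add: distrib_left sum.distrib sum_distrib_left mult_ac)
    show ?thesis unfolding heat_def e5
      by (simp only: right_diff_distrib sum_subtractf e1 e2 e3 e4) (simp add: algebra_simps)
  qed
  \<comment> \<open>Symmetry of S' makes the two mixed sums equal, which cancels the factor 1/2; the
    recursion then removes the remaining index b.\<close>
  also have "(\<Sum>a<d. \<Sum>b<d. S' a b * B i b * ?H (a # r)) = (\<Sum>a<d. \<Sum>b<d. S' a b * B i a * ?H (b # r))"
    by (subst sum.swap) (use sym' in \<open>auto intro!: sum.cong\<close>)
  also have "(\<Sum>a<d. \<Sum>b<d. S' a b * B i a * ?H (b # r))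
     = (\<Sum>q<d. \<Sum>l<d. B i q * S' q l * y l) * ?H r
       - (\<Sum>c<d. ?c c * (\<Sum>q<d. \<Sum>l<d. B i q * S' q l * B l c) * ?H (remove1 c r))"
  proof -
    have "(\<Sum>a<d. \<Sum>b<d. S' a b * B i a * ?H (b # r))
      = (\<Sum>q<d. \<Sum>l<d. B i q * S' q l * y l * ?H r) - (\<Sum>q<d. \<Sum>l<d. \<Sum>c<d. B i q * S' q l * (?c c * B l c * ?H (remove1 c r)))"
      by (simp add: herm_Cons lower_def right_diff_distrib sum_subtractf sum_distrib_left mult_ac)
    also have "(\<Sum>q<d. \<Sum>l<d. \<Sum>c<d. B i q * S' q l * (?c c * B l c * ?H (remove1 c r)))
      = (\<Sum>q<d. \<Sum>c<d. \<Sum>l<d. B i q * S' q l * (?c c * B l c * ?H (remove1 c r)))"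
      by (rule sum.cong[OF refl], rule sum.swap)
    also have "\<dots> = (\<Sum>c<d. \<Sum>q<d. \<Sum>l<d. B i q * S' q l * (?c c * B l c * ?H (remove1 c r)))"
      by (rule sum.swap)
    also have "\<dots> = (\<Sum>c<d. ?c c * (\<Sum>q<d. \<Sum>l<d. B i q * S' q l * B l c) * ?H (remove1 c r))"
      by (simp add: sum_distrib_left sum_distrib_right mult_ac)
    finally show ?thesis by (simp add: sum_distrib_right)
  qed
  finally show ?thesis by (simp add: algebra_simps)
qed

text \<open>The hypotheses on y and B are the derivatives of the inverse covariance and of its
  product with x - \<mu>. The subtracted term is the logarithmic derivative of the density, so that
  \<open>hg\<close> obeys the plain heat equation.\<close>

lemma herm_path_derivative:
  fixes y :: "real \<Rightarrow> nat \<Rightarrow> real" and B :: "real \<Rightarrow> nat \<Rightarrow> nat \<Rightarrow> real"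
  assumes sym: "\<And>i l. B t0 i l = B t0 l i" and sym': "\<And>i l. i < d \<Longrightarrow> l < d \<Longrightarrow> S' i l = S' l i"
    and y: "\<And>i. i < d \<Longrightarrow> ((\<lambda>t. y t i) has_real_derivative
       - ((\<Sum>q<d. \<Sum>l<d. B t0 i q * S' q l * y t0 l) + (\<Sum>a<d. B t0 i a * m' a))) (at t0 within A)"
    and B: "\<And>i l. i < d \<Longrightarrow> l < d \<Longrightarrow> ((\<lambda>t. B t i l) has_real_derivative
       - (\<Sum>q<d. \<Sum>r<d. B t0 i q * S' q r * B t0 r l)) (at t0 within A)"
  shows "set is \<subseteq> {..<d} \<Longrightarrow>
    ((\<lambda>t. herm d (B t) (y t) is) has_real_derivative
      heat d (B t0) (y t0) m' S' is - heat d (B t0) (y t0) m' S' [] * herm d (B t0) (y t0) is) (at t0 within A)"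
proof (induction "length is" arbitrary: "is" rule: less_induct)
  case less
  let ?H = "herm d (B t0) (y t0)" and ?R = "heat d (B t0) (y t0) m' S'"
  show ?case
  proof (cases "is")
    case Nil
    thus ?thesis by simp
  next
    case (Cons j r)
    hence jr: "j < d" "set r \<subseteq> {..<d}" using less.prems by auto
    have IH: "((\<lambda>t. herm d (B t) (y t) r') has_real_derivative ?R r' - ?R [] * ?H r') (at t0 within A)"
      if "length r' \<le> length r" "set r' \<subseteq> {..<d}" for r'
      using less.hyps[of r'] that Cons by simp
    define y' where "y' = - ((\<Sum>q<d. \<Sum>l<d. B t0 j q * S' q l * y t0 l) + (\<Sum>a<d. B t0 j a * m' a))"
    define B' where "B' b = - (\<Sum>q<d. \<Sum>l<d. B t0 j q * S' q l * B t0 l b)" for b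
    have t: "((\<lambda>t. real (count_list r b) * B t j b * herm d (B t) (y t) (remove1 b r)) has_real_derivative
        (real (count_list r b) * B' b * ?H (remove1 b r) +
          (?R (remove1 b r) - ?R [] * ?H (remove1 b r)) * (real (count_list r b) * B t0 j b))) (at t0 within A)"
      if "b < d" for b
      unfolding B'_def
      by (rule DERIV_mult, rule DERIV_cmult, rule B[OF jr(1) that], rule IH)
        (use set_remove1_le[OF jr(2)] in \<open>auto simp: length_remove1\<close>)
    have D: "((\<lambda>t. y t j * herm d (B t) (y t) r - (\<Sum>b<d. real (count_list r b) * B t j b * herm d (B t) (y t) (remove1 b r))) has_real_derivative
       (y' * ?H r + (?R r - ?R [] * ?H r) * y t0 j) -
       (\<Sum>b<d. real (count_list r b) * B' b * ?H (remove1 b r) +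
          (?R (remove1 b r) - ?R [] * ?H (remove1 b r)) * (real (count_list r b) * B t0 j b))) (at t0 within A)"
    proof (rule DERIV_diff)
      show "((\<lambda>t. y t j * herm d (B t) (y t) r) has_real_derivative
         y' * ?H r + (?R r - ?R [] * ?H r) * y t0 j) (at t0 within A)"
        unfolding y'_def by (rule DERIV_mult[OF y[OF jr(1)] IH[OF _ jr(2)]]) simp
      show "((\<lambda>t. \<Sum>b<d. real (count_list r b) * B t j b * herm d (B t) (y t) (remove1 b r)) has_real_derivative
        (\<Sum>b<d. real (count_list r b) * B' b * ?H (remove1 b r) +
          (?R (remove1 b r) - ?R [] * ?H (remove1 b r)) * (real (count_list r b) * B t0 j b))) (at t0 within A)"
        by (rule DERIV_sum, rule t) simp
    qed
    have SY: "\<forall>i<d. \<forall>l<d. S' i l = S' l i" using sym' by blast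
    note HC = heat_Cons[where B = "B t0" and y = "y t0" and S' = S' and m' = m' and i = j and r = r, OF sym SY jr]
    have "(y' * ?H r + (?R r - ?R [] * ?H r) * y t0 j) -
       (\<Sum>b<d. real (count_list r b) * B' b * ?H (remove1 b r) +
          (?R (remove1 b r) - ?R [] * ?H (remove1 b r)) * (real (count_list r b) * B t0 j b))
       = ?R (j # r) - ?R [] * ?H (j # r)"
      unfolding HC herm.simps(2) B'_def y'_def
      by (simp add: algebra_simps sum.distrib sum_subtractf sum_negf sum_distrib_left)
    with D show ?thesis unfolding Cons herm.simps(2) by (simp only:)
  qed
qed

section \<open>Gaussian densities and their derivatives\<close>

definition gd :: "nat \<Rightarrow> (nat \<Rightarrow> real) \<Rightarrow> (nat \<Rightarrow> nat \<Rightarrow> real) \<Rightarrow> (nat \<Rightarrow> real) \<Rightarrow> real" where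
  "gd d \<mu> S x = exp (- quadform d (minv d S) (\<lambda>i. x i - \<mu> i) / 2) / sqrt ((2 * pi) ^ d * mdet d S)"

lemma gauss_density_gd: "gauss_density d mu Sig = gd d mu (\<lambda>i l. idm i l + Sig i l)"
  by (rule ext) (simp add: gauss_density_def gd_def Let_def)

definition yv :: "nat \<Rightarrow> (nat \<Rightarrow> real) \<Rightarrow> (nat \<Rightarrow> nat \<Rightarrow> real) \<Rightarrow> (nat \<Rightarrow> real) \<Rightarrow> nat \<Rightarrow> real" where
  "yv d \<mu> S x = mv d (minv d S) (\<lambda>i. x i - \<mu> i)"

definition hg :: "nat \<Rightarrow> (nat \<Rightarrow> real) \<Rightarrow> (nat \<Rightarrow> nat \<Rightarrow> real) \<Rightarrow> nat list \<Rightarrow> (nat \<Rightarrow> real) \<Rightarrow> real" where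
  "hg d \<mu> S is x = herm d (minv d S) (yv d \<mu> S x) is * gd d \<mu> S x"

lemma gd_pos: "pdm d \<beta> S \<Longrightarrow> 0 < gd d \<mu> S x"
  using mdet_pos[of d \<beta> S] by (simp add: gd_def)

lemma quadform_derivative:
  assumes "\<And>i. i < d \<Longrightarrow> ((\<lambda>t. z t i) has_real_derivative z' i) (at t0 within A)"
    and "\<And>i l. i < d \<Longrightarrow> l < d \<Longrightarrow> ((\<lambda>t. B t i l) has_real_derivative B' i l) (at t0 within A)"
    and sym: "\<And>i l. B t0 i l = B t0 l i"
  shows "((\<lambda>t. quadform d (B t) (z t)) has_real_derivative
    quadform d B' (z t0) + 2 * (\<Sum>i<d. z' i * mv d (B t0) (z t0) i)) (at t0 within A)"
proof -
  have "((\<lambda>t. quadform d (B t) (z t)) has_real_derivative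
    (\<Sum>i<d. \<Sum>l<d. (z' i * B t0 i l + B' i l * z t0 i) * z t0 l + z' l * (z t0 i * B t0 i l))) (at t0 within A)"
    unfolding quadform_def
    by (rule DERIV_sum, rule DERIV_sum, rule DERIV_mult, rule DERIV_mult) (use assms in auto)
  moreover have "(\<Sum>i<d. \<Sum>l<d. z' l * (z t0 i * B t0 i l)) = (\<Sum>i<d. z' i * mv d (B t0) (z t0) i)"
    by (subst sum.swap) (simp add: mv_def sum_distrib_left sym[of _ "_ :: nat"] mult_ac)
  moreover have "(\<Sum>i<d. \<Sum>l<d. (z' i * B t0 i l) * z t0 l) = (\<Sum>i<d. z' i * mv d (B t0) (z t0) i)"
    by (simp add: mv_def sum_distrib_left mult_ac)
  moreover have "(\<Sum>i<d. \<Sum>l<d. (B' i l * z t0 i) * z t0 l) = quadform d B' (z t0)"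
    by (simp add: quadform_def mult_ac)
  ultimately show ?thesis by (simp only: distrib_right sum.distrib) (simp add: add_ac)
qed

text \<open>The heat equation for all derivatives of a Gaussian at once: the mean moves by one
  application of -\<partial> and the covariance by half of two. The derivatives of exponent,
  normalization and polynomial factor are computed separately and combined.\<close>

lemma hg_path_derivative:
  fixes S :: "real \<Rightarrow> nat \<Rightarrow> nat \<Rightarrow> real" and m :: "real \<Rightarrow> nat \<Rightarrow> real"
  assumes S: "\<And>i l. i < d \<Longrightarrow> l < d \<Longrightarrow> ((\<lambda>s. S s i l) has_real_derivative S' i l) (at s0 within A)"
    and m: "\<And>i. i < d \<Longrightarrow> ((\<lambda>s. m s i) has_real_derivative m' i) (at s0 within A)"
    and sym': "\<And>i l. i < d \<Longrightarrow> l < d \<Longrightarrow> S' i l = S' l i"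
    and p: "\<And>s. s \<in> A \<Longrightarrow> pdm d \<beta> (S s)" and s0: "s0 \<in> A"
    and "is": "set is \<subseteq> {..<d}"
  shows "((\<lambda>s. hg d (m s) (S s) is x) has_real_derivative
     (\<Sum>a<d. m' a * hg d (m s0) (S s0) (a # is) x) +
     1 / 2 * (\<Sum>a<d. \<Sum>b<d. S' a b * hg d (m s0) (S s0) (a # b # is) x)) (at s0 within A)"
proof -
  define B where "B s = minv d (S s)" for s
  define z where "z s i = x i - m s i" for s i
  define y where "y s = mv d (B s) (z s)" for s
  define B' where "B' i l = - (\<Sum>q<d. \<Sum>r<d. B s0 i q * S' q r * B s0 r l)" for i l
  note P = p[OF s0]
  have symB: "B s0 i l = B s0 l i" for i l unfolding B_def by (rule minv_spec(4)[OF P])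
  have dB: "((\<lambda>s. B s i l) has_real_derivative B' i l) (at s0 within A)" for i l
    unfolding B_def B'_def by (rule minv_derivative[where S = S and S' = S', OF S p s0])
  have dz: "((\<lambda>s. z s i) has_real_derivative - m' i) (at s0 within A)" if "i < d" for i
    unfolding z_def using DERIV_diff[OF DERIV_const m[OF that]] by simp
  have B'z: "(\<Sum>l<d. B' i l * z s0 l) = - (\<Sum>q<d. \<Sum>l<d. B s0 i q * S' q l * y s0 l)" for i
  proof -
    have "(\<Sum>l<d. (\<Sum>q<d. \<Sum>r<d. B s0 i q * S' q r * B s0 r l) * z s0 l) = (\<Sum>q<d. \<Sum>r<d. \<Sum>l<d. B s0 i q * S' q r * B s0 r l * z s0 l)"
      unfolding sum_distrib_right
      by (subst sum.swap, rule sum.cong[OF refl], rule sum.swap)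
    thus ?thesis
      by (simp add: B'_def y_def mv_def sum_negf sum_distrib_left mult_ac)
  qed
  have dy: "((\<lambda>s. y s i) has_real_derivative
      - ((\<Sum>q<d. \<Sum>l<d. B s0 i q * S' q l * y s0 l) + (\<Sum>a<d. B s0 i a * m' a))) (at s0 within A)" for i
  proof -
    have "((\<lambda>s. y s i) has_real_derivative (\<Sum>l<d. B' i l * z s0 l + (- m' l) * B s0 i l)) (at s0 within A)"
      unfolding y_def mv_def by (rule DERIV_sum, rule DERIV_mult[OF dB dz]) simp
    thus ?thesis by (simp add: sum.distrib B'z sum_negf sum_subtractf mult.commute[of "m' _"])
  qed
  have dH: "((\<lambda>s. herm d (B s) (y s) is) has_real_derivative
      heat d (B s0) (y s0) m' S' is - heat d (B s0) (y s0) m' S' [] * herm d (B s0) (y s0) is) (at s0 within A)"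
    by (rule herm_path_derivative[where B = B and y = y and ?t0.0 = s0, OF symB sym' dy _ "is"]) (use dB in \<open>auto simp: B'_def\<close>)
  define Z where "Z s = sqrt ((2 * pi) ^ d * mdet d (S s))" for s
  define D where "D = mdet d (S s0)"
  have D: "0 < D" unfolding D_def by (rule mdet_pos[OF P])
  have Z0: "0 < Z s0" using D by (simp add: Z_def D_def)
  define tr where "tr = (\<Sum>i<d. \<Sum>l<d. B s0 i l * S' l i)"
  have dZ: "((\<lambda>s. Z s) has_real_derivative Z s0 * tr / 2) (at s0 within A)"
  proof -
    have "((\<lambda>s. (2 * pi) ^ d * mdet d (S s)) has_real_derivative (2 * pi) ^ d * (D * tr)) (at s0 within A)"
      unfolding D_def tr_def B_def by (rule DERIV_cmult, rule mdet_derivative[where S = S and S' = S', OF S P])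
    from DERIV_chain2[OF DERIV_real_sqrt this] D
    have "((\<lambda>s. Z s) has_real_derivative inverse (Z s0) / 2 * ((2 * pi) ^ d * (D * tr))) (at s0 within A)"
      by (simp add: Z_def[abs_def] D_def)
    moreover have "(2 * pi) ^ d * (D * tr) = Z s0 * Z s0 * tr"
      using D by (simp add: Z_def D_def)
    moreover have "inverse (Z s0) / 2 * (Z s0 * Z s0 * tr) = Z s0 * tr / 2" using Z0 by (simp add: field_simps)
    ultimately show ?thesis by (simp only:)
  qed
  define Q where "Q s = quadform d (B s) (z s)" for s
  have "((\<lambda>s. Q s) has_real_derivative
     quadform d B' (z s0) + 2 * (\<Sum>i<d. - m' i * mv d (B s0) (z s0) i)) (at s0 within A)"
    unfolding Q_def by (rule quadform_derivative[OF dz dB symB])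
  moreover have "quadform d B' (z s0) = - quadform d S' (y s0)"
  proof -
    have "quadform d B' (z s0) = - (\<Sum>i<d. \<Sum>q<d. \<Sum>l<d. z s0 i * B s0 i q * S' q l * y s0 l)"
      unfolding quadform_mv mv_def[of d B'] B'z by (simp add: sum_distrib_left sum_negf mult_ac)
    also have "(\<Sum>i<d. \<Sum>q<d. \<Sum>l<d. z s0 i * B s0 i q * S' q l * y s0 l)
        = (\<Sum>q<d. \<Sum>l<d. \<Sum>i<d. z s0 i * B s0 i q * S' q l * y s0 l)"
      by (subst sum.swap, rule sum.cong[OF refl], rule sum.swap)
    also have "\<dots> = quadform d S' (y s0)"
      unfolding quadform_def
    proof (intro sum.cong refl)
      fix q l
      have "y s0 q = (\<Sum>i<d. z s0 i * B s0 i q)"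
        unfolding y_def mv_def by (intro sum.cong refl) (simp add: symB[of q] mult.commute)
      thus "(\<Sum>i<d. z s0 i * B s0 i q * S' q l * y s0 l) = y s0 q * S' q l * y s0 l"
        by (simp add: sum_distrib_right)
    qed
    finally show ?thesis by simp
  qed
  ultimately have dQ: "((\<lambda>s. Q s) has_real_derivative - quadform d S' (y s0) - 2 * (\<Sum>i<d. m' i * y s0 i)) (at s0 within A)"
    by (simp add: y_def sum_negf)
  define G where "G s = exp (- Q s / 2) / Z s" for s
  have dG: "((\<lambda>s. G s) has_real_derivative G s0 * heat d (B s0) (y s0) m' S' []) (at s0 within A)"
  proof -
    have "((\<lambda>s. - Q s / 2) has_real_derivative - (- quadform d S' (y s0) - 2 * (\<Sum>i<d. m' i * y s0 i)) / 2) (at s0 within A)"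
      by (intro DERIV_cdivide DERIV_minus dQ)
    from DERIV_chain2[OF DERIV_exp this]
    have "((\<lambda>s. exp (- Q s / 2)) has_real_derivative
       exp (- Q s0 / 2) * (- (- quadform d S' (y s0) - 2 * (\<Sum>i<d. m' i * y s0 i)) / 2)) (at s0 within A)" .
    from DERIV_divide[OF this dZ] Z0
    have "((\<lambda>s. G s) has_real_derivative
       (exp (- Q s0 / 2) * (- (- quadform d S' (y s0) - 2 * (\<Sum>i<d. m' i * y s0 i)) / 2) * Z s0 -
         exp (- Q s0 / 2) * (Z s0 * tr / 2)) / (Z s0 * Z s0)) (at s0 within A)"
      unfolding G_def by simp
    moreover have "heat d (B s0) (y s0) m' S' [] = (\<Sum>i<d. m' i * y s0 i) + (quadform d S' (y s0) - tr) / 2"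
    proof -
      have "herm d (B s0) (y s0) [a, b] = y s0 a * y s0 b - B s0 a b" if "b < d" for a b
        using that by (simp add: herm.simps(2) if_distrib[of "\<lambda>x. real x * _"] if_distrib[of "\<lambda>x. x * _"] cong: if_cong)
      hence "(\<Sum>a<d. \<Sum>b<d. S' a b * herm d (B s0) (y s0) [a, b]) = (\<Sum>a<d. \<Sum>b<d. S' a b * (y s0 a * y s0 b - B s0 a b))"
        by simp
      also have "\<dots> = quadform d S' (y s0) - (\<Sum>a<d. \<Sum>b<d. S' a b * B s0 a b)"
        by (simp add: right_diff_distrib sum_subtractf quadform_def mult_ac)
      also have "(\<Sum>a<d. \<Sum>b<d. S' a b * B s0 a b) = tr"
        unfolding tr_def by (intro sum.cong refl) (use sym' in \<open>simp add: mult.commute\<close>)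
      finally show ?thesis unfolding heat_def by (simp add: herm.simps(2))
    qed
    moreover have "(E * (- (- q - 2 * u) / 2) * Z0 - E * (Z0 * t / 2)) / (Z0 * Z0) = E / Z0 * (u + (q - t) / 2)"
      if "0 < Z0" for E q u Z0 t :: real
      using that by (simp add: field_simps)
    ultimately show ?thesis using Z0 by (simp only: G_def)
  qed
  have hgG: "hg d (m s) (S s) js x = herm d (B s) (y s) js * G s" for s js
    by (simp add: hg_def yv_def gd_def y_def z_def[abs_def] G_def Q_def Z_def B_def)
  \<comment> \<open>The correction term of \<open>dH\<close> cancels against the derivative of the
    density.\<close>
  have "((\<lambda>s. herm d (B s) (y s) is * G s) has_real_derivative heat d (B s0) (y s0) m' S' is * G s0) (at s0 within A)"
    using DERIV_mult[OF dH dG] by (rule back_subst[where P = "\<lambda>D. (_ has_real_derivative D) _"]) (simp add: algebra_simps)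
  thus ?thesis
    unfolding hgG heat_def by (simp add: sum_distrib_right distrib_right mult.assoc)
qed

text \<open>The recursion of \<open>herm\<close> is made for this product rule: the density
  contributes - y_i, the polynomial factor contributes \<open>lower\<close>.\<close>

lemma hg_derivative:
  assumes p: "pdm d \<beta> S" and "is": "set is \<subseteq> {..<d}" and i: "i < d"
  shows "((\<lambda>t. hg d \<mu> S is (x(i := t))) has_real_derivative - hg d \<mu> S (i # is) (x(i := t0))) (at t0)"
proof -
  define B where "B = minv d S"
  have symB: "B i l = B l i" for i l unfolding B_def by (rule minv_spec(4)[OF p])
  define z where "z t l = (x(i := t)) l - \<mu> l" for t l
  define y where "y t = mv d B (z t)" for t
  have dz: "((\<lambda>t. z t l) has_real_derivative idm i l) (at t0)" for l
    unfolding z_def idm_def by (cases "i = l") (auto intro!: derivative_eq_intros)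
  have dy: "((\<lambda>t. y t l) has_real_derivative B i l) (at t0)" for l
  proof -
    have "((\<lambda>t. y t l) has_real_derivative (\<Sum>r<d. B l r * idm i r)) (at t0)"
      unfolding y_def mv_def by (rule DERIV_sum, rule DERIV_cmult[OF dz])
    moreover have "(\<Sum>r<d. B l r * idm i r) = B i l"
      using i sum_idm(2)[OF i, of "B l"] by (simp add: mult.commute symB[of i])
    ultimately show ?thesis by simp
  qed
  have dH: "((\<lambda>t. herm d B (y t) is) has_real_derivative lower d B (y t0) (B i) [] is) (at t0)"
    by (rule herm_derivative[OF symB dy "is"])
  define G where "G t = exp (- quadform d B (z t) / 2) / sqrt ((2 * pi) ^ d * mdet d S)" for t
  have "((\<lambda>t. quadform d B (z t)) has_real_derivative quadform d (\<lambda>_ _. 0) (z t0) + 2 * (\<Sum>r<d. idm i r * mv d B (z t0) r)) (at t0)"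
    by (rule quadform_derivative[OF dz _ symB]) simp
  hence "((\<lambda>t. quadform d B (z t)) has_real_derivative 2 * y t0 i) (at t0)"
    using i by (simp add: quadform_def y_def)
  hence "((\<lambda>t. - quadform d B (z t) / 2) has_real_derivative - (2 * y t0 i) / 2) (at t0)"
    by (intro DERIV_cdivide DERIV_minus)
  from DERIV_cdivide[OF DERIV_chain2[OF DERIV_exp this], of "sqrt ((2 * pi) ^ d * mdet d S)"]
  have dG: "((\<lambda>t. G t) has_real_derivative - y t0 i * G t0) (at t0)"
    unfolding G_def by (simp add: mult.commute)
  have hgG: "hg d \<mu> S js (x(i := t)) = herm d B (y t) js * G t" for t js
    by (simp add: hg_def yv_def gd_def y_def z_def[abs_def] G_def B_def)
  show ?thesis
    unfolding hgG herm_Cons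
    using DERIV_mult[OF dH dG] by (rule back_subst[where P = "\<lambda>D. (_ has_real_derivative D) _"]) (simp add: algebra_simps)
qed

subsection \<open>Gaussian domination and integration by parts\<close>

definition gw :: "nat \<Rightarrow> real \<Rightarrow> real \<Rightarrow> real" where
  "gw N \<kappa> t = (1 + \<bar>t\<bar>) ^ N * exp (- \<kappa> * t\<^sup>2)"

lemma gw_nonneg [simp]: "0 \<le> gw N \<kappa> t"
  by (simp add: gw_def)

text \<open>Polynomial growth costs half of the decay rate, by u^N \<le> N^N exp u and |t| \<le>
  \<kappa> t^2 / 2 + 1 / (2 \<kappa>).\<close>

lemma gw_bound:
  assumes "0 < \<kappa>"
  shows "gw N \<kappa> t \<le> real N ^ N * exp (1 + 1 / (2 * \<kappa>)) * exp (- (\<kappa> / 2) * t\<^sup>2)"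
proof -
  have a: "u ^ N \<le> real N ^ N * exp u" if "0 \<le> u" for u :: real
  proof (cases "N = 0")
    case False
    have "(u / real N) ^ N \<le> exp (u / real N) ^ N"
      using that exp_ge_add_one_self[of "u / real N"] by (intro power_mono) (linarith, simp)
    also have "\<dots> = exp u" using False by (simp flip: exp_of_nat_mult)
    finally show ?thesis using False by (simp add: power_divide field_simps)
  qed (use that in simp)
  have "\<bar>t\<bar> \<le> \<kappa> / 2 * t\<^sup>2 + 1 / (2 * \<kappa>)"
  proof -
    have "0 \<le> (\<kappa> * \<bar>t\<bar> - 1)\<^sup>2 / (2 * \<kappa>)" using assms by simp
    also have "\<dots> = \<kappa> / 2 * t\<^sup>2 + 1 / (2 * \<kappa>) - \<bar>t\<bar>"
      using assms by (simp add: power2_eq_square field_simps)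
    finally show ?thesis by simp
  qed
  hence "exp (1 + \<bar>t\<bar>) \<le> exp (1 + (\<kappa> / 2 * t\<^sup>2 + 1 / (2 * \<kappa>)))" by simp
  hence "(1 + \<bar>t\<bar>) ^ N \<le> real N ^ N * exp (1 + (\<kappa> / 2 * t\<^sup>2 + 1 / (2 * \<kappa>)))"
    using a[of "1 + \<bar>t\<bar>"] by (meson order_trans mult_left_mono zero_le_power of_nat_0_le_iff add_nonneg_nonneg abs_ge_zero zero_le_one)
  hence "gw N \<kappa> t \<le> real N ^ N * exp (1 + (\<kappa> / 2 * t\<^sup>2 + 1 / (2 * \<kappa>))) * exp (- \<kappa> * t\<^sup>2)"
    unfolding gw_def by (intro mult_right_mono) auto
  also have "\<dots> = real N ^ N * (exp (1 + (\<kappa> / 2 * t\<^sup>2 + 1 / (2 * \<kappa>))) * exp (- \<kappa> * t\<^sup>2))" by simp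
  also have "exp (1 + (\<kappa> / 2 * t\<^sup>2 + 1 / (2 * \<kappa>))) * exp (- \<kappa> * t\<^sup>2) = exp (1 + 1 / (2 * \<kappa>)) * exp (- (\<kappa> / 2) * t\<^sup>2)"
    unfolding exp_add[symmetric] by (rule arg_cong[where f = exp]) (simp add: field_simps)
  finally show ?thesis by simp
qed

lemma gw_measurable [measurable]: "gw N \<kappa> \<in> borel_measurable borel"
  unfolding gw_def by measurable

lemma integrable_gw:
  assumes "0 < \<kappa>"
  shows "integrable lborel (gw N \<kappa>)"
proof -
  define \<sigma> where "\<sigma> = 1 / sqrt \<kappa>"
  have s: "\<sigma>\<^sup>2 = 1 / \<kappa>" "0 < \<sigma>" using assms by (simp_all add: \<sigma>_def power_divide)
  have "exp (- (\<kappa> / 2) * t\<^sup>2) = sqrt (2 * pi * \<sigma>\<^sup>2) * normal_density 0 \<sigma> t" for t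
    using assms s by (simp add: normal_density_def s(1))
  hence "integrable lborel (\<lambda>t. real N ^ N * exp (1 + 1 / (2 * \<kappa>)) * exp (- (\<kappa> / 2) * t\<^sup>2))"
    using s by (simp del: mult_minus_left)
  thus ?thesis
  proof (rule Bochner_Integration.integrable_bound)
    show "AE t in lborel. norm (gw N \<kappa> t) \<le> norm (real N ^ N * exp (1 + 1 / (2 * \<kappa>)) * exp (- (\<kappa> / 2) * t\<^sup>2))"
      using gw_bound[OF assms, of N] by (intro AE_I2) (simp add: gw_nonneg)
  qed simp
qed

lemma gw_tendsto:
  assumes "0 < \<kappa>"
  shows "((\<lambda>n. gw N \<kappa> (real n)) \<longlongrightarrow> 0) sequentially" "((\<lambda>n. gw N \<kappa> (- real n)) \<longlongrightarrow> 0) sequentially"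
proof -
  have "filterlim (\<lambda>n. (\<kappa> / 2) * (real n)\<^sup>2) at_top sequentially"
    using assms by (intro filterlim_tendsto_pos_mult_at_top[OF tendsto_const] filterlim_pow_at_top filterlim_real_sequentially) auto
  hence "((\<lambda>n. exp (- ((\<kappa> / 2) * (real n)\<^sup>2))) \<longlongrightarrow> 0) sequentially"
    by (intro filterlim_compose[OF exp_at_bot]) (simp add: filterlim_uminus_at_top)
  hence "((\<lambda>n. real N ^ N * exp (1 + 1 / (2 * \<kappa>)) * exp (- (\<kappa> / 2) * (real n)\<^sup>2)) \<longlongrightarrow> real N ^ N * exp (1 + 1 / (2 * \<kappa>)) * 0) sequentially"
    by (intro tendsto_mult tendsto_const) simp
  hence l: "((\<lambda>n. real N ^ N * exp (1 + 1 / (2 * \<kappa>)) * exp (- (\<kappa> / 2) * (real n)\<^sup>2)) \<longlongrightarrow> 0) sequentially"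
    by simp
  show "((\<lambda>n. gw N \<kappa> (real n)) \<longlongrightarrow> 0) sequentially"
    by (rule tendsto_sandwich[OF _ _ tendsto_const l]) (use gw_bound[OF assms] in \<open>auto intro!: always_eventually\<close>)
  thus "((\<lambda>n. gw N \<kappa> (- real n)) \<longlongrightarrow> 0) sequentially" by (simp add: gw_def)
qed

lemma integral_derivative_zero:
  fixes f f' :: "real \<Rightarrow> real"
  assumes d: "\<And>t. (f has_real_derivative f' t) (at t)" and c: "\<And>t. isCont f' t"
    and i: "integrable lborel f'" and b: "\<And>t. \<bar>f t\<bar> \<le> K * gw N \<kappa> t" and k: "0 < \<kappa>"
  shows "(\<integral>t. f' t \<partial>lborel) = 0"
proof -
  have K: "((\<lambda>n. K * gw N \<kappa> (real n)) \<longlongrightarrow> K * 0) sequentially" "((\<lambda>n. K * gw N \<kappa> (- real n)) \<longlongrightarrow> K * 0) sequentially"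
    by (intro tendsto_mult tendsto_const gw_tendsto k)+
  have "((\<lambda>n. f (real n)) \<longlongrightarrow> 0) sequentially"
    by (rule Lim_null_comparison[OF _ K(1)[unfolded mult_zero_right]]) (use b in \<open>auto intro!: always_eventually\<close>)
  moreover have "((\<lambda>n. f (- real n)) \<longlongrightarrow> 0) sequentially"
    by (rule Lim_null_comparison[OF _ K(2)[unfolded mult_zero_right]]) (use b in \<open>auto intro!: always_eventually\<close>)
  ultimately have "((\<lambda>n. f (real n) - f (- real n)) \<longlongrightarrow> 0 - 0) sequentially"
    by (rule tendsto_diff)
  moreover have "(\<integral>t. f' t * indicator {- real n..real n} t \<partial>lborel) = f (real n) - f (- real n)" for n
    by (rule integral_FTC_Icc_real) (use d c in auto)
  moreover have "(\<lambda>n. \<integral>t. f' t * indicator {- real n..real n} t \<partial>lborel) \<longlonglongrightarrow> (\<integral>t. f' t \<partial>lborel)"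
  proof (rule integral_dominated_convergence[where w = "\<lambda>t. norm (f' t)"])
    show "AE t in lborel. (\<lambda>n. f' t * indicator {- real n..real n} t) \<longlonglongrightarrow> f' t"
    proof (rule AE_I2)
      fix t
      have "eventually (\<lambda>n. f' t * indicator {- real n..real n} t = f' t) sequentially"
        using eventually_ge_at_top[of "nat \<lceil>\<bar>t\<bar>\<rceil>"]
        by eventually_elim (auto simp: indicator_def nat_le_iff ceiling_le_iff abs_le_iff)
      thus "(\<lambda>n. f' t * indicator {- real n..real n} t) \<longlonglongrightarrow> f' t" by (rule tendsto_eventually)
    qed
  qed (use i in \<open>auto simp: indicator_def intro!: AE_I2\<close>)
  ultimately show ?thesis using LIMSEQ_unique by fastforce
qed

interpretation lebd: product_sigma_finite "\<lambda>_::nat. lborel :: real measure"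
  by standard

lemma sigma_finite_lebd: "sigma_finite_measure (lebd d)"
  by (rule lebd.sigma_finite) simp

text \<open>A product of one-dimensional weights instead of a function of |x|, so that integrability
  and restriction to a coordinate line are immediate. The constants in front of it depend on d; they
  justify limits and exchanges of integrals, and enter no quantitative estimate.\<close>

definition Gw :: "nat \<Rightarrow> nat \<Rightarrow> real \<Rightarrow> (nat \<Rightarrow> real) \<Rightarrow> real" where
  "Gw d N \<kappa> x = (\<Prod>i<d. gw N \<kappa> (x i))"

lemma Gw_nonneg [simp]: "0 \<le> Gw d N \<kappa> x"
  unfolding Gw_def by (rule prod_nonneg) simp

lemma integrable_Gw: "0 < \<kappa> \<Longrightarrow> integrable (lebd d) (Gw d N \<kappa>)"
  unfolding Gw_def by (rule lebd.product_integrable_prod) (auto intro: integrable_gw)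

lemma Gw_mult:
  "(\<Prod>i<d. 1 + \<bar>x i\<bar>) ^ n * Gw d N \<kappa> x = Gw d (n + N) \<kappa> x"
  unfolding Gw_def by (simp add: gw_def power_add prod.distrib prod_power_distrib mult.assoc)

lemma integrable_Gw_bound:
  assumes "f \<in> borel_measurable (lebd d)" "\<And>x. \<bar>f x\<bar> \<le> K * Gw d N \<kappa> x" "0 < \<kappa>"
  shows "integrable (lebd d) f"
proof (rule Bochner_Integration.integrable_bound)
  show "integrable (lebd d) (\<lambda>x. K * Gw d N \<kappa> x)"
    using integrable_Gw[OF assms(3)] by simp
  show "AE x in lebd d. norm (f x) \<le> norm (K * Gw d N \<kappa> x)"
    using assms(2) by (intro AE_I2) (smt (verit) real_norm_def)
qed (rule assms)

text \<open>Integrate over the i-th coordinate first: the bound on f removes the boundary terms, the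
  bound on f' permits Fubini.\<close>

lemma lebd_integral_derivative_zero:
  assumes i: "i < d" and k: "0 < \<kappa>"
    and d: "\<And>x t. ((\<lambda>t. f (x(i := t))) has_real_derivative f' (x(i := t))) (at t)"
    and c: "\<And>x t. isCont (\<lambda>t. f' (x(i := t))) t"
    and m: "f' \<in> borel_measurable (lebd d)"
    and b: "\<And>x. \<bar>f x\<bar> \<le> K * Gw d N \<kappa> x" and b': "\<And>x. \<bar>f' x\<bar> \<le> K' * Gw d N' \<kappa> x"
  shows "(\<integral>x. f' x \<partial>lebd d) = 0"
proof -
  have ins: "insert i ({..<d} - {i}) = {..<d}" using i by auto
  have G: "Gw d N \<kappa> (x(i := t)) = (\<Prod>l\<in>{..<d} - {i}. gw N \<kappa> (x l)) * gw N \<kappa> t" for x t N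
  proof -
    have "Gw d N \<kappa> (x(i := t)) = (\<Prod>l\<in>insert i ({..<d} - {i}). gw N \<kappa> ((x(i := t)) l))"
      by (simp only: Gw_def ins)
    also have "\<dots> = gw N \<kappa> t * (\<Prod>l\<in>{..<d} - {i}. gw N \<kappa> ((x(i := t)) l))"
      by (subst prod.insert) auto
    also have "(\<Prod>l\<in>{..<d} - {i}. gw N \<kappa> ((x(i := t)) l)) = (\<Prod>l\<in>{..<d} - {i}. gw N \<kappa> (x l))"
      by (intro prod.cong) auto
    finally show ?thesis by (simp only: mult.commute)
  qed
  have "(\<integral>x. f' x \<partial>lebd d) = (\<integral>x. (\<integral>t. f' (x(i := t)) \<partial>lborel) \<partial>PiM ({..<d} - {i}) (\<lambda>_. lborel))"
    using lebd.product_integral_insert[of "{..<d} - {i}" i f'] integrable_Gw_bound[OF m b' k]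
    unfolding ins by simp
  also have "\<dots> = 0"
  proof -
    have "(\<integral>t. f' (x(i := t)) \<partial>lborel) = 0" for x
    proof (rule integral_derivative_zero[OF d c _ _ k])
      show "\<bar>f (x(i := t))\<bar> \<le> (K * (\<Prod>l\<in>{..<d} - {i}. gw N \<kappa> (x l))) * gw N \<kappa> t" for t
        using b[of "x(i := t)"] by (simp add: G mult.assoc)
      show "integrable lborel (\<lambda>t. f' (x(i := t)))"
      proof (rule Bochner_Integration.integrable_bound)
        show "integrable lborel (\<lambda>t. (K' * (\<Prod>l\<in>{..<d} - {i}. gw N' \<kappa> (x l))) * gw N' \<kappa> t)"
          using integrable_gw[OF k] by simp
        have "continuous_on UNIV (\<lambda>t. f' (x(i := t)))"
          using c by (simp add: continuous_at_imp_continuous_on)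
        thus "(\<lambda>t. f' (x(i := t))) \<in> borel_measurable lborel"
          by (simp add: borel_measurable_continuous_onI)
        show "AE t in lborel. norm (f' (x(i := t))) \<le> norm ((K' * (\<Prod>l\<in>{..<d} - {i}. gw N' \<kappa> (x l))) * gw N' \<kappa> t)"
          using b'[of "x(i := _)"] by (intro AE_I2) (simp add: G mult.assoc, smt (verit))
      qed
    qed
    thus ?thesis by simp
  qed
  finally show ?thesis .
qed

section \<open>Measurability and domination of Hermite functions\<close>

lemma herm_measurable:
  assumes "\<And>i. i < d \<Longrightarrow> (\<lambda>\<omega>. y \<omega> i) \<in> borel_measurable M"
    and "\<And>i l. i < d \<Longrightarrow> l < d \<Longrightarrow> (\<lambda>\<omega>. B \<omega> i l) \<in> borel_measurable M"
  shows "set is \<subseteq> {..<d} \<Longrightarrow> (\<lambda>\<omega>. herm d (B \<omega>) (y \<omega>) is) \<in> borel_measurable M"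
proof (induction "length is" arbitrary: "is" rule: less_induct)
  case less
  show ?case
  proof (cases "is")
    case (Cons i r)
    hence "i < d" and r: "set r \<subseteq> {..<d}" using less.prems by auto
    thus ?thesis unfolding Cons herm.simps(2) using Cons set_remove1_le[OF r]
      by (intro borel_measurable_diff borel_measurable_times borel_measurable_sum borel_measurable_const assms less.hyps)
        (auto simp: length_remove1)
  qed simp
qed

text \<open>Mean and covariance may vary with \<omega> too, because the Taylor remainder requires
  joint measurability in the path parameter and the point.\<close>

lemma hg_measurable:
  assumes x: "\<And>i. i < d \<Longrightarrow> (\<lambda>\<omega>. x \<omega> i) \<in> borel_measurable M"
    and \<mu>: "\<And>i. i < d \<Longrightarrow> (\<lambda>\<omega>. \<mu> \<omega> i) \<in> borel_measurable M"
    and B: "\<And>i l. i < d \<Longrightarrow> l < d \<Longrightarrow> (\<lambda>\<omega>. minv d (S \<omega>) i l) \<in> borel_measurable M"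
    and S: "(\<lambda>\<omega>. mdet d (S \<omega>)) \<in> borel_measurable M"
    and "is": "set is \<subseteq> {..<d}"
  shows "(\<lambda>\<omega>. hg d (\<mu> \<omega>) (S \<omega>) is (x \<omega>)) \<in> borel_measurable M"
proof -
  have "(\<lambda>\<omega>. herm d (minv d (S \<omega>)) (yv d (\<mu> \<omega>) (S \<omega>) (x \<omega>)) is) \<in> borel_measurable M"
    unfolding yv_def mv_def
    by (intro herm_measurable borel_measurable_sum borel_measurable_times borel_measurable_diff x \<mu> B "is") auto
  moreover have "(\<lambda>\<omega>. gd d (\<mu> \<omega>) (S \<omega>) (x \<omega>)) \<in> borel_measurable M"
  proof -
    have "(\<lambda>\<omega>. quadform d (minv d (S \<omega>)) (\<lambda>i. x \<omega> i - \<mu> \<omega> i)) \<in> borel_measurable M"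
      unfolding quadform_def by (intro borel_measurable_sum borel_measurable_times borel_measurable_diff x \<mu> B) auto
    thus ?thesis unfolding gd_def using S by measurable
  qed
  ultimately show ?thesis unfolding hg_def by (rule borel_measurable_times)
qed

lemma hg_measurable_lebd [measurable]:
  "set is \<subseteq> {..<d} \<Longrightarrow> (\<lambda>x. hg d \<mu> S is x) \<in> borel_measurable (lebd d)"
  by (rule hg_measurable) auto

lemma herm_bound:
  assumes "0 \<le> \<beta>"
  shows "set is \<subseteq> {..<d} \<Longrightarrow> \<exists>K\<ge>0. \<forall>B y (Y::real). 1 \<le> Y \<and> (\<forall>i<d. \<bar>y i\<bar> \<le> Y) \<and> (\<forall>i l. \<bar>B i l\<bar> \<le> \<beta>) \<longrightarrow>
    \<bar>herm d B y is\<bar> \<le> K * Y ^ length is"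
proof (induction "length is" arbitrary: "is" rule: less_induct)
  case less
  show ?case
  proof (cases "is")
    case Nil
    thus ?thesis by (auto intro!: exI[of _ 1])
  next
    case (Cons i r)
    hence i: "i < d" and r: "set r \<subseteq> {..<d}" using less.prems by auto
    have "\<exists>K\<ge>0. \<forall>B y (Y::real). 1 \<le> Y \<and> (\<forall>i<d. \<bar>y i\<bar> \<le> Y) \<and> (\<forall>i l. \<bar>B i l\<bar> \<le> \<beta>) \<longrightarrow> \<bar>herm d B y u\<bar> \<le> K * Y ^ length u"
      if "length u \<le> length r" "set u \<subseteq> {..<d}" for u
      using less.hyps[of u] that Cons by simp
    then obtain K where K: "\<And>u. length u \<le> length r \<Longrightarrow> set u \<subseteq> {..<d} \<Longrightarrow> 0 \<le> K u"
      "\<And>u B y (Y::real). length u \<le> length r \<Longrightarrow> set u \<subseteq> {..<d} \<Longrightarrow> 1 \<le> Y \<Longrightarrow> (\<forall>i<d. \<bar>y i\<bar> \<le> Y) \<Longrightarrow> (\<forall>i l. \<bar>B i l\<bar> \<le> \<beta>) \<Longrightarrow>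
         \<bar>herm d B y u\<bar> \<le> K u * Y ^ length u"
      by metis
    define C where "C = K r + (\<Sum>b<d. real (count_list r b) * \<beta> * K (remove1 b r))"
    have rm: "length (remove1 b r) \<le> length r" "set (remove1 b r) \<subseteq> {..<d}" for b
      using set_remove1_le[OF r] by (auto simp: length_remove1)
    show ?thesis
    proof (intro exI[of _ C] conjI allI impI)
      show "0 \<le> C" unfolding C_def using K(1) r rm assms by (intro add_nonneg_nonneg sum_nonneg mult_nonneg_nonneg) auto
      fix B :: "nat \<Rightarrow> nat \<Rightarrow> real" and y :: "nat \<Rightarrow> real" and Y :: real assume H: "1 \<le> Y \<and> (\<forall>i<d. \<bar>y i\<bar> \<le> Y) \<and> (\<forall>i l. \<bar>B i l\<bar> \<le> \<beta>)"
      let ?n = "length r"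
      have "\<bar>herm d B y is\<bar> \<le> \<bar>y i\<bar> * \<bar>herm d B y r\<bar> + \<bar>\<Sum>b<d. real (count_list r b) * B i b * herm d B y (remove1 b r)\<bar>"
        unfolding Cons herm.simps(2) abs_mult[symmetric] by (rule abs_triangle_ineq4)
      also have "\<bar>\<Sum>b<d. real (count_list r b) * B i b * herm d B y (remove1 b r)\<bar>
          \<le> (\<Sum>b<d. real (count_list r b) * \<beta> * K (remove1 b r)) * Y ^ Suc ?n"
        unfolding sum_distrib_right
      proof (rule order_trans[OF sum_abs sum_mono])
        fix b
        have "\<bar>herm d B y (remove1 b r)\<bar> \<le> K (remove1 b r) * Y ^ length (remove1 b r)"
          using K(2)[OF rm] H by blast
        also have "\<dots> \<le> K (remove1 b r) * Y ^ Suc ?n"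
          using H rm K(1)[OF rm] by (intro mult_left_mono power_increasing le_SucI) auto
        finally show "\<bar>real (count_list r b) * B i b * herm d B y (remove1 b r)\<bar> \<le> real (count_list r b) * \<beta> * K (remove1 b r) * Y ^ Suc ?n"
          using H assms unfolding abs_mult mult.assoc by (intro mult_mono) auto
      qed
      also have "\<bar>y i\<bar> * \<bar>herm d B y r\<bar> \<le> Y * (K r * Y ^ ?n)"
        using H i K(2)[OF _ r] by (intro mult_mono) auto
      finally show "\<bar>herm d B y is\<bar> \<le> C * Y ^ length is" unfolding C_def Cons by (simp add: algebra_simps)
    qed
  qed
qed

text \<open>K is chosen before \<mu>, S and x, so that one majorant serves a whole path of
  Gaussians. The decay 1 / (2 \<beta>) of the density drops to 1 / (4 \<beta>) through (x - \<mu>)^2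
  \<ge> x^2 / 2 - \<mu>^2.\<close>

lemma hg_bound:
  assumes b: "0 < \<beta>" and M0: "0 \<le> M0" and D0: "0 < D0" and "is": "set is \<subseteq> {..<d}"
  shows "\<exists>K\<ge>0. \<forall>\<mu> S x. pdm d \<beta> S \<and> (\<forall>i<d. \<bar>\<mu> i\<bar> \<le> M0) \<and> D0 \<le> mdet d S \<longrightarrow>
    \<bar>hg d \<mu> S is x\<bar> \<le> K * Gw d (length is) (1 / (4 * \<beta>)) x"
proof -
  from herm_bound[OF less_imp_le[OF b] "is"] obtain K where K: "0 \<le> K"
    "\<And>B y (Y::real). 1 \<le> Y \<Longrightarrow> (\<forall>i<d. \<bar>y i\<bar> \<le> Y) \<Longrightarrow> (\<forall>i l. \<bar>B i l\<bar> \<le> \<beta>) \<Longrightarrow> \<bar>herm d B y is\<bar> \<le> K * Y ^ length is"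
    by blast
  \<comment> \<open>c bounds y = B (x - \<mu>) relative to the product of the 1 + |x_i|, each entry
    of B being at most \<beta>. E collects the loss from recentring the exponent at 0 and the worst
    normalization.\<close>
  define c where "c = 1 + real d * \<beta> * (1 + M0)"
  define E where "E = exp (real d * M0\<^sup>2 / (2 * \<beta>)) / sqrt ((2 * pi) ^ d * D0)"
  have c1: "1 \<le> c" unfolding c_def using b M0 by simp
  have E0: "0 \<le> E" unfolding E_def using D0 by simp
  show ?thesis
  proof (intro exI[of _ "K * c ^ length is * E"] conjI allI impI)
    show "0 \<le> K * c ^ length is * E" using K(1) c1 E0 by simp
    fix \<mu> x :: "nat \<Rightarrow> real" and S assume H: "pdm d \<beta> S \<and> (\<forall>i<d. \<bar>\<mu> i\<bar> \<le> M0) \<and> D0 \<le> mdet d S"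
    define P where "P = (\<Prod>i<d. 1 + \<bar>x i\<bar>)"
    have P1: "1 \<le> P" unfolding P_def by (rule prod_ge_1) simp
    have Px: "1 + \<bar>x l\<bar> \<le> P" if "l < d" for l
      unfolding P_def using prod_mono2[of "{..<d}" "{l}" "\<lambda>i. 1 + \<bar>x i\<bar>"] that by simp
    have y: "\<bar>yv d \<mu> S x i\<bar> \<le> c * P" for i
    proof -
      have "\<bar>yv d \<mu> S x i\<bar> \<le> (\<Sum>l<d. \<bar>minv d S i l\<bar> * \<bar>x l - \<mu> l\<bar>)"
        unfolding yv_def mv_def abs_mult[symmetric] by (rule sum_abs)
      also have "\<dots> \<le> (\<Sum>l<d. \<beta> * ((1 + M0) * P))"
      proof (intro sum_mono mult_mono)
        fix l assume "l \<in> {..<d}"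
        hence l: "l < d" by simp
        have "\<bar>x l - \<mu> l\<bar> \<le> \<bar>x l\<bar> + M0 * 1" using H l by (smt (verit) mult_cancel_left1)
        also have "M0 * 1 \<le> M0 * P" using M0 P1 by (intro mult_left_mono) auto
        also have "\<bar>x l\<bar> \<le> P" using Px[OF l] by simp
        finally show "\<bar>x l - \<mu> l\<bar> \<le> (1 + M0) * P" by (simp add: distrib_right)
      qed (use H b minv_entry_le in auto)
      also have "\<dots> \<le> c * P" unfolding c_def using P1 by (simp add: distrib_right mult.assoc)
      finally show ?thesis .
    qed
    have h: "\<bar>herm d (minv d S) (yv d \<mu> S x) is\<bar> \<le> K * (c * P) ^ length is"
    proof (rule K(2))
      show "1 \<le> c * P" using c1 P1 mult_mono[of 1 c 1 P] by simp
    qed (use y H minv_entry_le in auto)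
    have g: "gd d \<mu> S x \<le> E * exp (- (1 / (4 * \<beta>)) * (\<Sum>i<d. (x i)\<^sup>2))"
    proof -
      have "1 / \<beta> * (\<Sum>i<d. (x i - \<mu> i)\<^sup>2) \<le> quadform d (minv d S) (\<lambda>i. x i - \<mu> i)"
        using H by (intro minv_quadform_ge) auto
      moreover have "(\<Sum>i<d. (x i)\<^sup>2) / 2 - real d * M0\<^sup>2 \<le> (\<Sum>i<d. (x i - \<mu> i)\<^sup>2)"
      proof -
        have "(\<Sum>i<d. (x i)\<^sup>2) / 2 - real d * M0\<^sup>2 = (\<Sum>i<d. (x i)\<^sup>2 / 2 - M0\<^sup>2)"
          by (simp add: sum_subtractf sum_divide_distrib)
        also have "\<dots> \<le> (\<Sum>i<d. (x i - \<mu> i)\<^sup>2)"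
        proof (rule sum_mono)
          fix i assume "i \<in> {..<d}"
          hence "(\<mu> i)\<^sup>2 \<le> M0\<^sup>2" using H M0 by (simp add: abs_le_square_iff[symmetric])
          moreover have "0 \<le> (x i - 2 * \<mu> i)\<^sup>2 / 2" by simp
          ultimately show "(x i)\<^sup>2 / 2 - M0\<^sup>2 \<le> (x i - \<mu> i)\<^sup>2"
            by (simp add: power2_eq_square algebra_simps)
        qed
        finally show ?thesis .
      qed
      ultimately have "- quadform d (minv d S) (\<lambda>i. x i - \<mu> i) / 2 \<le> real d * M0\<^sup>2 / (2 * \<beta>) + - (1 / (4 * \<beta>)) * (\<Sum>i<d. (x i)\<^sup>2)"
        using b by (simp add: field_simps)
      hence "exp (- quadform d (minv d S) (\<lambda>i. x i - \<mu> i) / 2) \<le> exp (real d * M0\<^sup>2 / (2 * \<beta>)) * exp (- (1 / (4 * \<beta>)) * (\<Sum>i<d. (x i)\<^sup>2))"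
        unfolding exp_add[symmetric] by simp
      moreover have "sqrt ((2 * pi) ^ d * D0) \<le> sqrt ((2 * pi) ^ d * mdet d S)"
        using H by (intro real_sqrt_le_mono mult_left_mono) auto
      moreover have "0 < sqrt ((2 * pi) ^ d * D0)" using D0 by simp
      ultimately have "gd d \<mu> S x \<le> exp (real d * M0\<^sup>2 / (2 * \<beta>)) * exp (- (1 / (4 * \<beta>)) * (\<Sum>i<d. (x i)\<^sup>2)) / sqrt ((2 * pi) ^ d * D0)"
        unfolding gd_def by (intro frac_le) auto
      thus ?thesis by (simp add: E_def)
    qed
    have Gwe: "P ^ n * exp (- \<kappa> * (\<Sum>i<d. (x i)\<^sup>2)) = Gw d n \<kappa> x" for n \<kappa>
      unfolding Gw_def gw_def P_def by (simp add: prod.distrib prod_power_distrib exp_sum[symmetric] sum_distrib_left sum_negf)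
    have "0 \<le> gd d \<mu> S x" using H gd_pos less_imp_le by blast
    hence "\<bar>hg d \<mu> S is x\<bar> = \<bar>herm d (minv d S) (yv d \<mu> S x) is\<bar> * gd d \<mu> S x"
      by (simp add: hg_def abs_mult)
    also have "\<dots> \<le> K * (c * P) ^ length is * (E * exp (- (1 / (4 * \<beta>)) * (\<Sum>i<d. (x i)\<^sup>2)))"
      using h g \<open>0 \<le> gd d \<mu> S x\<close> by (intro mult_mono) auto
    also have "\<dots> = K * c ^ length is * E * Gw d (length is) (1 / (4 * \<beta>)) x"
      unfolding Gwe[symmetric] by (simp add: power_mult_distrib mult_ac)
    finally show "\<bar>hg d \<mu> S is x\<bar> \<le> K * c ^ length is * E * Gw d (length is) (1 / (4 * \<beta>)) x" .
  qed
qed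

text \<open>Growth is measured by the product of the 1 + |x_i|, which merges with the weight by
  \<open>Gw_mult\<close>.\<close>

definition pgrow :: "nat \<Rightarrow> ((nat \<Rightarrow> real) \<Rightarrow> real) \<Rightarrow> bool" where
  "pgrow d q \<longleftrightarrow> q \<in> borel_measurable (lebd d) \<and> (\<exists>K n. \<forall>x. \<bar>q x\<bar> \<le> K * (\<Prod>i<d. 1 + \<bar>x i\<bar>) ^ n)"

lemma prod_abs_ge_1: "1 \<le> (\<Prod>i<d. 1 + \<bar>x i :: real\<bar>)"
  by (rule prod_ge_1) simp

lemma pgrow_const: "pgrow d (\<lambda>x. c)"
  unfolding pgrow_def
proof (intro conjI exI allI)
  show "\<bar>c\<bar> \<le> \<bar>c\<bar> * (\<Prod>i<d. 1 + \<bar>x i\<bar>) ^ 0" for x :: "nat \<Rightarrow> real" by simp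
qed simp

lemma pgrow_coord: "i < d \<Longrightarrow> pgrow d (\<lambda>x. x i)"
  unfolding pgrow_def
proof (intro conjI exI allI)
  fix x :: "nat \<Rightarrow> real" assume "i < d"
  have "\<bar>x i\<bar> \<le> 1 + \<bar>x i\<bar>" by simp
  also have "\<dots> \<le> (\<Prod>i<d. 1 + \<bar>x i\<bar>)"
    using prod_mono2[of "{..<d}" "{i}" "\<lambda>i. 1 + \<bar>x i\<bar>"] \<open>i < d\<close> by simp
  finally show "\<bar>x i\<bar> \<le> 1 * (\<Prod>i<d. 1 + \<bar>x i\<bar>) ^ 1" by simp
qed auto

lemma pgrow_mult:
  assumes "pgrow d p" "pgrow d q"
  shows "pgrow d (\<lambda>x. p x * q x)"
proof -
  from assms obtain K n K' n' where K: "\<And>x. \<bar>p x\<bar> \<le> K * (\<Prod>i<d. 1 + \<bar>x i\<bar>) ^ n"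
    "\<And>x. \<bar>q x\<bar> \<le> K' * (\<Prod>i<d. 1 + \<bar>x i\<bar>) ^ n'"
    unfolding pgrow_def by blast
  have "\<bar>p x * q x\<bar> \<le> (K * K') * (\<Prod>i<d. 1 + \<bar>x i\<bar>) ^ (n + n')" for x
  proof -
    have "0 \<le> K * (\<Prod>i<d. 1 + \<bar>x i\<bar>) ^ n" using K(1)[of x] by linarith
    hence "\<bar>p x\<bar> * \<bar>q x\<bar> \<le> (K * (\<Prod>i<d. 1 + \<bar>x i\<bar>) ^ n) * (K' * (\<Prod>i<d. 1 + \<bar>x i\<bar>) ^ n')"
      using K by (intro mult_mono) auto
    thus ?thesis by (simp add: abs_mult power_add mult_ac)
  qed
  thus ?thesis using assms unfolding pgrow_def by (auto intro!: borel_measurable_times)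
qed

lemma pgrow_add:
  assumes "pgrow d p" "pgrow d q"
  shows "pgrow d (\<lambda>x. p x + q x)"
proof -
  from assms obtain K n K' n' where K: "\<And>x. \<bar>p x\<bar> \<le> K * (\<Prod>i<d. 1 + \<bar>x i\<bar>) ^ n"
    "\<And>x. \<bar>q x\<bar> \<le> K' * (\<Prod>i<d. 1 + \<bar>x i\<bar>) ^ n'"
    unfolding pgrow_def by blast
  have "\<bar>p x + q x\<bar> \<le> (\<bar>K\<bar> + \<bar>K'\<bar>) * (\<Prod>i<d. 1 + \<bar>x i\<bar>) ^ (n + n')" for x
  proof -
    let ?P = "\<Prod>i<d. 1 + \<bar>x i\<bar>"
    have "?P ^ n \<le> ?P ^ (n + n')" "?P ^ n' \<le> ?P ^ (n + n')"
      using prod_abs_ge_1[of x d] by (auto intro: power_increasing)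
    hence "\<bar>K\<bar> * ?P ^ n \<le> \<bar>K\<bar> * ?P ^ (n + n')" "\<bar>K'\<bar> * ?P ^ n' \<le> \<bar>K'\<bar> * ?P ^ (n + n')"
      by (auto intro: mult_left_mono)
    moreover have "K * ?P ^ n \<le> \<bar>K\<bar> * ?P ^ n" "K' * ?P ^ n' \<le> \<bar>K'\<bar> * ?P ^ n'"
      using prod_abs_ge_1[of x d] by (intro mult_right_mono; simp)+
    ultimately show ?thesis using K(1)[of x] K(2)[of x] unfolding distrib_right by linarith
  qed
  thus ?thesis using assms unfolding pgrow_def by (auto intro!: borel_measurable_add)
qed

lemma pgrow_diff: "pgrow d p \<Longrightarrow> pgrow d q \<Longrightarrow> pgrow d (\<lambda>x. p x - q x)"
  using pgrow_add[of d p "\<lambda>x. (- 1) * q x"] pgrow_mult[OF pgrow_const[of d "- 1"]] by simp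

lemma pgrow_sum: "(\<And>a. a \<in> A \<Longrightarrow> pgrow d (p a)) \<Longrightarrow> pgrow d (\<lambda>x. \<Sum>a\<in>A. p a x)"
  by (induction A rule: infinite_finite_induct) (auto intro: pgrow_const pgrow_add)

lemma pgrow_herm: "set is \<subseteq> {..<d} \<Longrightarrow> pgrow d (\<lambda>x. herm d B (yv d \<mu> S x) is)"
proof (induction "length is" arbitrary: "is" rule: less_induct)
  case less
  show ?case
  proof (cases "is")
    case (Cons i r)
    hence "i < d" and r: "set r \<subseteq> {..<d}" using less.prems by auto
    thus ?thesis unfolding Cons herm.simps(2) yv_def mv_def using Cons set_remove1_le[OF r]
      by (intro pgrow_diff pgrow_mult pgrow_sum pgrow_const pgrow_coord less.hyps[unfolded yv_def mv_def])
        (auto simp: length_remove1)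
  qed (simp add: pgrow_const)
qed

lemma hg_bound1:
  assumes p: "pdm d \<beta> S" and "is": "set is \<subseteq> {..<d}"
  shows "\<exists>K\<ge>0. \<forall>x. \<bar>hg d \<mu> S is x\<bar> \<le> K * Gw d (length is) (1 / (4 * \<beta>)) x"
proof -
  have "0 < \<beta>" using p by (simp add: pdm_def)
  moreover have "\<forall>i<d. \<bar>\<mu> i\<bar> \<le> (\<Sum>i<d. \<bar>\<mu> i\<bar>)" by (auto intro!: member_le_sum)
  moreover have "0 \<le> (\<Sum>i<d. \<bar>\<mu> i\<bar>)" by (intro sum_nonneg) auto
  ultimately show ?thesis
    using hg_bound[of \<beta> "\<Sum>i<d. \<bar>\<mu> i\<bar>" "mdet d S", OF _ _ mdet_pos[OF p] "is"] p by blast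
qed

lemma pgrow_hg_bound:
  assumes "pgrow d q" "pdm d \<beta> S" "set is \<subseteq> {..<d}"
  shows "\<exists>K N. \<forall>x. \<bar>q x * hg d \<mu> S is x\<bar> \<le> K * Gw d N (1 / (4 * \<beta>)) x"
proof -
  from assms(1) obtain K n where K: "\<And>x. \<bar>q x\<bar> \<le> K * (\<Prod>i<d. 1 + \<bar>x i\<bar>) ^ n"
    unfolding pgrow_def by blast
  from hg_bound1[OF assms(2,3)] obtain K' where K': "0 \<le> K'" "\<And>x. \<bar>hg d \<mu> S is x\<bar> \<le> K' * Gw d (length is) (1 / (4 * \<beta>)) x"
    by blast
  have "\<bar>q x * hg d \<mu> S is x\<bar> \<le> (K * K') * Gw d (n + length is) (1 / (4 * \<beta>)) x" for x
  proof -
    have "0 \<le> K * (\<Prod>i<d. 1 + \<bar>x i\<bar>) ^ n" using K[of x] by linarith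
    hence "\<bar>q x\<bar> * \<bar>hg d \<mu> S is x\<bar> \<le> (K * (\<Prod>i<d. 1 + \<bar>x i\<bar>) ^ n) * (K' * Gw d (length is) (1 / (4 * \<beta>)) x)"
      using K K' by (intro mult_mono) auto
    thus ?thesis unfolding Gw_mult[symmetric] abs_mult by (simp add: mult_ac)
  qed
  thus ?thesis by blast
qed

lemma integrable_pgrow_hg:
  assumes "pgrow d q" "pdm d \<beta> S" "set is \<subseteq> {..<d}"
  shows "integrable (lebd d) (\<lambda>x. q x * hg d \<mu> S is x)"
proof -
  from pgrow_hg_bound[OF assms] obtain K N where "\<And>x. \<bar>q x * hg d \<mu> S is x\<bar> \<le> K * Gw d N (1 / (4 * \<beta>)) x" by blast
  thus ?thesis
    using assms by (intro integrable_Gw_bound[of _ d K N "1 / (4 * \<beta>)"] borel_measurable_times hg_measurable_lebd)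
      (auto simp: pgrow_def pdm_def)
qed

lemma integrable_hg: "pdm d \<beta> S \<Longrightarrow> set is \<subseteq> {..<d} \<Longrightarrow> integrable (lebd d) (\<lambda>x. hg d \<mu> S is x)"
  using integrable_pgrow_hg[OF pgrow_const[of d 1]] by simp

text \<open>No sign appears, because prefixing i stands for -\<partial>_i.\<close>

lemma hg_integral_by_parts:
  assumes p: "pdm d \<beta> S" and i: "i < d" and "is": "set is \<subseteq> {..<d}"
    and q: "pgrow d q" and q': "pgrow d q'"
    and d: "\<And>x t. ((\<lambda>t. q (x(i := t))) has_real_derivative q' (x(i := t))) (at t)"
    and c: "\<And>x t. isCont (\<lambda>t. q' (x(i := t))) t"
  shows "(\<integral>x. q x * hg d \<mu> S (i # is) x \<partial>lebd d) = (\<integral>x. q' x * hg d \<mu> S is x \<partial>lebd d)"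
proof -
  have "is'": "set (i # is) \<subseteq> {..<d}" using i "is" by auto
  note dh = hg_derivative[OF p "is" i] and dh' = hg_derivative[OF p is' i]
  define f' where "f' x = q' x * hg d \<mu> S is x - q x * hg d \<mu> S (i # is) x" for x
  from pgrow_hg_bound[OF q p "is"] obtain K N where b: "\<And>x. \<bar>q x * hg d \<mu> S is x\<bar> \<le> K * Gw d N (1 / (4 * \<beta>)) x" by blast
  have "pgrow d (\<lambda>x. q' x * herm d (minv d S) (yv d \<mu> S x) is - q x * herm d (minv d S) (yv d \<mu> S x) (i # is))"
    using "is" is' by (intro pgrow_diff pgrow_mult q q' pgrow_herm)
  from pgrow_hg_bound[OF this p, of "[]" \<mu>] obtain K' N' where b': "\<And>x. \<bar>f' x\<bar> \<le> K' * Gw d N' (1 / (4 * \<beta>)) x"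
    by (auto simp: f'_def hg_def left_diff_distrib mult.assoc)
  have "(\<integral>x. f' x \<partial>lebd d) = 0"
  proof (rule lebd_integral_derivative_zero[OF i _ _ _ _ b b'])
    show "0 < 1 / (4 * \<beta>)" using p by (simp add: pdm_def)
    show "((\<lambda>t. q (x(i := t)) * hg d \<mu> S is (x(i := t))) has_real_derivative f' (x(i := t))) (at t)" for x t
      using DERIV_mult[OF d[of x t] dh[where x = x and ?t0.0 = t]] by (simp add: f'_def algebra_simps)
    show "isCont (\<lambda>t. f' (x(i := t))) t" for x t
      unfolding f'_def by (intro continuous_diff continuous_mult c DERIV_isCont[OF d] DERIV_isCont[OF dh] DERIV_isCont[OF dh'])
    show "f' \<in> borel_measurable (lebd d)"
      unfolding f'_def using q q' "is" is' by (intro borel_measurable_diff borel_measurable_times hg_measurable_lebd) (auto simp: pgrow_def)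
  qed
  thus ?thesis
    unfolding f'_def using integrable_pgrow_hg[OF q p is'] integrable_pgrow_hg[OF q' p "is"]
    by (simp add: Bochner_Integration.integral_diff)
qed

lemma integral_hg_Cons:
  assumes "pdm d \<beta> S" "i < d" "set is \<subseteq> {..<d}"
  shows "(\<integral>x. hg d \<mu> S (i # is) x \<partial>lebd d) = 0"
  using hg_integral_by_parts[OF assms pgrow_const[of d 1] pgrow_const[of d 0]] by simp

subsection \<open>Paths of Gaussians\<close>

text \<open>The parameter enters squared here and linearly in the mean, since X -> s X scales
  quadratic forms by s^2 and linear ones by s.\<close>

definition pS :: "(nat \<Rightarrow> nat \<Rightarrow> real) \<Rightarrow> (nat \<Rightarrow> nat \<Rightarrow> real) \<Rightarrow> real \<Rightarrow> nat \<Rightarrow> nat \<Rightarrow> real" where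
  "pS S0 S1 s i l = S0 i l + s\<^sup>2 * (S1 i l - S0 i l)"

definition pm :: "(nat \<Rightarrow> real) \<Rightarrow> (nat \<Rightarrow> real) \<Rightarrow> real \<Rightarrow> nat \<Rightarrow> real" where
  "pm m0 m1 s i = m0 i + s * (m1 i - m0 i)"

lemma pS_pm_ends: "pS S0 S1 0 = S0" "pS S0 S1 1 = S1" "pm m0 m1 0 = m0" "pm m0 m1 1 = m1"
  by (auto simp: pS_def pm_def fun_eq_iff)

lemma pdm_pS:
  assumes "pdm d \<beta> S0" "pdm d \<beta> S1" "s \<in> {0..1}"
  shows "pdm d \<beta> (pS S0 S1 s)"
  unfolding pS_def[abs_def] using assms(3) by (intro pdm_combine assms) (auto simp: power_le_one)

lemma pS_derivative: "((\<lambda>s. pS S0 S1 s i l) has_real_derivative 2 * s0 * (S1 i l - S0 i l)) (at s0 within A)"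
  unfolding pS_def by (auto intro!: derivative_eq_intros)

lemma pm_derivative: "((\<lambda>s. pm m0 m1 s i) has_real_derivative (m1 i - m0 i)) (at s0 within A)"
  unfolding pm_def by (auto intro!: derivative_eq_intros)

lemma hg_pS_derivative:
  assumes p: "pdm d \<beta> S0" "pdm d \<beta> S1" and s0: "s0 \<in> {0..1}" and "is": "set is \<subseteq> {..<d}"
  shows "((\<lambda>s. hg d (pm m0 m1 s) (pS S0 S1 s) is x) has_real_derivative
     (\<Sum>a<d. (m1 a - m0 a) * hg d (pm m0 m1 s0) (pS S0 S1 s0) (a # is) x) +
     s0 * (\<Sum>a<d. \<Sum>b<d. (S1 a b - S0 a b) * hg d (pm m0 m1 s0) (pS S0 S1 s0) (a # b # is) x)) (at s0 within {0..1})"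
proof -
  have "((\<lambda>s. hg d (pm m0 m1 s) (pS S0 S1 s) is x) has_real_derivative
     (\<Sum>a<d. (m1 a - m0 a) * hg d (pm m0 m1 s0) (pS S0 S1 s0) (a # is) x) +
     1 / 2 * (\<Sum>a<d. \<Sum>b<d. (2 * s0 * (S1 a b - S0 a b)) * hg d (pm m0 m1 s0) (pS S0 S1 s0) (a # b # is) x)) (at s0 within {0..1})"
    by (rule hg_path_derivative[OF pS_derivative pm_derivative _ pdm_pS[OF p] s0 "is"])
      (use p in \<open>auto simp: pdm_def\<close>)
  thus ?thesis by (simp add: sum_distrib_left mult.assoc)
qed

lemma pS_continuous:
  assumes p: "pdm d \<beta> S0" "pdm d \<beta> S1"
  shows "continuous_on {0..1} (\<lambda>s. minv d (pS S0 S1 s) i l)" "continuous_on {0..1} (\<lambda>s. mdet d (pS S0 S1 s))"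
proof -
  show "continuous_on {0..1} (\<lambda>s. minv d (pS S0 S1 s) i l)"
    by (rule DERIV_continuous_on, rule minv_derivative[where S = "pS S0 S1", OF pS_derivative pdm_pS[OF p]])
  show "continuous_on {0..1} (\<lambda>s. mdet d (pS S0 S1 s))"
    unfolding mdet_def pS_def by (intro continuous_intros)
qed

lemma hg_pS_bound:
  assumes p: "pdm d \<beta> S0" "pdm d \<beta> S1" and "is": "set is \<subseteq> {..<d}"
  shows "\<exists>K\<ge>0. \<forall>s\<in>{0..1}. \<forall>x. \<bar>hg d (pm m0 m1 s) (pS S0 S1 s) is x\<bar> \<le> K * Gw d (length is) (1 / (4 * \<beta>)) x"
proof -
  have b: "0 < \<beta>" using p by (simp add: pdm_def)
  \<comment> \<open>By compactness the determinant has a least value on the path; it is positive and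
    serves as \<open>D0\<close>.\<close>
  obtain s0 where s0: "s0 \<in> {0..1}" "\<And>s. s \<in> {0..1} \<Longrightarrow> mdet d (pS S0 S1 s0) \<le> mdet d (pS S0 S1 s)"
    using continuous_attains_inf[OF _ _ pS_continuous(2)[OF p]] by auto
  define M0 where "M0 = (\<Sum>i<d. \<bar>m0 i\<bar> + \<bar>m1 i\<bar>)"
  have M: "\<bar>pm m0 m1 s i\<bar> \<le> M0" if "s \<in> {0..1}" "i < d" for s i
  proof -
    have "pm m0 m1 s i = (1 - s) * m0 i + s * m1 i" by (simp add: pm_def algebra_simps)
    also have "\<bar>\<dots>\<bar> \<le> (1 - s) * \<bar>m0 i\<bar> + s * \<bar>m1 i\<bar>"
      using that abs_triangle_ineq[of "(1 - s) * m0 i" "s * m1 i"] by (simp add: abs_mult)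
    also have "\<dots> \<le> 1 * \<bar>m0 i\<bar> + 1 * \<bar>m1 i\<bar>"
      using that by (intro add_mono mult_right_mono) auto
    also have "\<dots> \<le> M0" unfolding M0_def
      using that member_le_sum[of i "{..<d}" "\<lambda>i. \<bar>m0 i\<bar> + \<bar>m1 i\<bar>"] by simp
    finally show ?thesis .
  qed
  have "0 \<le> M0" unfolding M0_def by (intro sum_nonneg) auto
  from hg_bound[OF b this mdet_pos[OF pdm_pS[OF p s0(1)]] "is"] show ?thesis
    using pdm_pS[OF p] s0(2) M by meson
qed

text \<open>Inverse and determinant are known to be continuous in s on [0,1] only. Clamping extends
  the integrand to a measurable function on the whole line.\<close>

definition clamp01 :: "real \<Rightarrow> real" where "clamp01 s = max 0 (min 1 s)"

lemma clamp01: "clamp01 s \<in> {0..1}" "s \<in> {0..1} \<Longrightarrow> clamp01 s = s" "continuous_on UNIV clamp01"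
  by (auto simp: clamp01_def[abs_def] intro!: continuous_intros)

lemma hg_pS_measurable [measurable]:
  assumes p: "pdm d \<beta> S0" "pdm d \<beta> S1" and "is": "set is \<subseteq> {..<d}"
  shows "(\<lambda>\<omega>. hg d (pm m0 m1 (clamp01 (fst \<omega>))) (pS S0 S1 (clamp01 (fst \<omega>))) is (snd \<omega>))
    \<in> borel_measurable (lborel \<Otimes>\<^sub>M lebd d)"
proof (rule hg_measurable[OF _ _ _ _ "is"])
  have c: "(\<lambda>\<omega>. f (clamp01 (fst \<omega>))) \<in> borel_measurable (lborel \<Otimes>\<^sub>M lebd d)"
    if "continuous_on {0..1} f" for f :: "real \<Rightarrow> real"
  proof -
    have "continuous_on UNIV (\<lambda>s. f (clamp01 s))"
      by (rule continuous_on_compose2[OF that clamp01(3)]) (use clamp01(1) in auto)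
    hence "(\<lambda>s. f (clamp01 s)) \<in> borel_measurable lborel"
      by (simp add: borel_measurable_continuous_onI)
    thus ?thesis by measurable
  qed
  show "(\<lambda>\<omega>. snd \<omega> i) \<in> borel_measurable (lborel \<Otimes>\<^sub>M lebd d)" if "i < d" for i
  proof -
    have [measurable]: "(\<lambda>x. x i) \<in> borel_measurable (lebd d)"
      using measurable_component_singleton[of i "{..<d}" "\<lambda>_. lborel"] that by simp
    show ?thesis by measurable
  qed
  show "(\<lambda>\<omega>. pm m0 m1 (clamp01 (fst \<omega>)) i) \<in> borel_measurable (lborel \<Otimes>\<^sub>M lebd d)" for i
    by (rule c) (auto simp: pm_def intro!: continuous_intros)
  show "(\<lambda>\<omega>. minv d (pS S0 S1 (clamp01 (fst \<omega>))) i l) \<in> borel_measurable (lborel \<Otimes>\<^sub>M lebd d)" for i l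
    by (rule c[OF pS_continuous(1)[OF p]])
  show "(\<lambda>\<omega>. mdet d (pS S0 S1 (clamp01 (fst \<omega>)))) \<in> borel_measurable (lborel \<Otimes>\<^sub>M lebd d)"
    by (rule c[OF pS_continuous(2)[OF p]])
qed

lemma pair_sigma_finite_lebd: "pair_sigma_finite lborel (lebd d)"
  by (intro pair_sigma_finite.intro lborel.sigma_finite_measure_axioms sigma_finite_lebd)

lemma integral_sum2:
  fixes f :: "'a \<Rightarrow> 'b \<Rightarrow> 'c \<Rightarrow> real"
  assumes "\<And>a b. a \<in> A \<Longrightarrow> b \<in> B \<Longrightarrow> integrable M (f a b)"
  shows "(\<integral>x. (\<Sum>a\<in>A. \<Sum>b\<in>B. f a b x) \<partial>M) = (\<Sum>a\<in>A. \<Sum>b\<in>B. \<integral>x. f a b x \<partial>M)"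
    and "integrable M (\<lambda>x. \<Sum>a\<in>A. \<Sum>b\<in>B. f a b x)"
proof -
  have i: "integrable M (\<lambda>x. \<Sum>b\<in>B. f a b x)" if "a \<in> A" for a
    using assms[OF that] by (rule Bochner_Integration.integrable_sum)
  show "integrable M (\<lambda>x. \<Sum>a\<in>A. \<Sum>b\<in>B. f a b x)"
    using i by (rule Bochner_Integration.integrable_sum)
  have "(\<integral>x. (\<Sum>a\<in>A. \<Sum>b\<in>B. f a b x) \<partial>M) = (\<Sum>a\<in>A. \<integral>x. (\<Sum>b\<in>B. f a b x) \<partial>M)"
    using i by (rule Bochner_Integration.integral_sum)
  also have "\<dots> = (\<Sum>a\<in>A. \<Sum>b\<in>B. \<integral>x. f a b x \<partial>M)"
    by (rule sum.cong[OF refl], rule Bochner_Integration.integral_sum, rule assms)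
  finally show "(\<integral>x. (\<Sum>a\<in>A. \<Sum>b\<in>B. f a b x) \<partial>M) = \<dots>" .
qed

text \<open>Along the path from the identity, \<open>gd\<close> moves by second derivatives, which integrate to zero.\<close>

lemma integral_gd:
  assumes p: "pdm d \<beta> S"
  shows "(\<integral>x. gd d \<mu> S x \<partial>lebd d) = 1"
proof -
  interpret P: pair_sigma_finite lborel "lebd d" by (rule pair_sigma_finite_lebd)
  define \<gamma> where "\<gamma> = max \<beta> (1 / \<beta>)"
  have b: "0 < \<beta>" using p by (simp add: pdm_def)
  have p0: "pdm d \<gamma> idm" unfolding \<gamma>_def by (rule pdm_idm[OF b])
  have p1: "pdm d \<gamma> S" by (rule pdm_mono[OF p]) (simp add: \<gamma>_def)
  have g: "0 < \<gamma>" using p0 by (simp add: pdm_def)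
  have hg0: "hg d \<mu> S [] = gd d \<mu> S" for S by (rule ext) (simp add: hg_def)
  have pmm: "pm \<mu> \<mu> s = \<mu>" for s by (rule ext) (simp add: pm_def)
  let ?h = "\<lambda>s. hg d \<mu> (pS idm S s)"
  define V where "V a b = S a b - idm a b" for a b
  define f where "f s x = s * (\<Sum>a<d. \<Sum>b<d. V a b * ?h s [a,b] x)" for s x
  have ab: "set [a,b] \<subseteq> {..<d}" if "a < d" "b < d" for a b using that by simp
  have D: "((\<lambda>s. ?h s [] x) has_real_derivative f s x) (at s within {0..1})" if "s \<in> {0..1}" for s x
    using hg_pS_derivative[OF p0 p1 that, of "[]" \<mu> \<mu> x] by (simp add: pmm f_def V_def)
  have F: "(\<integral>s. indicator {0..1} s * f s x \<partial>lborel) = gd d \<mu> S x - gd d \<mu> idm x" for x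
  proof -
    have "(\<integral>s. indicator {0..1} s *\<^sub>R f s x \<partial>lborel) = ?h 1 [] x - ?h 0 [] x"
    proof (rule integral_FTC_Icc)
      show "continuous_on {0..1} (\<lambda>s. f s x)"
      proof -
        have "continuous_on {0..1} (\<lambda>s. ?h s [a,b] x)" if "a < d" "b < d" for a b
          using hg_pS_derivative[OF p0 p1 _ ab[OF that], of _ \<mu> \<mu> x] unfolding pmm
          by (rule DERIV_continuous_on)
        thus ?thesis unfolding f_def by (intro continuous_intros) auto
      qed
    qed (use D in \<open>auto simp: has_real_derivative_iff_has_vector_derivative\<close>)
    thus ?thesis by (simp add: hg0 pS_pm_ends)
  qed
  have ind: "(\<lambda>\<omega>. indicator {0..1::real} (fst \<omega>) :: real) \<in> borel_measurable (lborel \<Otimes>\<^sub>M lebd d)"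
  proof -
    have "(indicator {0..1} :: real \<Rightarrow> real) \<in> borel_measurable lborel" by simp
    thus ?thesis by (rule measurable_compose[OF measurable_fst])
  qed
  have m: "(\<lambda>\<omega>. indicator {0..1::real} (fst \<omega>) * f (clamp01 (fst \<omega>)) (snd \<omega>)) \<in> borel_measurable (lborel \<Otimes>\<^sub>M lebd d)"
  proof -
    have "(\<lambda>\<omega>. clamp01 (fst \<omega>)) \<in> borel_measurable (lborel \<Otimes>\<^sub>M lebd d)"
      unfolding clamp01_def by measurable
    moreover note ind
    ultimately show ?thesis unfolding f_def
      using hg_pS_measurable[OF p0 p1 ab, of _ _ \<mu> \<mu>] unfolding pmm
      by (intro borel_measurable_times borel_measurable_sum borel_measurable_const) auto
  qed
  have "\<exists>K\<ge>0. \<forall>s\<in>{0..1}. \<forall>x. \<bar>?h s [a,b] x\<bar> \<le> K * Gw d 2 (1 / (4 * \<gamma>)) x" if "a < d" "b < d" for a b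
    using hg_pS_bound[OF p0 p1 ab[OF that], of \<mu> \<mu>] by (simp add: pmm numeral_2_eq_2)
  then obtain K where K: "\<And>a b s x. a < d \<Longrightarrow> b < d \<Longrightarrow> s \<in> {0..1} \<Longrightarrow> \<bar>?h s [a,b] x\<bar> \<le> K a b * Gw d 2 (1 / (4 * \<gamma>)) x"
    by metis
  define C where "C = (\<Sum>a<d. \<Sum>b<d. \<bar>V a b\<bar> * K a b)"
  have fb: "\<bar>f s x\<bar> \<le> C * Gw d 2 (1 / (4 * \<gamma>)) x" if s: "s \<in> {0..1}" for s x
  proof -
    have "\<bar>f s x\<bar> \<le> 1 * \<bar>\<Sum>a<d. \<Sum>b<d. V a b * ?h s [a,b] x\<bar>"
      unfolding f_def abs_mult using s by (intro mult_right_mono) auto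
    also have "\<dots> \<le> (\<Sum>a<d. \<Sum>b<d. \<bar>V a b * ?h s [a,b] x\<bar>)"
      by (simp, rule order_trans[OF sum_abs sum_mono], rule sum_abs)
    also have "\<dots> \<le> C * Gw d 2 (1 / (4 * \<gamma>)) x"
      unfolding C_def sum_distrib_right abs_mult mult.assoc
      using K s by (intro sum_mono mult_left_mono) auto
    finally show ?thesis .
  qed
  have kap: "0 < 1 / (4 * \<gamma>)" using g by simp
  let ?g = "\<lambda>\<omega>. indicator {0..1::real} (fst \<omega>) * (C * Gw d 2 (1 / (4 * \<gamma>)) (snd \<omega>))"
  have Gi: "integrable (lebd d) (Gw d 2 (1 / (4 * \<gamma>)))" by (rule integrable_Gw[OF kap])
  have gi: "integrable (lborel \<Otimes>\<^sub>M lebd d) ?g"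
  proof (rule P.Fubini_integrable)
    show "?g \<in> borel_measurable (lborel \<Otimes>\<^sub>M lebd d)"
      by (intro borel_measurable_times ind borel_measurable_const
          measurable_compose[OF measurable_snd borel_measurable_integrable[OF Gi]])
    show "integrable lborel (\<lambda>s. \<integral>x. norm (?g (s, x)) \<partial>lebd d)"
      using integrable_real_indicator[of "{0..1::real}" lborel] by (simp add: abs_mult)
    show "AE s in lborel. integrable (lebd d) (\<lambda>x. ?g (s, x))" using Gi by simp
  qed
  have hi: "integrable (lborel \<Otimes>\<^sub>M lebd d) (\<lambda>(s, x). indicator {0..1} s * f s x)"
  proof -
    have eq: "(\<lambda>(s, x). indicator {0..1} s * f s x) = (\<lambda>\<omega>. indicator {0..1::real} (fst \<omega>) * f (clamp01 (fst \<omega>)) (snd \<omega>))"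
      by (auto simp: indicator_def clamp01(2))
    show ?thesis unfolding eq
    proof (rule Bochner_Integration.integrable_bound[OF gi m], intro AE_I2)
      fix \<omega> :: "real \<times> (nat \<Rightarrow> real)"
      show "norm (indicator {0..1::real} (fst \<omega>) * f (clamp01 (fst \<omega>)) (snd \<omega>)) \<le> norm (?g \<omega>)"
        using fb[of "fst \<omega>" "snd \<omega>"] by (cases "fst \<omega> \<in> {0..1}") (auto simp: clamp01(2))
    qed
  qed
  have "(\<integral>x. (\<integral>s. indicator {0..1} s * f s x \<partial>lborel) \<partial>lebd d) = (\<integral>s. (\<integral>x. indicator {0..1} s * f s x \<partial>lebd d) \<partial>lborel)"
    by (rule P.Fubini_integral) (use hi in simp)
  also have "\<dots> = 0"
  proof -
    have "(\<integral>x. f s x \<partial>lebd d) = 0" if s: "s \<in> {0..1}" for s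
    proof -
      note ps = pdm_pS[OF p0 p1 s]
      have "(\<integral>x. (\<Sum>a<d. \<Sum>b<d. V a b * ?h s [a,b] x) \<partial>lebd d) = (\<Sum>a<d. \<Sum>b<d. \<integral>x. V a b * ?h s [a,b] x \<partial>lebd d)"
        by (rule integral_sum2) (use integrable_hg[OF ps ab] in auto)
      hence "(\<integral>x. f s x \<partial>lebd d) = s * (\<Sum>a<d. \<Sum>b<d. V a b * (\<integral>x. ?h s [a,b] x \<partial>lebd d))"
        unfolding f_def by simp
      also have "\<dots> = 0" using integral_hg_Cons[OF ps] by simp
      finally show ?thesis .
    qed
    hence "(\<integral>x. indicator {0..1} s * f s x \<partial>lebd d) = 0" for s
      by (cases "s \<in> {0..1}") auto
    thus ?thesis by (simp only: Bochner_Integration.integral_zero)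
  qed
  finally have "(\<integral>x. gd d \<mu> S x - gd d \<mu> idm x \<partial>lebd d) = 0" unfolding F .
  moreover have "integrable (lebd d) (gd d \<mu> S)" "integrable (lebd d) (gd d \<mu> idm)"
    using integrable_hg[OF p1, of "[]" \<mu>] integrable_hg[OF p0, of "[]" \<mu>] by (simp_all add: hg0)
  ultimately have "(\<integral>x. gd d \<mu> S x \<partial>lebd d) = (\<integral>x. gd d \<mu> idm x \<partial>lebd d)"
    by (simp add: Bochner_Integration.integral_diff)
  also have "\<dots> = (\<integral>x. (\<Prod>i<d. normal_density (\<mu> i) 1 (x i)) \<partial>lebd d)"
  proof (rule Bochner_Integration.integral_cong[OF refl])
    fix x
    have "quadform d (minv d idm) (\<lambda>i. x i - \<mu> i) = (\<Sum>i<d. (x i - \<mu> i)\<^sup>2)"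
    proof -
      have "mv d (minv d idm) u i = u i" if "i < d" for u i
      proof -
        have "mv d (minv d idm) u i = (\<Sum>l<d. idm i l * u l)"
          unfolding mv_def using that by (intro sum.cong) (auto simp: minv_idm)
        thus ?thesis using that by simp
      qed
      thus ?thesis by (simp add: quadform_mv power2_eq_square)
    qed
    moreover have "sqrt ((2 * pi) ^ d * 1) = sqrt (2 * pi) ^ d" by (simp only: real_sqrt_power mult_1_right)
    ultimately show "gd d \<mu> idm x = (\<Prod>i<d. normal_density (\<mu> i) 1 (x i))"
      unfolding gd_def mdet_idm
      by (simp add: normal_density_def prod_dividef prod.distrib exp_sum[symmetric] sum_negf sum_divide_distrib power_one_over)
  qed
  also have "\<dots> = (\<Prod>i<d. \<integral>t. normal_density (\<mu> i) 1 t \<partial>lborel)"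
    by (rule lebd.product_integral_prod) auto
  also have "\<dots> = 1" by simp
  finally show ?thesis .
qed

subsection \<open>Hermite moments\<close>

text \<open>\<open>en n a b\<close> is the coefficient of \<open>t\<^sup>n\<close> in \<open>exp (a t + b t\<^sup>2 / 2)\<close>.\<close>

fun en :: "nat \<Rightarrow> real \<Rightarrow> real \<Rightarrow> real" where
  "en 0 a b = 1"
| "en (Suc 0) a b = a"
| "en (Suc (Suc n)) a b = (a * en (Suc n) a b + b * en n a b) / real (Suc (Suc n))"

lemma hh_derivative: "((\<lambda>x. hh n x s) has_real_derivative real n * hh (n - 1) x s) (at x)"
proof (induction n rule: less_induct)
  case (less n)
  consider "n = 0" | "n = 1" | k where "n = Suc (Suc k)" by (metis One_nat_def not0_implies_Suc)
  thus ?case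
  proof cases
    case 3
    have "((\<lambda>x. x * hh (Suc k) x s - real (Suc k) * s * hh k x s) has_real_derivative
      1 * hh (Suc k) x s + real (Suc k) * hh k x s * x - real (Suc k) * s * (real k * hh (k - 1) x s)) (at x)"
      using less[of "Suc k"] less[of k] 3
      by (intro DERIV_diff DERIV_mult DERIV_ident DERIV_cmult) auto
    moreover have "real (Suc k) * hh k x s * x - real (Suc k) * s * (real k * hh (k - 1) x s) = real (Suc k) * hh (Suc k) x s"
      by (cases k) (simp_all add: algebra_simps)
    ultimately show ?thesis using 3 by (simp add: algebra_simps)
  qed (auto intro!: derivative_eq_intros)
qed

lemma hermite_multi_derivative:
  assumes "i < d"
  shows "((\<lambda>t. hermite_multi d n X (z(i := t))) has_real_derivative
    real n * X i * hermite_multi d (n - 1) X (z(i := t))) (at t)"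
proof -
  have "((\<lambda>t. (z(i := t)) l * X l) has_real_derivative (if l = i then X i else 0)) (at t)" for l
    by (cases "l = i") (auto intro!: derivative_eq_intros)
  hence "((\<lambda>t. \<Sum>l<d. (z(i := t)) l * X l) has_real_derivative (\<Sum>l<d. if l = i then X i else 0)) (at t)"
    by (rule DERIV_sum)
  hence "((\<lambda>t. \<Sum>l<d. (z(i := t)) l * X l) has_real_derivative X i) (at t)"
    using assms by simp
  from DERIV_chain2[OF hh_derivative this] show ?thesis
    unfolding hermite_multi_def by (simp add: mult_ac)
qed

lemma pgrow_hermite_multi: "pgrow d (\<lambda>z. hermite_multi d n X z)"
proof (induction n rule: less_induct)
  case (less n)
  have l: "pgrow d (\<lambda>z. \<Sum>i<d. z i * X i)"
    by (intro pgrow_sum pgrow_mult pgrow_coord pgrow_const) auto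
  consider "n = 0" | "n = 1" | k where "n = Suc (Suc k)" by (metis One_nat_def not0_implies_Suc)
  thus ?case
  proof cases
    case 3
    show ?thesis using less[of "Suc k"] less[of k] 3 unfolding hermite_multi_def
      by (auto intro!: pgrow_diff pgrow_mult pgrow_const l)
  qed (auto simp: hermite_multi_def pgrow_const l)
qed

text \<open>Both sides obey the same three-term recursion. Multiplication by z . X becomes
  multiplication by a plus a first derivative contracted with S X, and integration by parts turns
  the latter into the quadratic form of S; the |X|^2 in the recursion of \<open>hh\<close> lowers S
  to S - I, whence b.\<close>

lemma hermite_moment_hg_Nil:
  fixes \<mu> X :: "nat \<Rightarrow> real"
  assumes p: "pdm d \<beta> S"
  defines "a \<equiv> \<Sum>i<d. \<mu> i * X i" and "b \<equiv> quadform d S X - (\<Sum>i<d. (X i)\<^sup>2)"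
  shows "(\<integral>z. hermite_multi d n X z * hg d \<mu> S [] z \<partial>lebd d) = fact n * en n a b"
proof -
  let ?q = "\<lambda>n z. hermite_multi d n X z" and ?G = "hg d \<mu> S []"
  define I where "I n = (\<integral>z. ?q n z * ?G z \<partial>lebd d)" for n
  have "set [] \<subseteq> {..<d}" by simp
  note int = integrable_pgrow_hg[OF pgrow_hermite_multi p this, of _ X \<mu>]
  have inta: "integrable (lebd d) (\<lambda>z. ?q n z * hg d \<mu> S [l] z)" if "l < d" for n l
    using integrable_pgrow_hg[OF pgrow_hermite_multi p] that by simp
  have ibp: "(\<integral>z. ?q n z * hg d \<mu> S [l] z \<partial>lebd d) = real n * X l * I (n - 1)" if l: "l < d" for n l
  proof -
    have "(\<integral>z. ?q n z * hg d \<mu> S [l] z \<partial>lebd d) = (\<integral>z. real n * X l * ?q (n - 1) z * hg d \<mu> S [] z \<partial>lebd d)"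
    proof (rule hg_integral_by_parts[OF p l _ pgrow_hermite_multi])
      show "pgrow d (\<lambda>z. real n * X l * ?q (n - 1) z)"
        by (intro pgrow_mult[OF pgrow_const] pgrow_hermite_multi)
      show "isCont (\<lambda>t. real n * X l * ?q (n - 1) (z(l := t))) t" for z t
        by (intro continuous_mult continuous_const DERIV_isCont[OF hermite_multi_derivative[OF l]])
    qed (use hermite_multi_derivative[OF l] in auto)
    thus ?thesis by (simp add: I_def mult.assoc)
  qed
  \<comment> \<open>Stein's identity: z - \<mu> = S y, and y_l times the density is its derivative
    \<open>hg d \<mu> S [l]\<close>.\<close>
  have z: "(\<Sum>i<d. z i * X i) * ?G z = a * ?G z + (\<Sum>i<d. \<Sum>l<d. X i * S i l * hg d \<mu> S [l] z)" for z
  proof -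
    have "z i * ?G z = \<mu> i * ?G z + (\<Sum>l<d. S i l * hg d \<mu> S [l] z)" if "i < d" for i
    proof -
      have "z i - \<mu> i = (\<Sum>l<d. S i l * yv d \<mu> S z l)"
        using mv_minv[OF p that, of "\<lambda>i. z i - \<mu> i"] by (simp add: yv_def mv_def[of d S])
      hence "(z i - \<mu> i) * ?G z = (\<Sum>l<d. S i l * hg d \<mu> S [l] z)"
        by (simp add: hg_def herm.simps(2) sum_distrib_right mult.assoc)
      thus ?thesis by (simp add: algebra_simps)
    qed
    hence "(\<Sum>i<d. z i * X i) * ?G z = (\<Sum>i<d. X i * (\<mu> i * ?G z + (\<Sum>l<d. S i l * hg d \<mu> S [l] z)))"
      unfolding sum_distrib_right by (intro sum.cong refl) (simp add: mult_ac)
    thus ?thesis by (simp add: a_def distrib_left sum.distrib sum_distrib_left sum_distrib_right mult_ac)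
  qed
  have rec: "(\<integral>z. (\<Sum>i<d. z i * X i) * (?q n z * ?G z) \<partial>lebd d) = a * I n + real n * quadform d S X * I (n - 1)" for n
  proof -
    have "(\<lambda>z. (\<Sum>i<d. z i * X i) * (?q n z * ?G z)) = (\<lambda>z. a * (?q n z * ?G z) + (\<Sum>i<d. \<Sum>l<d. X i * S i l * (?q n z * hg d \<mu> S [l] z)))"
    proof
      fix y
      have "(\<Sum>i<d. y i * X i) * (?q n y * ?G y) = ?q n y * ((\<Sum>i<d. y i * X i) * ?G y)" by (simp add: mult_ac)
      also have "\<dots> = a * (?q n y * ?G y) + (\<Sum>i<d. \<Sum>l<d. X i * S i l * (?q n y * hg d \<mu> S [l] y))"
        unfolding z by (simp add: distrib_left sum_distrib_left mult_ac)
      finally show "(\<Sum>i<d. y i * X i) * (?q n y * ?G y) = \<dots>" .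
    qed
    moreover have "integrable (lebd d) (\<lambda>z. X i * S i l * (?q n z * hg d \<mu> S [l] z))" if "i \<in> {..<d}" "l \<in> {..<d}" for i l
      using inta that by simp
    note S2 = integral_sum2[of "{..<d}" "{..<d}" "lebd d" "\<lambda>i l z. X i * S i l * (?q n z * hg d \<mu> S [l] z)", OF this]
    have "(\<integral>z. a * (?q n z * ?G z) + (\<Sum>i<d. \<Sum>l<d. X i * S i l * (?q n z * hg d \<mu> S [l] z)) \<partial>lebd d)
       = a * I n + (\<Sum>i<d. \<Sum>l<d. X i * S i l * (\<integral>z. ?q n z * hg d \<mu> S [l] z \<partial>lebd d))"
      using int S2 by (simp add: I_def)
    ultimately have "(\<integral>z. (\<Sum>i<d. z i * X i) * (?q n z * ?G z) \<partial>lebd d)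
       = a * I n + (\<Sum>i<d. \<Sum>l<d. X i * S i l * (\<integral>z. ?q n z * hg d \<mu> S [l] z \<partial>lebd d))"
      by (simp only:)
    also have "(\<Sum>i<d. \<Sum>l<d. X i * S i l * (\<integral>z. ?q n z * hg d \<mu> S [l] z \<partial>lebd d)) = real n * quadform d S X * I (n - 1)"
      unfolding quadform_def sum_distrib_left sum_distrib_right
      by (intro sum.cong refl) (simp add: ibp mult_ac)
    finally show ?thesis .
  qed
  have "I n = fact n * en n a b"
  proof (induction n rule: less_induct)
    case (less n)
    consider "n = 0" | "n = 1" | k where "n = Suc (Suc k)" by (metis One_nat_def not0_implies_Suc)
    thus ?case
    proof cases
      case 1
      have "I 0 = (\<integral>x. gd d \<mu> S x \<partial>lebd d)" by (simp add: I_def hermite_multi_def hg_def)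
      thus ?thesis using integral_gd[OF p] 1 by simp
    next
      case 2
      have I0: "I 0 = (\<integral>x. gd d \<mu> S x \<partial>lebd d)" by (simp add: I_def hermite_multi_def hg_def)
      have "I 1 = a * I 0" using rec[of 0] by (simp add: I_def hermite_multi_def)
      thus ?thesis using integral_gd[OF p] 2 I0 by simp
    next
      case 3
      have q: "?q n z * ?G z = (\<Sum>i<d. z i * X i) * (?q (Suc k) z * ?G z) - real (Suc k) * (\<Sum>i<d. (X i)\<^sup>2) * (?q k z * ?G z)" for z
        unfolding 3 by (simp add: hermite_multi_def algebra_simps)
      have "integrable (lebd d) (\<lambda>z. (\<Sum>i<d. z i * X i) * (?q (Suc k) z * ?G z))"
      proof -
        have "pgrow d (\<lambda>z. (\<Sum>i<d. z i * X i) * ?q (Suc k) z)"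
          by (intro pgrow_mult pgrow_sum pgrow_coord pgrow_const pgrow_hermite_multi) auto
        from integrable_pgrow_hg[OF this p, of "[]" \<mu>] show ?thesis by (simp add: mult.assoc)
      qed
      hence "I n = a * I (Suc k) + real (Suc k) * quadform d S X * I k - real (Suc k) * (\<Sum>i<d. (X i)\<^sup>2) * I k"
        unfolding I_def[of n] q using int rec[of "Suc k"] by (simp add: I_def)
      also have "\<dots> = a * I (Suc k) + real (Suc k) * b * I k" by (simp add: b_def algebra_simps)
      also have "\<dots> = fact n * en n a b"
        using less[of "Suc k"] less[of k] 3 by (simp add: field_simps)
      finally show ?thesis .
    qed
  qed
  thus ?thesis by (simp add: I_def)
qed

text \<open>Each -\<partial>_i moved onto the Hermite polynomial produces n X_i and lowers n by one.
  So derivatives of the density multiply its generating function by monomials.\<close>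

lemma hermite_moment_hg:
  fixes \<mu> X :: "nat \<Rightarrow> real"
  assumes p: "pdm d \<beta> S"
  defines "a \<equiv> \<Sum>i<d. \<mu> i * X i" and "b \<equiv> quadform d S X - (\<Sum>i<d. (X i)\<^sup>2)"
  shows "set is \<subseteq> {..<d} \<Longrightarrow> (\<integral>z. hermite_multi d n X z * hg d \<mu> S is z \<partial>lebd d) =
    (if length is \<le> n then fact n * (mon X is * en (n - length is) a b) else 0)"
proof (induction "is" arbitrary: n)
  case Nil
  show ?case using hermite_moment_hg_Nil[OF p, of n X \<mu>] by (simp add: a_def b_def)
next
  case (Cons i r)
  hence i: "i < d" and r: "set r \<subseteq> {..<d}" by auto
  have "(\<integral>z. hermite_multi d n X z * hg d \<mu> S (i # r) z \<partial>lebd d)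
     = (\<integral>z. real n * X i * hermite_multi d (n - 1) X z * hg d \<mu> S r z \<partial>lebd d)"
  proof (rule hg_integral_by_parts[OF p i r pgrow_hermite_multi])
    show "pgrow d (\<lambda>z. real n * X i * hermite_multi d (n - 1) X z)"
      by (intro pgrow_mult[OF pgrow_const] pgrow_hermite_multi)
    show "isCont (\<lambda>t. real n * X i * hermite_multi d (n - 1) X (z(i := t))) t" for z t
      by (intro continuous_mult continuous_const DERIV_isCont[OF hermite_multi_derivative[OF i]])
  qed (use hermite_multi_derivative[OF i] in auto)
  also have "\<dots> = real n * X i * (\<integral>z. hermite_multi d (n - 1) X z * hg d \<mu> S r z \<partial>lebd d)"
    by (simp add: mult.assoc)
  \<comment> \<open>For n = 0 the factor \<open>real n\<close> is zero, which takes care of the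
    truncated n - 1.\<close>
  finally show ?case unfolding Cons.IH[OF r] by (cases n) (auto simp: algebra_simps)
qed

subsection \<open>The L1 norm of a homogeneous Hermite function\<close>

text \<open>Passes from index values with multiplicities, as in the recursion of
  \<open>herm\<close>, to positions in the list, as required for contracting tensors.\<close>

lemma sum_count_positions:
  fixes \<phi> :: "nat \<Rightarrow> nat list \<Rightarrow> real"
  assumes "set js \<subseteq> {..<d}"
    and "\<And>b u w. b < d \<Longrightarrow> set u \<subseteq> {..<d} \<Longrightarrow> mset u = mset w \<Longrightarrow> \<phi> b u = \<phi> b w"
  shows "(\<Sum>b<d. real (count_list js b) * \<phi> b (remove1 b js)) = (\<Sum>l<length js. \<phi> (js ! l) (take l js @ drop (Suc l) js))"
  using assms
proof (induction js arbitrary: \<phi>)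
  case Nil
  show ?case by simp
next
  case (Cons j r)
  have j: "j < d" and r: "set r \<subseteq> {..<d}" using Cons.prems(1) by auto
  have "(\<Sum>b<d. real (count_list (j # r) b) * \<phi> b (remove1 b (j # r)))
     = (\<Sum>b<d. (if b = j then \<phi> j r else 0) + real (count_list r b) * \<phi> b (j # remove1 b r))"
  proof (rule sum.cong[OF refl])
    fix b assume "b \<in> {..<d}"
    have "\<phi> j (j # remove1 j r) = \<phi> j r" if "j \<in> set r"
      using that j r set_remove1_le[OF r] by (intro Cons.prems(2)) auto
    thus "real (count_list (j # r) b) * \<phi> b (remove1 b (j # r))
       = (if b = j then \<phi> j r else 0) + real (count_list r b) * \<phi> b (j # remove1 b r)"
      by (auto simp: algebra_simps count_list_0_iff)
  qed
  also have "\<dots> = \<phi> j r + (\<Sum>b<d. real (count_list r b) * \<phi> b (j # remove1 b r))"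
    using j by (simp add: sum.distrib)
  also have "(\<Sum>b<d. real (count_list r b) * \<phi> b (j # remove1 b r)) = (\<Sum>l<length r. \<phi> (r ! l) (j # take l r @ drop (Suc l) r))"
  proof (rule Cons.IH[of "\<lambda>b u. \<phi> b (j # u)", OF r])
    fix b u w assume "b < d" "set u \<subseteq> {..<d}" "mset u = mset (w :: nat list)"
    thus "\<phi> b (j # u) = \<phi> b (j # w)" using j by (intro Cons.prems(2)) simp_all
  qed
  finally show ?case by (simp add: sum.lessThan_Suc_shift del: sum.lessThan_Suc)
qed

lemma yv_derivative:
  assumes "pdm d \<beta> S" "i < d"
  shows "((\<lambda>t. yv d \<mu> S (x(i := t)) l) has_real_derivative minv d S i l) (at t)"
proof -
  have "((\<lambda>t. (x(i := t)) r - \<mu> r) has_real_derivative idm i r) (at t)" for r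
    unfolding idm_def by (cases "i = r") (auto intro!: derivative_eq_intros)
  hence "((\<lambda>t. minv d S l r * ((x(i := t)) r - \<mu> r)) has_real_derivative minv d S l r * idm i r) (at t)" for r
    by (rule DERIV_cmult)
  hence "((\<lambda>t. \<Sum>r<d. minv d S l r * ((x(i := t)) r - \<mu> r)) has_real_derivative (\<Sum>r<d. minv d S l r * idm i r)) (at t)"
    by (rule DERIV_sum)
  moreover have "(\<Sum>r<d. minv d S l r * idm i r) = minv d S i l"
    using sum_idm(2)[OF assms(2), of "minv d S l"] minv_spec(4)[OF assms(1)] by (simp add: mult.commute)
  ultimately show ?thesis unfolding yv_def mv_def by (simp only:)
qed

text \<open>The inner product of two Hermite polynomials in L2 of the Gaussian.\<close>

definition gram :: "nat \<Rightarrow> (nat \<Rightarrow> real) \<Rightarrow> (nat \<Rightarrow> nat \<Rightarrow> real) \<Rightarrow> nat list \<Rightarrow> nat list \<Rightarrow> real" where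
  "gram d \<mu> S is js = (\<integral>x. herm d (minv d S) (yv d \<mu> S x) js * hg d \<mu> S is x \<partial>lebd d)"

text \<open>One step of Wick's formula: by parts, i is paired with each position of js in turn, at
  the cost of the matching entry of the inverse covariance.\<close>

lemma gram_Cons:
  assumes p: "pdm d \<beta> S" and i: "i < d" and "is": "set is \<subseteq> {..<d}" and js: "set js \<subseteq> {..<d}"
  shows "gram d \<mu> S (i # is) js = (\<Sum>l<length js. minv d S i (js ! l) * gram d \<mu> S is (take l js @ drop (Suc l) js))"
proof -
  let ?B = "minv d S" and ?y = "yv d \<mu> S"
  have sym: "?B i l = ?B l i" for i l by (rule minv_spec(4)[OF p])
  have dh: "((\<lambda>t. herm d ?B (?y (x(i := t))) u) has_real_derivative lower d ?B (?y (x(i := t))) (?B i) [] u) (at t)"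
    if "set u \<subseteq> {..<d}" for u x t
    by (rule herm_derivative[OF sym yv_derivative[OF p i] that])
  have "gram d \<mu> S (i # is) js = (\<integral>x. lower d ?B (?y x) (?B i) [] js * hg d \<mu> S is x \<partial>lebd d)"
    unfolding gram_def
  proof (rule hg_integral_by_parts[OF p i "is" pgrow_herm[OF js], where q' = "\<lambda>x. lower d ?B (?y x) (?B i) [] js"])
    show "pgrow d (\<lambda>x. lower d ?B (?y x) (?B i) [] js)"
      unfolding lower_def using set_remove1_le[OF js] by (intro pgrow_sum pgrow_mult pgrow_const pgrow_herm) auto
    show "isCont (\<lambda>t. lower d ?B (?y (x(i := t))) (?B i) [] js) t" for x t
      unfolding lower_def using set_remove1_le[OF js]
      by (intro continuous_sum continuous_mult continuous_const DERIV_isCont[OF dh]) auto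
  qed (rule dh[OF js])
  also have "\<dots> = (\<integral>x. (\<Sum>b<d. real (count_list js b) * ?B i b * (herm d ?B (?y x) (remove1 b js) * hg d \<mu> S is x)) \<partial>lebd d)"
    by (simp add: lower_def sum_distrib_right mult.assoc)
  also have "\<dots> = (\<Sum>b<d. real (count_list js b) * ?B i b * gram d \<mu> S is (remove1 b js))"
    unfolding gram_def
    using integrable_pgrow_hg[OF pgrow_herm[OF set_remove1_le[OF js]] p "is"]
    by (subst Bochner_Integration.integral_sum) auto
  also have "\<dots> = (\<Sum>l<length js. ?B i (js ! l) * gram d \<mu> S is (take l js @ drop (Suc l) js))"
    unfolding mult.assoc
  proof (rule sum_count_positions[OF js, where \<phi> = "\<lambda>b u. ?B i b * gram d \<mu> S is u"])
    fix b u w assume "set u \<subseteq> {..<d}" "mset u = mset (w :: nat list)"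
    thus "?B i b * gram d \<mu> S is u = ?B i b * gram d \<mu> S is w"
      unfolding gram_def using herm_perm[OF sym] by (auto intro!: Bochner_Integration.integral_cong)
  qed
  finally show ?thesis .
qed

lemma L2_set_square: "(L2_set f A)\<^sup>2 = (\<Sum>a\<in>A. (f a)\<^sup>2)"
  unfolding L2_set_def by (simp add: sum_nonneg)

text \<open>Wick pairing of the first index with position l contracts that slot of U with the
  inverse covariance, whose operator norm is at most \<beta>. Cauchy-Schwarz over the contracted
  index leaves the norms of T and U, and the r + 1 choices of l build up the factorial. Nothing
  depends on d.\<close>

lemma gram_bound:
  assumes p: "pdm d \<beta> S"
  shows "\<bar>\<Sum>is\<in>idx d r. \<Sum>js\<in>idx d r. T is * U js * gram d \<mu> S is js\<bar> \<le> fact r * \<beta> ^ r * tnorm d r T * tnorm d r U"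
proof (induction r arbitrary: T U)
  case 0
  have "gram d \<mu> S [] [] = 1" using integral_gd[OF p, of \<mu>] by (simp add: gram_def hg_def)
  thus ?case by (simp add: tnorm_def L2_set_def abs_mult)
next
  case (Suc r)
  have b: "0 < \<beta>" using p by (simp add: pdm_def)
  let ?B = "minv d S" and ?g = "gram d \<mu> S"
  \<comment> \<open>U contracted in slot l with row i of the inverse covariance.\<close>
  define V where "V l i w = (\<Sum>b<d. ?B i b * U (take l w @ b # drop l w))" for l i w
  have idx: "length u = n" "set u \<subseteq> {..<d}" if "u \<in> idx d n" for u n using that by (auto simp: idx_def)
  have inner: "(\<Sum>js\<in>idx d (Suc r). U js * ?g (i # u) js) = (\<Sum>l<Suc r. \<Sum>w\<in>idx d r. V l i w * ?g u w)"
    if i: "i < d" and u: "u \<in> idx d r" for i u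
  proof -
    have "(\<Sum>js\<in>idx d (Suc r). U js * ?g (i # u) js)
        = (\<Sum>js\<in>idx d (Suc r). \<Sum>l<Suc r. U js * (?B i (js ! l) * ?g u (take l js @ drop (Suc l) js)))"
      using gram_Cons[OF p i idx(2)[OF u] idx(2)] idx(1)
      by (intro sum.cong refl) (simp add: sum_distrib_left del: sum.lessThan_Suc)
    also have "\<dots> = (\<Sum>l<Suc r. \<Sum>js\<in>idx d (Suc r). U js * (?B i (js ! l) * ?g u (take l js @ drop (Suc l) js)))"
      by (rule sum.swap)
    also have "\<dots> = (\<Sum>l<Suc r. \<Sum>w\<in>idx d r. V l i w * ?g u w)"
    proof (rule sum.cong[OF refl])
      fix l assume "l \<in> {..<Suc r}"
      hence l: "l \<le> r" by simp
      have "(\<Sum>js\<in>idx d (Suc r). U js * (?B i (js ! l) * ?g u (take l js @ drop (Suc l) js)))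
          = (\<Sum>b<d. \<Sum>w\<in>idx d r. U (take l w @ b # drop l w) * (?B i b * ?g u w))"
        unfolding sum_idx_insert[OF l]
        by (intro sum.cong refl) (use l idx(1) in \<open>simp add: nth_append min_absorb2\<close>)
      also have "\<dots> = (\<Sum>w\<in>idx d r. \<Sum>b<d. U (take l w @ b # drop l w) * (?B i b * ?g u w))"
        by (rule sum.swap)
      also have "\<dots> = (\<Sum>w\<in>idx d r. V l i w * ?g u w)"
        by (simp add: V_def sum_distrib_left sum_distrib_right mult_ac)
      finally show "(\<Sum>js\<in>idx d (Suc r). U js * (?B i (js ! l) * ?g u (take l js @ drop (Suc l) js))) = \<dots>" .
    qed
    finally show ?thesis .
  qed
  have Vn: "L2_set (\<lambda>i. tnorm d r (V l i)) {..<d} \<le> \<beta> * tnorm d (Suc r) U" if l: "l \<le> r" for l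
  proof -
    have "(L2_set (\<lambda>i. tnorm d r (V l i)) {..<d})\<^sup>2 = (\<Sum>w\<in>idx d r. \<Sum>i<d. (mv d ?B (\<lambda>b. U (take l w @ b # drop l w)) i)\<^sup>2)"
      unfolding L2_set_square tnorm_def V_def mv_def by (rule sum.swap)
    also have "\<dots> \<le> (\<Sum>w\<in>idx d r. \<beta>\<^sup>2 * (\<Sum>b<d. (U (take l w @ b # drop l w))\<^sup>2))"
      by (intro sum_mono minv_norm_le[OF p])
    also have "\<dots> = \<beta>\<^sup>2 * (\<Sum>b<d. \<Sum>w\<in>idx d r. (U (take l w @ b # drop l w))\<^sup>2)"
      unfolding sum_distrib_left[symmetric] by (subst sum.swap) simp
    also have "\<dots> = (\<beta> * tnorm d (Suc r) U)\<^sup>2"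
      unfolding tnorm_def power_mult_distrib L2_set_square sum_idx_insert[OF l] ..
    finally show ?thesis using b by (simp add: power2_le_iff_abs_le tnorm_def L2_set_nonneg abs_le_square_iff[symmetric] abs_mult)
  qed
  have Tn: "L2_set (\<lambda>i. tnorm d r (\<lambda>u. T (i # u))) {..<d} = tnorm d (Suc r) T"
  proof -
    have "(L2_set (\<lambda>i. tnorm d r (\<lambda>u. T (i # u))) {..<d})\<^sup>2 = (tnorm d (Suc r) T)\<^sup>2"
      unfolding L2_set_square tnorm_def sum_idx_Suc ..
    thus ?thesis by (simp add: tnorm_def L2_set_nonneg)
  qed
  have "(\<Sum>is\<in>idx d (Suc r). \<Sum>js\<in>idx d (Suc r). T is * U js * ?g is js)
     = (\<Sum>i<d. \<Sum>u\<in>idx d r. T (i # u) * (\<Sum>js\<in>idx d (Suc r). U js * ?g (i # u) js))"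
    unfolding sum_idx_Suc[of "\<lambda>is. \<Sum>js\<in>idx d (Suc r). T is * U js * ?g is js"]
    by (simp add: sum_distrib_left mult.assoc)
  also have "\<dots> = (\<Sum>i<d. \<Sum>u\<in>idx d r. \<Sum>l<Suc r. \<Sum>w\<in>idx d r. T (i # u) * V l i w * ?g u w)"
    by (intro sum.cong refl) (simp add: inner sum_distrib_left mult.assoc del: sum.lessThan_Suc)
  also have "\<dots> = (\<Sum>i<d. \<Sum>l<Suc r. \<Sum>u\<in>idx d r. \<Sum>w\<in>idx d r. T (i # u) * V l i w * ?g u w)"
    by (rule sum.cong[OF refl], rule sum.swap)
  also have "\<dots> = (\<Sum>l<Suc r. \<Sum>i<d. \<Sum>u\<in>idx d r. \<Sum>w\<in>idx d r. T (i # u) * V l i w * ?g u w)"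
    by (rule sum.swap)
  finally have "\<bar>\<Sum>is\<in>idx d (Suc r). \<Sum>js\<in>idx d (Suc r). T is * U js * ?g is js\<bar>
      \<le> (\<Sum>l<Suc r. \<Sum>i<d. \<bar>\<Sum>u\<in>idx d r. \<Sum>w\<in>idx d r. T (i # u) * V l i w * ?g u w\<bar>)"
    by (simp only:) (rule order_trans[OF sum_abs sum_mono], rule sum_abs)
  also have "\<dots> \<le> (\<Sum>l<Suc r. fact r * \<beta> ^ r * (tnorm d (Suc r) T * (\<beta> * tnorm d (Suc r) U)))"
  proof (rule sum_mono)
    fix l assume "l \<in> {..<Suc r}"
    hence l: "l \<le> r" by simp
    have "(\<Sum>i<d. \<bar>\<Sum>u\<in>idx d r. \<Sum>w\<in>idx d r. T (i # u) * V l i w * ?g u w\<bar>)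
       \<le> (\<Sum>i<d. fact r * \<beta> ^ r * (\<bar>tnorm d r (\<lambda>u. T (i # u))\<bar> * \<bar>tnorm d r (V l i)\<bar>))"
      using Suc.IH[of "\<lambda>u. T (_ # u)" "V l _"] by (intro sum_mono) (simp add: mult.assoc tnorm_def L2_set_nonneg)
    also have "\<dots> = fact r * \<beta> ^ r * (\<Sum>i<d. \<bar>tnorm d r (\<lambda>u. T (i # u))\<bar> * \<bar>tnorm d r (V l i)\<bar>)"
      by (simp add: sum_distrib_left)
    also have "\<dots> \<le> fact r * \<beta> ^ r * (tnorm d (Suc r) T * (\<beta> * tnorm d (Suc r) U))"
    proof (rule mult_left_mono)
      have "(\<Sum>i<d. \<bar>tnorm d r (\<lambda>u. T (i # u))\<bar> * \<bar>tnorm d r (V l i)\<bar>)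
         \<le> L2_set (\<lambda>i. tnorm d r (\<lambda>u. T (i # u))) {..<d} * L2_set (\<lambda>i. tnorm d r (V l i)) {..<d}"
        by (rule L2_set_mult_ineq)
      also have "\<dots> \<le> tnorm d (Suc r) T * (\<beta> * tnorm d (Suc r) U)"
        unfolding Tn by (intro mult_left_mono Vn l) (simp add: tnorm_def L2_set_nonneg)
      finally show "(\<Sum>i<d. \<bar>tnorm d r (\<lambda>u. T (i # u))\<bar> * \<bar>tnorm d r (V l i)\<bar>) \<le> \<dots>" .
    qed (use b in simp)
    finally show "(\<Sum>i<d. \<bar>\<Sum>u\<in>idx d r. \<Sum>w\<in>idx d r. T (i # u) * V l i w * ?g u w\<bar>) \<le> \<dots>" .
  qed
  also have "\<dots> = fact (Suc r) * \<beta> ^ Suc r * tnorm d (Suc r) T * tnorm d (Suc r) U"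
    by (simp add: algebra_simps)
  finally show ?case .
qed

text \<open>The L1 norm is at most the L2 norm because the density has mass 1; this is used as |q|
  \<le> q^2 / (2 c) + c / 2.\<close>

lemma hermite_form_L1_bound:
  assumes p: "pdm d \<beta> S"
  shows "(\<integral>x. \<bar>\<Sum>is\<in>idx d r. T is * hg d \<mu> S is x\<bar> \<partial>lebd d) \<le> sqrt (fact r * \<beta> ^ r) * tnorm d r T"
proof (rule field_le_epsilon)
  fix e :: real assume e: "0 < e"
  have b: "0 < \<beta>" using p by (simp add: pdm_def)
  define N where "N = sqrt (fact r * \<beta> ^ r) * tnorm d r T"
  \<comment> \<open>N may be zero, whereas the weight c must be positive; hence the margin
    e.\<close>
  define c where "c = N + e"
  have N0: "0 \<le> N" using b by (simp add: N_def tnorm_def L2_set_nonneg)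
  hence c0: "0 < c" using e by (simp add: c_def)
  let ?H = "\<lambda>is x. herm d (minv d S) (yv d \<mu> S x) is" and ?G = "gd d \<mu> S"
  define q where "q x = (\<Sum>is\<in>idx d r. T is * ?H is x)" for x
  have sidx: "set is \<subseteq> {..<d}" if "is \<in> idx d r" for "is" using that by (simp add: idx_def)
  have G0: "0 \<le> ?G x" for x using gd_pos[OF p, of \<mu> x] by simp
  have hg0: "hg d \<mu> S [] = ?G" by (rule ext) (simp add: hg_def)
  have hgG: "hg d \<mu> S is x = ?H is x * ?G x" for "is" x by (simp add: hg_def)
  have pq: "pgrow d q" unfolding q_def by (intro pgrow_sum pgrow_mult pgrow_const pgrow_herm sidx)
  have set0: "set [] \<subseteq> {..<d}" by simp
  have iq: "integrable (lebd d) (\<lambda>x. q x * ?G x)" using integrable_pgrow_hg[OF pq p set0, of \<mu>] by (simp only: hg0)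
  have iqq: "integrable (lebd d) (\<lambda>x. q x * q x * ?G x)" using integrable_pgrow_hg[OF pgrow_mult[OF pq pq] p set0, of \<mu>] by (simp only: hg0)
  have iG: "integrable (lebd d) ?G" using integrable_hg[OF p set0, of \<mu>] by (simp only: hg0)
  have "(\<integral>x. q x * q x * ?G x \<partial>lebd d) = (\<integral>x. (\<Sum>is\<in>idx d r. \<Sum>js\<in>idx d r. T is * T js * (?H js x * hg d \<mu> S is x)) \<partial>lebd d)"
    by (rule Bochner_Integration.integral_cong[OF refl])
      (simp add: q_def sum_distrib_left sum_distrib_right hgG mult_ac)
  also have "\<dots> = (\<Sum>is\<in>idx d r. \<Sum>js\<in>idx d r. T is * T js * gram d \<mu> S is js)"
    unfolding gram_def using integrable_pgrow_hg[OF pgrow_herm[OF sidx] p sidx]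
    by (subst integral_sum2) auto
  also have "\<dots> \<le> fact r * \<beta> ^ r * tnorm d r T * tnorm d r T"
    using gram_bound[OF p, where T = T and U = T and r = r and \<mu> = \<mu>] by linarith
  also have "\<dots> = N\<^sup>2" using b by (simp add: N_def power_mult_distrib power2_eq_square[of "tnorm d r T"])
  also have "\<dots> \<le> c\<^sup>2" using N0 e unfolding c_def by (intro power_mono) auto
  finally have qq: "(\<integral>x. q x * q x * ?G x \<partial>lebd d) \<le> c\<^sup>2" .
  have "(\<integral>x. \<bar>\<Sum>is\<in>idx d r. T is * hg d \<mu> S is x\<bar> \<partial>lebd d) = (\<integral>x. \<bar>q x * ?G x\<bar> \<partial>lebd d)"
    by (simp add: q_def hgG sum_distrib_right mult.assoc)
  also have "\<dots> \<le> (\<integral>x. (1 / (2 * c)) * (q x * q x * ?G x) + (c / 2) * ?G x \<partial>lebd d)"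
  proof (rule integral_mono)
    show "integrable (lebd d) (\<lambda>x. \<bar>q x * ?G x\<bar>)" using iq by simp
    show "integrable (lebd d) (\<lambda>x. (1 / (2 * c)) * (q x * q x * ?G x) + (c / 2) * ?G x)" using iqq iG by simp
    fix x
    have "0 \<le> (\<bar>q x\<bar> - c)\<^sup>2 / (2 * c)" using c0 by simp
    also have "\<dots> = (1 / (2 * c)) * (q x * q x) + c / 2 - \<bar>q x\<bar>"
      using c0 by (simp add: power2_eq_square field_simps)
    finally have "\<bar>q x\<bar> * ?G x \<le> ((1 / (2 * c)) * (q x * q x) + c / 2) * ?G x"
      using G0 by (intro mult_right_mono) auto
    thus "\<bar>q x * ?G x\<bar> \<le> (1 / (2 * c)) * (q x * q x * ?G x) + (c / 2) * ?G x"
      using G0[of x] by (simp add: abs_mult algebra_simps)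
  qed
  also have "\<dots> = (1 / (2 * c)) * (\<integral>x. q x * q x * ?G x \<partial>lebd d) + (c / 2) * (\<integral>x. ?G x \<partial>lebd d)"
    using iqq iG by simp
  also have "(\<integral>x. ?G x \<partial>lebd d) = 1" by (rule integral_gd[OF p])
  also have "(1 / (2 * c)) * (\<integral>x. q x * q x * ?G x \<partial>lebd d) + (c / 2) * 1 \<le> (1 / (2 * c)) * c\<^sup>2 + (c / 2) * 1"
    using qq c0 by (intro add_right_mono mult_left_mono) auto
  also have "\<dots> = c" using c0 by (simp add: power2_eq_square field_simps)
  finally show "(\<integral>x. \<bar>\<Sum>is\<in>idx d r. T is * hg d \<mu> S is x\<bar> \<partial>lebd d) \<le> sqrt (fact r * \<beta> ^ r) * tnorm d r T + e"
    by (simp add: c_def N_def)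
qed

subsection \<open>Generating functions\<close>

lemma en_rec: "real n * en n a b = a * (if 1 \<le> n then en (n - 1) a b else 0) + b * (if 2 \<le> n then en (n - 2) a b else 0)"
proof -
  consider "n = 0" | "n = 1" | k where "n = Suc (Suc k)" by (metis One_nat_def not0_implies_Suc)
  thus ?thesis by cases auto
qed

definition Eg :: "real \<Rightarrow> real \<Rightarrow> real fps" where
  "Eg a b = Abs_fps (\<lambda>n. en n a b)"

lemma Eg_nth [simp]: "fps_nth (Eg a b) n = en n a b"
  by (simp add: Eg_def)

lemma Eg_deriv: "fps_deriv (Eg a b) = (fps_const a + fps_const b * fps_X) * Eg a b"
proof (rule fps_ext)
  fix n
  show "fps_nth (fps_deriv (Eg a b)) n = fps_nth ((fps_const a + fps_const b * fps_X) * Eg a b) n"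
    using en_rec[of "Suc n" a b] by (cases n) (simp_all add: distrib_right mult.assoc)
qed

text \<open>A linear differential equation with initial value 1 has one power series solution. The
  product rule \<open>Eg_add\<close> for exponentials follows from it.\<close>

lemma fps_eq_Eg:
  assumes "fps_nth F 0 = 1" "fps_deriv F = (fps_const a + fps_const b * fps_X) * F"
  shows "F = Eg a b"
proof (rule fps_ext)
  fix n
  show "fps_nth F n = fps_nth (Eg a b) n"
  proof (induction n rule: less_induct)
    case (less n)
    show ?case
    proof (cases n)
      case (Suc m)
      have "fps_nth (fps_deriv F) m = fps_nth ((fps_const a + fps_const b * fps_X) * F) m" by (simp only: assms(2))
      hence "real (Suc m) * fps_nth F (Suc m) = a * fps_nth F m + b * (if m = 0 then 0 else fps_nth F (m - 1))"
        by (cases m) (simp_all add: distrib_right mult.assoc)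
      also have "\<dots> = a * en m a b + b * (if m = 0 then 0 else en (m - 1) a b)"
        using less.IH[of m] less.IH[of "m - 1"] Suc by auto
      also have "\<dots> = real (Suc m) * en (Suc m) a b"
        using en_rec[of "Suc m" a b] by (auto simp: numeral_2_eq_2)
      finally show ?thesis using Suc by (simp del: of_nat_Suc en.simps)
    qed (use assms in simp)
  qed
qed

lemma Eg_add: "Eg (a + a') (b + b') = Eg a b * Eg a' b'"
  by (rule fps_eq_Eg[symmetric]) (simp_all add: Eg_deriv algebra_simps flip: fps_const_add)

lemma en_scale: "en n (s * a) (s\<^sup>2 * b) = s ^ n * en n a b"
  by (induction n a b rule: en.induct) (simp_all add: power2_eq_square algebra_simps)

text \<open>On generating functions, d/da multiplies by t and d/db by t^2 / 2, which shifts the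
  index by one and by two.\<close>

lemma en_derivative:
  assumes "(f has_real_derivative f') (at s within A)" "(g has_real_derivative g') (at s within A)"
  shows "((\<lambda>s. en n (f s) (g s)) has_real_derivative
    f' * (if 1 \<le> n then en (n - 1) (f s) (g s) else 0) + g' / 2 * (if 2 \<le> n then en (n - 2) (f s) (g s) else 0)) (at s within A)"
proof (induction n rule: less_induct)
  case (less n)
  consider "n = 0" | "n = 1" | k where "n = Suc (Suc k)" by (metis One_nat_def not0_implies_Suc)
  thus ?case
  proof cases
    case 3
    let ?e = "\<lambda>n. en n (f s) (g s)"
    let ?d = "\<lambda>n. f' * (if 1 \<le> n then ?e (n - 1) else 0) + g' / 2 * (if 2 \<le> n then ?e (n - 2) else 0)"
    have "((\<lambda>s. (f s * en (Suc k) (f s) (g s) + g s * en k (f s) (g s)) / real (Suc (Suc k))) has_real_derivative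
      ((f' * ?e (Suc k) + ?d (Suc k) * f s) + (g' * ?e k + ?d k * g s)) / real (Suc (Suc k))) (at s within A)"
      using less[of "Suc k"] less[of k] 3 by (intro DERIV_cdivide DERIV_add DERIV_mult assms) auto
    moreover have "((f' * ?e (Suc k) + ?d (Suc k) * f s) + (g' * ?e k + ?d k * g s)) / real (Suc (Suc k)) = ?d n"
    proof -
      have "(f' * ?e (Suc k) + ?d (Suc k) * f s) + (g' * ?e k + ?d k * g s)
        = f' * (?e (Suc k) + real (Suc k) * ?e (Suc k)) + g' / 2 * (2 * ?e k + real k * ?e k)"
        unfolding en_rec[of "Suc k"] en_rec[of k] by (simp add: algebra_simps numeral_2_eq_2)
      also have "\<dots> = real (Suc (Suc k)) * ?d n" unfolding 3 by (simp add: algebra_simps)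
      finally show ?thesis by simp
    qed
    ultimately show ?thesis unfolding 3 en.simps by (simp only:)
  qed (auto simp: assms)
qed

subsection \<open>Symbols\<close>

definition Lst :: "nat \<Rightarrow> nat \<Rightarrow> nat list set" where
  "Lst d M = {is. set is \<subseteq> {..<d} \<and> length is \<le> M}"

lemma finite_Lst [simp]: "finite (Lst d M)"
  unfolding Lst_def by (rule finite_lists_length_le) simp

lemma sum_Lst: "sum f (Lst d M) = (\<Sum>r\<le>M. sum f (idx d r))"
proof -
  have "Lst d M = (\<Union>r\<in>{..M}. idx d r)" by (auto simp: Lst_def idx_def)
  moreover have "sum f (\<Union>r\<in>{..M}. idx d r) = (\<Sum>r\<le>M. sum f (idx d r))"
    by (rule sum.UNION_disjoint) (simp, simp, auto simp: idx_def)
  ultimately show ?thesis by simp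
qed

lemma sum_Lst_Suc:
  fixes f :: "nat list \<Rightarrow> real"
  shows "sum f (Lst d (Suc M)) = f [] + (\<Sum>a<d. \<Sum>is\<in>Lst d M. f (a # is))"
proof -
  have "sum f (Lst d (Suc M)) = f [] + (\<Sum>r\<le>M. sum f (idx d (Suc r)))"
    unfolding sum_Lst sum.atMost_Suc_shift by simp
  also have "(\<Sum>r\<le>M. sum f (idx d (Suc r))) = (\<Sum>a<d. \<Sum>r\<le>M. \<Sum>is\<in>idx d r. f (a # is))"
    unfolding sum_idx_Suc by (rule sum.swap)
  finally show ?thesis by (simp add: sum_Lst)
qed

lemma sum_Lst_extend:
  assumes "M \<le> N" "\<And>is. M < length is \<Longrightarrow> f is = (0::real)"
  shows "sum f (Lst d N) = sum f (Lst d M)"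
  by (rule sum.mono_neutral_right[OF finite_Lst]) (use assms in \<open>auto simp: Lst_def not_le\<close>)

text \<open>
  A list \<open>is\<close> stands for the monomial with these indices, and \<open>C is\<close> for its coefficient, a
  polynomial in the path parameter \<open>s\<close>. \<open>Dop m V\<close> is the effect of \<open>d/ds\<close> on such a symbol when
  the mean is \<open>\<mu> + s m\<close> and the covariance \<open>S + s\<^sup>2 V\<close>.
\<close>

definition Dop :: "(nat \<Rightarrow> real) \<Rightarrow> (nat \<Rightarrow> nat \<Rightarrow> real) \<Rightarrow> (nat list \<Rightarrow> real poly) \<Rightarrow> nat list \<Rightarrow> real poly" where
  "Dop m V C is = pderiv (C is) + (case is of [] \<Rightarrow> 0 | a # r \<Rightarrow> Polynomial.smult (m a) (C r) +
     (case r of [] \<Rightarrow> 0 | b # u \<Rightarrow> [:0, V a b:] * C u))"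

definition symsum :: "nat \<Rightarrow> nat \<Rightarrow> (nat list \<Rightarrow> real poly) \<Rightarrow> real \<Rightarrow> (nat list \<Rightarrow> real) \<Rightarrow> real" where
  "symsum d M C s \<Phi> = (\<Sum>is\<in>Lst d M. poly (C is) s * \<Phi> is)"

text \<open>\<open>Dop\<close> is the transpose of the rule by which \<Phi> is differentiated: the
  coefficient at \<open>is\<close> is passed on to \<open>a # is\<close> and
  \<open>a # b # is\<close>. This is why the length bound grows by two.\<close>

lemma symsum_Dop:
  assumes C: "\<forall>is. M < length is \<longrightarrow> C is = 0"
  shows "symsum d (Suc (Suc M)) (Dop m V C) s \<Phi> =
    (\<Sum>is\<in>Lst d M. poly (pderiv (C is)) s * \<Phi> is + poly (C is) s *
       ((\<Sum>a<d. m a * \<Phi> (a # is)) + s * (\<Sum>a<d. \<Sum>b<d. V a b * \<Phi> (a # b # is))))"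
proof -
  let ?L = "Lst d (Suc (Suc M))"
  define A where "A is = (case is of [] \<Rightarrow> 0 | a # r \<Rightarrow> m a * poly (C r) s * \<Phi> is)" for "is"
  define B where "B is = (case is of [] \<Rightarrow> 0 | a # r \<Rightarrow> (case r of [] \<Rightarrow> 0 | b # u \<Rightarrow> s * V a b * poly (C u) s * \<Phi> is))" for "is"
  have "symsum d (Suc (Suc M)) (Dop m V C) s \<Phi> = (\<Sum>is\<in>?L. poly (pderiv (C is)) s * \<Phi> is + (A is + B is))"
    unfolding symsum_def Dop_def A_def B_def
    by (intro sum.cong refl) (simp split: list.split add: algebra_simps)
  also have "\<dots> = (\<Sum>is\<in>?L. poly (pderiv (C is)) s * \<Phi> is) + (sum A ?L + sum B ?L)"
    by (simp add: sum.distrib)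
  also have "(\<Sum>is\<in>?L. poly (pderiv (C is)) s * \<Phi> is) = (\<Sum>is\<in>Lst d M. poly (pderiv (C is)) s * \<Phi> is)"
    by (rule sum_Lst_extend) (simp_all add: C)
  also have "sum A ?L = (\<Sum>a<d. \<Sum>is\<in>Lst d (Suc M). m a * poly (C is) s * \<Phi> (a # is))"
    unfolding sum_Lst_Suc[of A] by (simp add: A_def)
  also have "\<dots> = (\<Sum>a<d. \<Sum>is\<in>Lst d M. m a * poly (C is) s * \<Phi> (a # is))"
    by (rule sum.cong[OF refl], rule sum_Lst_extend) (simp_all add: C)
  also have "\<dots> = (\<Sum>is\<in>Lst d M. poly (C is) s * (\<Sum>a<d. m a * \<Phi> (a # is)))"
    unfolding sum_distrib_left by (subst sum.swap) (simp add: mult_ac)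
  also have "sum B ?L = (\<Sum>a<d. \<Sum>b<d. \<Sum>is\<in>Lst d M. s * V a b * poly (C is) s * \<Phi> (a # b # is))"
    unfolding sum_Lst_Suc by (simp add: B_def)
  also have "\<dots> = (\<Sum>a<d. \<Sum>is\<in>Lst d M. \<Sum>b<d. s * V a b * poly (C is) s * \<Phi> (a # b # is))"
    by (rule sum.cong[OF refl], rule sum.swap)
  also have "\<dots> = (\<Sum>is\<in>Lst d M. \<Sum>a<d. \<Sum>b<d. s * V a b * poly (C is) s * \<Phi> (a # b # is))"
    by (rule sum.swap)
  also have "\<dots> = (\<Sum>is\<in>Lst d M. poly (C is) s * (s * (\<Sum>a<d. \<Sum>b<d. V a b * \<Phi> (a # b # is))))"
    by (simp add: sum_distrib_left mult_ac)
  finally show ?thesis by (simp add: sum.distrib distrib_left)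
qed

text \<open>The hypothesis on \<Phi> is met both by \<open>hg\<close> at a point x and by
  \<open>coef\<close> at a point X. So functions and their generating functions are differentiated
  through one and the same symbol.\<close>

lemma symsum_derivative:
  assumes C: "\<forall>is. M < length is \<longrightarrow> C is = 0"
    and \<Phi>: "\<And>is. set is \<subseteq> {..<d} \<Longrightarrow> ((\<lambda>s. \<Phi> s is) has_real_derivative
      (\<Sum>a<d. m a * \<Phi> s0 (a # is)) + s0 * (\<Sum>a<d. \<Sum>b<d. V a b * \<Phi> s0 (a # b # is))) (at s0 within A)"
  shows "((\<lambda>s. symsum d M C s (\<Phi> s)) has_real_derivative symsum d (Suc (Suc M)) (Dop m V C) s0 (\<Phi> s0)) (at s0 within A)"
proof -
  have "((\<lambda>s. poly (C is) s * \<Phi> s is) has_real_derivative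
      poly (pderiv (C is)) s0 * \<Phi> s0 is +
      ((\<Sum>a<d. m a * \<Phi> s0 (a # is)) + s0 * (\<Sum>a<d. \<Sum>b<d. V a b * \<Phi> s0 (a # b # is))) * poly (C is) s0) (at s0 within A)"
    if "is \<in> Lst d M" for "is"
    using that by (intro DERIV_mult \<Phi> has_field_derivative_at_within[OF poly_DERIV]) (auto simp: Lst_def)
  hence "((\<lambda>s. symsum d M C s (\<Phi> s)) has_real_derivative
     (\<Sum>is\<in>Lst d M. poly (pderiv (C is)) s0 * \<Phi> s0 is +
      ((\<Sum>a<d. m a * \<Phi> s0 (a # is)) + s0 * (\<Sum>a<d. \<Sum>b<d. V a b * \<Phi> s0 (a # b # is))) * poly (C is) s0)) (at s0 within A)"
    unfolding symsum_def by (rule DERIV_sum)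
  thus ?thesis unfolding symsum_Dop[OF C] by (simp add: mult.commute)
qed

lemma Dop_power_zero:
  assumes "\<And>is. M < length is \<Longrightarrow> C is = 0"
  shows "M + 2 * i < length is \<Longrightarrow> (Dop m V ^^ i) C is = 0"
proof (induction i arbitrary: "is")
  case (Suc i)
  thus ?case by (auto simp: Dop_def split: list.split)
qed (use assms in simp)

text \<open>c is the falling factorial l (l - 1) ... (l - i + 1).\<close>

lemma pderiv_power_monom: "\<exists>c. (pderiv ^^ i) (monom 1 l) = monom c (l - i) \<and> 0 \<le> c \<and> c \<le> real l ^ i \<and> (l < i \<longrightarrow> c = (0::real))"
proof (induction i)
  case (Suc i)
  then obtain c where c: "(pderiv ^^ i) (monom 1 l) = monom c (l - i)" "0 \<le> c" "c \<le> real l ^ i" "l < i \<longrightarrow> c = 0" by blast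
  have "real (l - i) * c \<le> real l * real l ^ i" using c by (intro mult_mono) auto
  thus ?case using c by (intro exI[of _ "real (l - i) * c"]) (auto simp: pderiv_monom)
qed auto

lemma pderiv_power_smult: "(pderiv ^^ i) (Polynomial.smult c p) = Polynomial.smult c ((pderiv ^^ i) (p :: real poly))"
  by (induction i) (simp_all add: pderiv_smult)

definition lin :: "nat \<Rightarrow> (nat \<Rightarrow> real) \<Rightarrow> (nat \<Rightarrow> real) \<Rightarrow> real" where
  "lin d \<mu> X = (\<Sum>i<d. \<mu> i * X i)"

definition qd :: "nat \<Rightarrow> (nat \<Rightarrow> nat \<Rightarrow> real) \<Rightarrow> (nat \<Rightarrow> real) \<Rightarrow> real" where
  "qd d S = quadform d (\<lambda>i l. S i l - idm i l)"

text \<open>The coefficient of t^n in the monomial of \<open>is\<close> at t X times exp (a t + b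
  t^2 / 2); by \<open>hermite_moment_hg\<close> it is a Hermite moment of \<open>hg\<close> divided
  by n!.\<close>

definition coef :: "nat \<Rightarrow> (nat \<Rightarrow> real) \<Rightarrow> real \<Rightarrow> real \<Rightarrow> nat list \<Rightarrow> real" where
  "coef n X a b is = (if length is \<le> n then mon X is * en (n - length is) a b else 0)"

text \<open>Of the same shape as \<open>hg_pS_derivative\<close>, with f and g in the place of mean
  and covariance.\<close>

lemma coef_derivative:
  assumes "(f has_real_derivative (\<Sum>a<d. m a * X a)) (at s within A)"
    and "(g has_real_derivative 2 * s * (\<Sum>a<d. \<Sum>b<d. V a b * X a * X b)) (at s within A)"
  shows "((\<lambda>s. coef n X (f s) (g s) is) has_real_derivative
     (\<Sum>a<d. m a * coef n X (f s) (g s) (a # is)) + s * (\<Sum>a<d. \<Sum>b<d. V a b * coef n X (f s) (g s) (a # b # is))) (at s within A)"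
proof (cases "length is \<le> n")
  case True
  let ?e = "\<lambda>k. en k (f s) (g s)" and ?k = "n - length is"
  have "((\<lambda>s. mon X is * en ?k (f s) (g s)) has_real_derivative mon X is *
    ((\<Sum>a<d. m a * X a) * (if 1 \<le> ?k then ?e (?k - 1) else 0) +
     2 * s * (\<Sum>a<d. \<Sum>b<d. V a b * X a * X b) / 2 * (if 2 \<le> ?k then ?e (?k - 2) else 0))) (at s within A)"
    by (rule DERIV_cmult[OF en_derivative[OF assms]])
  moreover have "(\<Sum>a<d. m a * coef n X (f s) (g s) (a # is)) = mon X is * ((\<Sum>a<d. m a * X a) * (if 1 \<le> ?k then ?e (?k - 1) else 0))"
  proof -
    have "m a * coef n X (f s) (g s) (a # is) = (m a * X a) * (mon X is * (if 1 \<le> ?k then ?e (?k - 1) else 0))" for a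
      unfolding coef_def by (cases "1 \<le> ?k") auto
    hence "(\<Sum>a<d. m a * coef n X (f s) (g s) (a # is)) =
      (\<Sum>a<d. m a * X a) * (mon X is * (if 1 \<le> ?k then ?e (?k - 1) else 0))"
      by (simp only: sum_distrib_right)
    thus ?thesis by simp
  qed
  moreover have V: "s * (\<Sum>a<d. \<Sum>b<d. V a b * coef n X (f s) (g s) (a # b # is)) =
      mon X is * (2 * s * (\<Sum>a<d. \<Sum>b<d. V a b * X a * X b) / 2 * (if 2 \<le> ?k then ?e (?k - 2) else 0))"
  proof -
    have "V a b * coef n X (f s) (g s) (a # b # is) = (V a b * X a * X b) * (mon X is * (if 2 \<le> ?k then ?e (?k - 2) else 0))" for a b
      unfolding coef_def by (cases "2 \<le> ?k") (auto simp: numeral_2_eq_2)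
    hence "(\<Sum>a<d. \<Sum>b<d. V a b * coef n X (f s) (g s) (a # b # is)) =
      (\<Sum>a<d. \<Sum>b<d. V a b * X a * X b) * (mon X is * (if 2 \<le> ?k then ?e (?k - 2) else 0))"
      by (simp only: sum_distrib_right)
    thus ?thesis by simp
  qed
  moreover have "coef n X (f s) (g s) is = mon X is * en ?k (f s) (g s)" for s
    using True by (simp add: coef_def)
  ultimately show ?thesis by (simp only: distrib_left)
qed (simp add: coef_def)

definition PP :: "nat \<Rightarrow> nat \<Rightarrow> (nat list \<Rightarrow> real) \<Rightarrow> (nat \<Rightarrow> real) \<Rightarrow> real fps" where
  "PP d M c X = Abs_fps (\<lambda>r. if r \<le> M then tensor_pair d r c X else 0)"

lemma sum_coef_eq: "(\<Sum>is\<in>Lst d M. c is * coef n X a b is) = fps_nth (PP d M c X * Eg a b) n"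
proof -
  have "(\<Sum>is\<in>Lst d M. c is * coef n X a b is) = (\<Sum>r\<le>M. if r \<le> n then tensor_pair d r c X * en (n - r) a b else 0)"
    unfolding sum_Lst
  proof (rule sum.cong[OF refl])
    fix r
    have "(\<Sum>is\<in>idx d r. c is * coef n X a b is) = (\<Sum>is\<in>idx d r. if r \<le> n then (c is * mon X is) * en (n - r) a b else 0)"
      by (rule sum.cong) (auto simp: coef_def idx_def)
    thus "(\<Sum>is\<in>idx d r. c is * coef n X a b is) = (if r \<le> n then tensor_pair d r c X * en (n - r) a b else 0)"
      by (simp add: tensor_pair_mon sum_distrib_right)
  qed
  also have "\<dots> = (\<Sum>r\<in>{..n}. if r \<le> M then tensor_pair d r c X * en (n - r) a b else 0)"
    by (simp only: sum.inter_filter[symmetric] finite_atMost) (rule sum.cong, auto)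
  also have "\<dots> = fps_nth (PP d M c X * Eg a b) n"
    unfolding fps_mult_nth PP_def atLeast0AtMost by (intro sum.cong refl) simp
  finally show ?thesis .
qed

lemma form_bound_power_eq:
  assumes "form_bound d n p e" "n = n'" "p = p'" "e \<le> e'"
  shows "form_bound d n' p' e'"
  using assms form_bound_mono by blast

text \<open>The recursion closes because \<alpha> (1 + \<alpha>) + \<alpha> \<le> (1 + \<alpha>)^2;
  the division by n is given away.\<close>

lemma form_bound_en:
  assumes a: "form_bound d 1 f \<alpha>" and b: "form_bound d 2 g \<alpha>"
  shows "form_bound d n (\<lambda>X. en n (f X) (g X)) ((1 + \<alpha>) ^ n)"
proof (induction n rule: less_induct)
  case (less n)
  have al: "0 \<le> \<alpha>" by (rule form_bound_nonneg[OF a])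
  consider "n = 0" | "n = 1" | k where "n = Suc (Suc k)" by (metis One_nat_def not0_implies_Suc)
  thus ?case
  proof cases
    case 1
    thus ?thesis using form_bound_const[of d 1] by simp
  next
    case 2
    thus ?thesis using form_bound_mono[OF a, of "1 + \<alpha>"] by simp
  next
    case 3
    have s1: "form_bound d n (\<lambda>X. f X * en (Suc k) (f X) (g X)) (\<alpha> * (1 + \<alpha>) ^ Suc k)"
      using form_bound_mult[OF a less[of "Suc k"]] 3 by simp
    have s2: "form_bound d n (\<lambda>X. g X * en k (f X) (g X)) (\<alpha> * (1 + \<alpha>) ^ k)"
      using form_bound_mult[OF b less[of k]] 3 by simp
    show ?thesis
    proof (rule form_bound_power_eq[OF form_bound_scale[OF form_bound_add[OF s1 s2], of "1 / real n"] refl])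
      show "(\<lambda>X. 1 / real n * (f X * en (Suc k) (f X) (g X) + g X * en k (f X) (g X))) = (\<lambda>X. en n (f X) (g X))"
        using 3 by (intro ext) simp
      have "\<bar>1 / real n\<bar> * (\<alpha> * (1 + \<alpha>) ^ Suc k + \<alpha> * (1 + \<alpha>) ^ k) \<le> 1 * (\<alpha> * (1 + \<alpha>) ^ Suc k + \<alpha> * (1 + \<alpha>) ^ k)"
        using al 3 by (intro mult_right_mono) auto
      also have "\<dots> = (\<alpha> * (1 + \<alpha>) + \<alpha>) * (1 + \<alpha>) ^ k" by (simp add: algebra_simps)
      also have "\<dots> \<le> ((1 + \<alpha>) * (1 + \<alpha>)) * (1 + \<alpha>) ^ k"
        using al by (intro mult_right_mono) (auto simp: algebra_simps)
      finally show "\<bar>1 / real n\<bar> * (\<alpha> * (1 + \<alpha>) ^ Suc k + \<alpha> * (1 + \<alpha>) ^ k) \<le> (1 + \<alpha>) ^ n"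
        using 3 by (simp add: mult.assoc)
    qed
  qed
qed

lemma form_bound_convolution:
  assumes f: "\<And>i. i \<le> n \<Longrightarrow> form_bound d i (f i) (A ^ i)" and g: "\<And>i. i \<le> n \<Longrightarrow> form_bound d i (g i) e"
    and A: "1 \<le> A"
  shows "form_bound d n (\<lambda>X. \<Sum>i\<le>n. f (n - i) X * g i X) (real (Suc n) * A ^ n * e)"
proof -
  have e: "0 \<le> e" using form_bound_nonneg[OF g[of 0]] by simp
  have "form_bound d n (\<lambda>X. f (n - i) X * g i X) (A ^ n * e)" if "i \<le> n" for i
  proof (rule form_bound_power_eq[OF form_bound_mult[OF f g[OF that], of "n - i"] _ refl])
    show "A ^ (n - i) * e \<le> A ^ n * e"
      using A e by (intro mult_right_mono power_increasing) auto
  qed (use that in auto)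
  from form_bound_sum[of "{..n}", OF _ this] show ?thesis by (simp add: mult.assoc algebra_simps)
qed

subsection \<open>Regular form and Taylor expansion in L1\<close>

lemma L2_set_convex:
  assumes "L2_set f A \<le> \<alpha>" "L2_set g A \<le> \<alpha>" "0 \<le> t" "t \<le> 1"
  shows "L2_set (\<lambda>i. f i + t * (g i - f i)) A \<le> \<alpha>"
proof -
  have sc: "L2_set (\<lambda>i. c * h i) A = c * L2_set h A" if "0 \<le> c" for c and h :: "'a \<Rightarrow> real"
    using that by (simp add: L2_set_def power_mult_distrib real_sqrt_mult flip: sum_distrib_left)
  have "(\<lambda>i. f i + t * (g i - f i)) = (\<lambda>i. (1 - t) * f i + t * g i)"
    by (rule ext) (simp add: algebra_simps)
  hence "L2_set (\<lambda>i. f i + t * (g i - f i)) A \<le> (1 - t) * L2_set f A + t * L2_set g A"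
    using L2_set_triangle_ineq[of "\<lambda>i. (1 - t) * f i" "\<lambda>i. t * g i" A] assms by (simp add: sc)
  also have "\<dots> \<le> \<alpha>" using assms by (intro convex_bound_le) auto
  finally show ?thesis .
qed

definition reg :: "nat \<Rightarrow> real \<Rightarrow> real \<Rightarrow> (nat \<Rightarrow> real) \<Rightarrow> (nat \<Rightarrow> nat \<Rightarrow> real) \<Rightarrow> bool" where
  "reg d \<alpha> \<beta> \<mu> S \<longleftrightarrow> pdm d \<beta> S \<and> vnorm d \<mu> \<le> \<alpha> \<and> frob d (\<lambda>i l. S i l - idm i l) \<le> \<alpha>"

lemma reg_path:
  assumes "reg d \<alpha> \<beta> \<mu>0 S0" "reg d \<alpha> \<beta> \<mu>1 S1" "s \<in> {0..1}"
  shows "reg d \<alpha> \<beta> (pm \<mu>0 \<mu>1 s) (pS S0 S1 s)"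
proof -
  have vn: "vnorm d \<mu> = L2_set \<mu> {..<d}" for \<mu> by (simp add: vnorm_def L2_set_def)
  have fr: "frob d T = L2_set (\<lambda>(i, l). T i l) ({..<d} \<times> {..<d})" for T
    by (simp add: frob_def L2_set_def sum.cartesian_product case_prod_beta)
  have "vnorm d (pm \<mu>0 \<mu>1 s) \<le> \<alpha>"
    using assms L2_set_convex[of \<mu>0 "{..<d}" \<alpha> \<mu>1 s] by (simp add: reg_def vn pm_def[abs_def])
  moreover have "frob d (\<lambda>i l. pS S0 S1 s i l - idm i l) \<le> \<alpha>"
  proof -
    have eq: "(\<lambda>p. (case p of (i, l) \<Rightarrow> S0 i l - idm i l) + s\<^sup>2 * ((case p of (i, l) \<Rightarrow> S1 i l - idm i l) - (case p of (i, l) \<Rightarrow> S0 i l - idm i l)))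
      = (\<lambda>(i, l). pS S0 S1 s i l - idm i l)"
      by (auto simp: pS_def fun_eq_iff)
    have "s\<^sup>2 \<le> 1" using assms(3) by (simp add: power_le_one)
    thus ?thesis
      using assms L2_set_convex[of "\<lambda>(i, l). S0 i l - idm i l" "{..<d} \<times> {..<d}" \<alpha> "\<lambda>(i, l). S1 i l - idm i l" "s\<^sup>2"]
      unfolding eq by (simp add: reg_def fr)
  qed
  ultimately show ?thesis using assms pdm_pS[OF _ _ assms(3)] by (simp add: reg_def)
qed

lemma reg_nonneg: "reg d \<alpha> \<beta> \<mu> S \<Longrightarrow> 0 \<le> \<alpha>"
  unfolding reg_def vnorm_def by (meson order_trans real_sqrt_ge_zero sum_nonneg zero_le_power2)

lemma reg_form_bound:
  assumes "reg d \<alpha> \<beta> \<mu> S"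
  shows "form_bound d 1 (lin d \<mu>) \<alpha>" "form_bound d 2 (qd d S) \<alpha>"
    "form_bound d 1 (\<lambda>X. - lin d \<mu> X) \<alpha>" "form_bound d 2 (\<lambda>X. - qd d S X) \<alpha>"
proof -
  show l: "form_bound d 1 (lin d \<mu>) \<alpha>"
    unfolding lin_def[abs_def] using assms by (intro form_bound_mono[OF form_bound_linear]) (simp add: reg_def)
  show q: "form_bound d 2 (qd d S) \<alpha>"
    unfolding qd_def using assms by (intro form_bound_mono[OF form_bound_quadform]) (simp add: reg_def)
  show "form_bound d 1 (\<lambda>X. - lin d \<mu> X) \<alpha>" "form_bound d 2 (\<lambda>X. - qd d S X) \<alpha>"
    using form_bound_scale[OF l, of "- 1"] form_bound_scale[OF q, of "- 1"] by simp_all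
qed

lemma lin_pm: "lin d (pm m0 m1 s) X = lin d m0 X + s * (lin d m1 X - lin d m0 X)"
  by (simp add: lin_def pm_def algebra_simps sum.distrib sum_subtractf sum_distrib_left)

lemma qd_pS: "qd d (pS S0 S1 s) X = qd d S0 X + s\<^sup>2 * (qd d S1 X - qd d S0 X)"
  by (simp add: qd_def quadform_def pS_def algebra_simps sum.distrib sum_subtractf sum_distrib_left)

text \<open>The weights 1 / i! and (1 - t)^M / M! are bounded by 1. Extended nonnegative reals let
  the remainder be integrated over x without a prior integrability proof.\<close>

lemma Taylor_abs_bound:
  fixes G :: "nat \<Rightarrow> real \<Rightarrow> real"
  assumes d: "\<And>i s. i \<le> M \<Longrightarrow> s \<in> {0..1} \<Longrightarrow> (G i has_real_derivative G (Suc i) s) (at s within {0..1})"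
    and c: "continuous_on {0..1} (G (Suc M))"
  shows "ennreal \<bar>G 0 1\<bar> \<le> (\<Sum>i\<le>M. ennreal \<bar>G i 0\<bar>) + (\<integral>\<^sup>+s. indicator {0..1} s * ennreal \<bar>G (Suc M) s\<bar> \<partial>lborel)"
proof -
  let ?f = "\<lambda>t. (1 - t) ^ M / fact M * G (Suc M) t"
  have hi: "(?f has_integral G 0 1 - (\<Sum>i\<le>M. G i 0 / fact i)) {0..1}"
    using Taylor_has_integral[of "Suc M" G "G 0" 0 1] d
    by (simp add: has_real_derivative_iff_has_vector_derivative lessThan_Suc_atMost)
  have ci: "(\<lambda>t. \<bar>G (Suc M) t\<bar>) integrable_on {0..1}"
    by (intro integrable_continuous_real continuous_intros c)
  have "\<bar>G 0 1 - (\<Sum>i\<le>M. G i 0 / fact i)\<bar> \<le> integral {0..1} (\<lambda>t. \<bar>G (Suc M) t\<bar>)"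
  proof -
    have "norm (integral {0..1} ?f) \<le> integral {0..1} (\<lambda>t. \<bar>G (Suc M) t\<bar>)"
    proof (rule integral_norm_bound_integral[OF has_integral_integrable[OF hi] ci])
      fix t :: real assume t: "t \<in> {0..1}"
      have "(1 - t) ^ M \<le> 1" using t by (intro power_le_one) auto
      also have "1 \<le> (fact M :: real)" by simp
      finally have "\<bar>(1 - t) ^ M / fact M\<bar> \<le> 1" using t by (simp add: divide_le_eq)
      thus "norm (?f t) \<le> \<bar>G (Suc M) t\<bar>"
        using mult_right_mono[of "\<bar>(1 - t) ^ M / fact M\<bar>" 1 "\<bar>G (Suc M) t\<bar>"] by (simp add: abs_mult)
    qed
    thus ?thesis unfolding integral_unique[OF hi] real_norm_def .
  qed
  moreover have "\<bar>\<Sum>i\<le>M. G i 0 / fact i\<bar> \<le> (\<Sum>i\<le>M. \<bar>G i 0\<bar>)"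
  proof (rule order_trans[OF sum_abs sum_mono])
    fix i
    have "1 \<le> (fact i :: real)" by simp
    thus "\<bar>G i 0 / fact i\<bar> \<le> \<bar>G i 0\<bar>"
      by (simp add: abs_divide divide_le_eq mult_le_cancel_left1)
  qed
  ultimately have "\<bar>G 0 1\<bar> \<le> (\<Sum>i\<le>M. \<bar>G i 0\<bar>) + integral {0..1} (\<lambda>t. \<bar>G (Suc M) t\<bar>)" by linarith
  hence "ennreal \<bar>G 0 1\<bar> \<le> ennreal ((\<Sum>i\<le>M. \<bar>G i 0\<bar>) + integral {0..1} (\<lambda>t. \<bar>G (Suc M) t\<bar>))"
    by (intro ennreal_leI)
  also have "\<dots> = ennreal (\<Sum>i\<le>M. \<bar>G i 0\<bar>) + ennreal (integral {0..1} (\<lambda>t. \<bar>G (Suc M) t\<bar>))"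
    by (rule ennreal_plus) (simp add: sum_nonneg, rule integral_nonneg[OF ci], simp)
  also have "ennreal (\<Sum>i\<le>M. \<bar>G i 0\<bar>) = (\<Sum>i\<le>M. ennreal \<bar>G i 0\<bar>)"
    by (simp add: sum_ennreal)
  finally have "ennreal \<bar>G 0 1\<bar> \<le> (\<Sum>i\<le>M. ennreal \<bar>G i 0\<bar>) + ennreal (integral {0..1} (\<lambda>t. \<bar>G (Suc M) t\<bar>))" .
  moreover have "ennreal (integral {0..1} (\<lambda>t. \<bar>G (Suc M) t\<bar>)) = (\<integral>\<^sup>+s. indicator {0..1} s * ennreal \<bar>G (Suc M) s\<bar> \<partial>lborel)"
  proof -
    have si: "set_integrable lborel {0..1} (\<lambda>t. \<bar>G (Suc M) t\<bar>)"
      by (rule borel_integrable_atLeastAtMost') (intro continuous_intros c)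
    hence "integral {0..1} (\<lambda>t. \<bar>G (Suc M) t\<bar>) = (\<integral>t. indicator {0..1} t * \<bar>G (Suc M) t\<bar> \<partial>lborel)"
      using set_borel_integral_eq_integral(2)[OF si] by (simp add: set_lebesgue_integral_def)
    also have "ennreal \<dots> = (\<integral>\<^sup>+t. ennreal (indicator {0..1} t * \<bar>G (Suc M) t\<bar>) \<partial>lborel)"
      using si by (intro nn_integral_eq_integral[symmetric]) (auto simp: set_integrable_def)
    also have "\<dots> = (\<integral>\<^sup>+s. indicator {0..1} s * ennreal \<bar>G (Suc M) s\<bar> \<partial>lborel)"
      by (intro nn_integral_cong) (auto simp: indicator_def)
    finally show ?thesis .
  qed
  ultimately show ?thesis by simp
qed

text \<open>Tonelli exchanges the integrals in the remainder, after which a bound on the L1 norm of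
  the last derivative, uniform in s, is enough.\<close>

lemma Taylor_L1_bound:
  fixes G :: "nat \<Rightarrow> real \<Rightarrow> 'a \<Rightarrow> real"
  assumes sf: "pair_sigma_finite (lborel :: real measure) R"
    and d: "\<And>i s x. s \<in> {0..1} \<Longrightarrow> ((\<lambda>s. G i s x) has_real_derivative G (Suc i) s x) (at s within {0..1})"
    and int: "\<And>i s. s \<in> {0..1} \<Longrightarrow> integrable R (G i s)"
    and m: "(\<lambda>\<omega>. G (Suc M) (clamp01 (fst \<omega>)) (snd \<omega>)) \<in> borel_measurable (lborel \<Otimes>\<^sub>M R)"
    and a: "\<And>i. i \<le> M \<Longrightarrow> (\<integral>x. \<bar>G i 0 x\<bar> \<partial>R) \<le> a"
    and K: "\<And>s. s \<in> {0..1} \<Longrightarrow> (\<integral>x. \<bar>G (Suc M) s x\<bar> \<partial>R) \<le> K"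
  shows "(\<integral>x. \<bar>G 0 1 x\<bar> \<partial>R) \<le> real (Suc M) * a + K"
proof -
  interpret pair_sigma_finite "lborel :: real measure" R by (rule sf)
  have K0: "0 \<le> K" and a0: "0 \<le> a"
    using order_trans[OF integral_nonneg_AE K[of 0]] order_trans[OF integral_nonneg_AE a[of 0]] by auto
  have nn: "(\<integral>\<^sup>+x. ennreal \<bar>f x\<bar> \<partial>R) = ennreal (\<integral>x. \<bar>f x\<bar> \<partial>R)" if "integrable R f" for f :: "'a \<Rightarrow> real"
    using that by (intro nn_integral_eq_integral) auto
  let ?G = "\<lambda>s x. indicator {0..1} s * ennreal \<bar>G (Suc M) (clamp01 s) x\<bar>"
  have ind: "(\<lambda>\<omega>. indicator {0..1::real} (fst \<omega>) :: ennreal) \<in> borel_measurable (lborel \<Otimes>\<^sub>M R)"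
  proof -
    have "(indicator {0..1} :: real \<Rightarrow> ennreal) \<in> borel_measurable lborel" by simp
    thus ?thesis by (rule measurable_compose[OF measurable_fst])
  qed
  have mG: "(\<lambda>(s, x). ?G s x) \<in> borel_measurable (lborel \<Otimes>\<^sub>M R)"
    unfolding case_prod_beta using m ind by (intro borel_measurable_times_ennreal) auto
  have "(\<integral>\<^sup>+x. ennreal \<bar>G 0 1 x\<bar> \<partial>R) \<le> (\<integral>\<^sup>+x. (\<Sum>i\<le>M. ennreal \<bar>G i 0 x\<bar>) + (\<integral>\<^sup>+s. ?G s x \<partial>lborel) \<partial>R)"
  proof (rule nn_integral_mono)
    fix x
    have "(\<integral>\<^sup>+s. ?G s x \<partial>lborel) = (\<integral>\<^sup>+s. indicator {0..1} s * ennreal \<bar>G (Suc M) s x\<bar> \<partial>lborel)"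
      by (intro nn_integral_cong) (auto simp: indicator_def clamp01(2))
    moreover have "continuous_on {0..1} (\<lambda>s. G (Suc M) s x)"
      by (rule DERIV_continuous_on[OF d])
    ultimately show "ennreal \<bar>G 0 1 x\<bar> \<le> (\<Sum>i\<le>M. ennreal \<bar>G i 0 x\<bar>) + (\<integral>\<^sup>+s. ?G s x \<partial>lborel)"
      using Taylor_abs_bound[of M "\<lambda>i s. G i s x", OF d] by simp
  qed
  also have "\<dots> = (\<Sum>i\<le>M. \<integral>\<^sup>+x. ennreal \<bar>G i 0 x\<bar> \<partial>R) + (\<integral>\<^sup>+x. (\<integral>\<^sup>+s. ?G s x \<partial>lborel) \<partial>R)"
  proof -
    have "(\<lambda>x. ennreal \<bar>G i 0 x\<bar>) \<in> borel_measurable R" for i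
      using int[of 0 i] by auto
    moreover have "(\<lambda>x. \<integral>\<^sup>+s. ?G s x \<partial>lborel) \<in> borel_measurable R"
      using lborel.borel_measurable_nn_integral[of "\<lambda>x s. ?G s x" R] measurable_pair_swap[OF mG] by simp
    moreover have "(\<integral>\<^sup>+x. (\<Sum>i\<le>M. ennreal \<bar>G i 0 x\<bar>) \<partial>R) = (\<Sum>i\<le>M. \<integral>\<^sup>+x. ennreal \<bar>G i 0 x\<bar> \<partial>R)"
      using calculation(1) by (intro nn_integral_sum) auto
    ultimately show ?thesis by (subst nn_integral_add) (auto intro!: borel_measurable_sum simp del: sum_ennreal)
  qed
  finally have h1: "(\<integral>\<^sup>+x. ennreal \<bar>G 0 1 x\<bar> \<partial>R) \<le>
    (\<Sum>i\<le>M. \<integral>\<^sup>+x. ennreal \<bar>G i 0 x\<bar> \<partial>R) + (\<integral>\<^sup>+x. (\<integral>\<^sup>+s. ?G s x \<partial>lborel) \<partial>R)" .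
  have "(\<integral>\<^sup>+x. (\<integral>\<^sup>+s. ?G s x \<partial>lborel) \<partial>R) = (\<integral>\<^sup>+s. (\<integral>\<^sup>+x. ?G s x \<partial>R) \<partial>lborel)"
    by (rule Fubini'[OF mG])
  also have "\<dots> \<le> (\<integral>\<^sup>+s. ennreal K * indicator {0..1::real} s \<partial>lborel)"
  proof (rule nn_integral_mono)
    fix s :: real
    show "(\<integral>\<^sup>+x. ?G s x \<partial>R) \<le> ennreal K * indicator {0..1} s"
    proof (cases "s \<in> {0..1}")
      case True
      have "(\<integral>\<^sup>+x. ?G s x \<partial>R) = (\<integral>\<^sup>+x. ennreal \<bar>G (Suc M) s x\<bar> \<partial>R)"
        using True by (simp add: clamp01(2))
      thus ?thesis using True K nn[OF int] K0 by (simp add: ennreal_leI)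
    qed simp
  qed
  also have "\<dots> = ennreal K" by (simp add: nn_integral_cmult)
  finally have h2: "(\<integral>\<^sup>+x. (\<integral>\<^sup>+s. ?G s x \<partial>lborel) \<partial>R) \<le> ennreal K" .
  have "(\<Sum>i\<le>M. \<integral>\<^sup>+x. ennreal \<bar>G i 0 x\<bar> \<partial>R) \<le> (\<Sum>i\<le>M. ennreal a)"
    using a by (intro sum_mono) (auto simp: nn[OF int] intro: ennreal_leI)
  also have "\<dots> = ennreal (\<Sum>i\<le>M. a)"
    using a0 by (intro sum_ennreal) auto
  finally have h3: "(\<Sum>i\<le>M. \<integral>\<^sup>+x. ennreal \<bar>G i 0 x\<bar> \<partial>R) \<le> ennreal (real (Suc M) * a)" by simp
  have "ennreal (\<integral>x. \<bar>G 0 1 x\<bar> \<partial>R) \<le> ennreal (real (Suc M) * a) + ennreal K"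
    using order_trans[OF h1 add_mono[OF h3 h2]] nn[OF int[of 1 0]] by simp
  also have "\<dots> = ennreal (real (Suc M) * a + K)"
    using a0 K0 by (intro ennreal_plus[symmetric]) auto
  finally have "ennreal (\<integral>x. \<bar>G 0 1 x\<bar> \<partial>R) \<le> ennreal (real (Suc M) * a + K)" .
  moreover have "0 \<le> real (Suc M) * a + K" using a0 K0 by simp
  ultimately show ?thesis by (simp only: ennreal_le_iff)
qed

subsection \<open>Eliminating one Gaussian\<close>

text \<open>The k-th Gaussian does not move along the path, so only the powers of s in its symbol
  are differentiated.\<close>

lemma Dop_zero: "Dop (\<lambda>_. 0) (\<lambda>_ _. 0) C is = pderiv (C is)"
  by (simp add: Dop_def split: list.split)

lemma Dop_power_pderiv: "(Dop (\<lambda>_. 0) (\<lambda>_ _. 0) ^^ i) C is = (pderiv ^^ i) (C is)"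
  by (induction i arbitrary: "is") (simp_all add: Dop_zero)

lemma pderiv_power_zero: "(pderiv ^^ i) 0 = (0 :: real poly)"
  by (induction i) simp_all

text \<open>Under the dilation X -> s X, a monomial of degree r acquires the factor s^r.\<close>

definition sym0 :: "nat \<Rightarrow> (nat list \<Rightarrow> real) \<Rightarrow> nat list \<Rightarrow> real poly" where
  "sym0 M c is = (if length is \<le> M then Polynomial.smult (c is) (monom 1 (length is)) else 0)"

text \<open>
  \<open>G i\<close> is the \<open>i\<close>-th derivative of \<open>g\<^sub>s\<close>, and \<open>W i n X\<close> the part of degree \<open>n\<close> of its
  generating function at \<open>X\<close>; \<open>Ft\<close> is the generating function \<open>H = F exp (-E\<^sub>k)\<close>.
\<close>

locale elimination =
  fixes d k M :: nat and \<alpha> \<beta> :: real and \<mu> :: "nat \<Rightarrow> nat \<Rightarrow> real"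
    and S :: "nat \<Rightarrow> nat \<Rightarrow> nat \<Rightarrow> real" and c :: "nat \<Rightarrow> nat list \<Rightarrow> real"
  assumes reg: "j \<le> k \<Longrightarrow> reg d \<alpha> \<beta> (\<mu> j) (S j)"
begin

definition "mp j s = pm (\<mu> k) (\<mu> j) s"
definition "Sp j s = pS (S k) (S j) s"
definition "D j i = (Dop (\<lambda>a. \<mu> j a - \<mu> k a) (\<lambda>a b. S j a b - S k a b) ^^ i) (sym0 M (c j))"
definition "G i s x = (\<Sum>j\<le>k. symsum d (M + 2 * i) (D j i) s (\<lambda>is. hg d (mp j s) (Sp j s) is x))"
definition "W i n X s = (\<Sum>j\<le>k. symsum d (M + 2 * i) (D j i) s (coef n X (lin d (mp j s) X) (qd d (Sp j s) X)))"
definition "F n X = (\<Sum>j\<le>k. \<Sum>is\<in>Lst d M. c j is * coef n X (lin d (\<mu> j) X) (qd d (S j) X) is)"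
definition "Ft l X = (\<Sum>i\<le>l. en (l - i) (- lin d (\<mu> k) X) (- qd d (S k) X) * F i X)"
text \<open>The i-th s-derivative of the degree n part of exp E_k(X) H(sX), expressed through F
  alone. Its equality with W, shown in \<open>W_eq\<close>, is what hands the moment bounds of g to
  the derivatives along the path.\<close>

definition "Rf i n X s = (\<Sum>l\<le>n. en (n - l) (lin d (\<mu> k) X) (qd d (S k) X) * (poly ((pderiv ^^ i) (monom 1 l)) s * Ft l X))"

lemma pdm: "j \<le> k \<Longrightarrow> pdm d \<beta> (S j)"
  using reg by (simp add: reg_def)

lemma D_Suc: "D j (Suc i) = Dop (\<lambda>a. \<mu> j a - \<mu> k a) (\<lambda>a b. S j a b - S k a b) (D j i)"
  by (simp add: D_def)

lemma D_zero: "\<forall>is. M + 2 * i < length is \<longrightarrow> D j i is = 0"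
proof (intro allI impI)
  fix "is" :: "nat list" assume "M + 2 * i < length is"
  thus "D j i is = 0" unfolding D_def by (intro Dop_power_zero[of M]) (simp_all add: sym0_def)
qed

lemma D_k: "D k (Suc M) is = 0"
proof -
  obtain r where r: "(pderiv ^^ Suc M) (monom 1 (length is)) = monom r (length is - Suc M)" "length is < Suc M \<longrightarrow> r = (0::real)"
    using pderiv_power_monom[of "Suc M" "length is"] by blast
  have "D k (Suc M) is = (pderiv ^^ Suc M) (sym0 M (c k) is)"
    unfolding D_def by (simp only: diff_self Dop_power_pderiv)
  thus ?thesis using r by (cases "length is \<le> M") (simp_all add: sym0_def pderiv_power_smult pderiv_power_zero del: funpow.simps)
qed

lemma G_derivative:
  assumes "s \<in> {0..1}"
  shows "((\<lambda>s. G i s x) has_real_derivative G (Suc i) s x) (at s within {0..1})"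
proof -
  have "((\<lambda>s. symsum d (M + 2 * i) (D j i) s (\<lambda>is. hg d (mp j s) (Sp j s) is x)) has_real_derivative
     symsum d (Suc (Suc (M + 2 * i))) (D j (Suc i)) s (\<lambda>is. hg d (mp j s) (Sp j s) is x)) (at s within {0..1})"
    if "j \<le> k" for j
    unfolding D_Suc mp_def Sp_def
    by (rule symsum_derivative[OF D_zero, where \<Phi> = "\<lambda>s is. hg d (pm (\<mu> k) (\<mu> j) s) (pS (S k) (S j) s) is x"],
        rule hg_pS_derivative[OF pdm pdm assms]) (use that in auto)
  hence "((\<lambda>s. G i s x) has_real_derivative
     (\<Sum>j\<le>k. symsum d (Suc (Suc (M + 2 * i))) (D j (Suc i)) s (\<lambda>is. hg d (mp j s) (Sp j s) is x))) (at s within {0..1})"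
    unfolding G_def by (intro DERIV_sum) auto
  thus ?thesis by (simp add: G_def)
qed

lemma W_derivative: "((\<lambda>s. W i n X s) has_real_derivative W (Suc i) n X s) (at s)"
proof -
  have "((\<lambda>s. symsum d (M + 2 * i) (D j i) s (coef n X (lin d (mp j s) X) (qd d (Sp j s) X))) has_real_derivative
     symsum d (Suc (Suc (M + 2 * i))) (D j (Suc i)) s (coef n X (lin d (mp j s) X) (qd d (Sp j s) X))) (at s)" for j
    unfolding D_Suc
  proof (rule symsum_derivative[OF D_zero, where \<Phi> = "\<lambda>s. coef n X (lin d (mp j s) X) (qd d (Sp j s) X)"], rule coef_derivative)
    show "((\<lambda>s. lin d (mp j s) X) has_real_derivative (\<Sum>a<d. (\<mu> j a - \<mu> k a) * X a)) (at s)"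
      unfolding mp_def lin_pm by (auto intro!: derivative_eq_intros simp: lin_def left_diff_distrib sum_subtractf)
    have "(\<Sum>a<d. \<Sum>b<d. (S j a b - S k a b) * X a * X b) = qd d (S j) X - qd d (S k) X"
      by (simp add: qd_def quadform_def algebra_simps flip: sum_subtractf)
    thus "((\<lambda>s. qd d (Sp j s) X) has_real_derivative 2 * s * (\<Sum>a<d. \<Sum>b<d. (S j a b - S k a b) * X a * X b)) (at s)"
      unfolding Sp_def qd_pS by (auto intro!: derivative_eq_intros)
  qed
  hence "((\<lambda>s. W i n X s) has_real_derivative
     (\<Sum>j\<le>k. symsum d (Suc (Suc (M + 2 * i))) (D j (Suc i)) s (coef n X (lin d (mp j s) X) (qd d (Sp j s) X)))) (at s)"
    unfolding W_def by (intro DERIV_sum) auto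
  thus ?thesis by (simp add: W_def)
qed

lemma Rf_derivative: "((\<lambda>s. Rf i n X s) has_real_derivative Rf (Suc i) n X s) (at s)"
proof -
  have "((\<lambda>s. poly ((pderiv ^^ i) (monom 1 l)) s * Ft l X) has_real_derivative poly ((pderiv ^^ Suc i) (monom 1 l)) s * Ft l X) (at s)" for l
    using DERIV_cmult_right[OF poly_DERIV[of "(pderiv ^^ i) (monom 1 l)" s]] by simp
  thus ?thesis unfolding Rf_def by (intro DERIV_sum DERIV_cmult) auto
qed

text \<open>The exponential of each interpolated Gaussian factors into exp E_k(X) and the
  exponential of E_j - E_k at s X. The first factor is common to all j, and the rest has degree l
  part s^l times that of H.\<close>

lemma W_0_eq: "W 0 n X s = Rf 0 n X s"
proof -
  define a b where "a j = lin d (\<mu> j) X" and "b j = qd d (S j) X" for j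
  define P where "P j = PP d M (c j) X" for j
  define Q where "Q j = P j * Eg (a j - a k) (b j - b k)" for j
  have sc: "fps_nth (PP d M (\<lambda>is. poly (D j 0 is) s) X * Eg (s * (a j - a k)) (s\<^sup>2 * (b j - b k))) l = s ^ l * fps_nth (Q j) l" for j l
  proof -
    have "fps_nth (PP d M (\<lambda>is. poly (D j 0 is) s) X) r = s ^ r * fps_nth (P j) r" for r
    proof -
      have "tensor_pair d r (\<lambda>is. poly (D j 0 is) s) X = s ^ r * tensor_pair d r (c j) X" if "r \<le> M"
        unfolding tensor_pair_mon sum_distrib_left
        by (rule sum.cong) (use that in \<open>auto simp: D_def sym0_def idx_def poly_monom\<close>)
      thus ?thesis by (simp add: PP_def P_def)
    qed
    hence "fps_nth (PP d M (\<lambda>is. poly (D j 0 is) s) X * Eg (s * (a j - a k)) (s\<^sup>2 * (b j - b k))) l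
       = (\<Sum>r=0..l. s ^ r * fps_nth (P j) r * (s ^ (l - r) * en (l - r) (a j - a k) (b j - b k)))"
      by (simp add: fps_mult_nth en_scale)
    also have "\<dots> = (\<Sum>r=0..l. s ^ l * (fps_nth (P j) r * en (l - r) (a j - a k) (b j - b k)))"
    proof (rule sum.cong[OF refl])
      fix r assume "r \<in> {0..l}"
      hence "s ^ l = s ^ r * s ^ (l - r)" by (simp flip: power_add)
      thus "s ^ r * fps_nth (P j) r * (s ^ (l - r) * en (l - r) (a j - a k) (b j - b k)) = s ^ l * (fps_nth (P j) r * en (l - r) (a j - a k) (b j - b k))"
        by simp
    qed
    also have "\<dots> = s ^ l * fps_nth (Q j) l"
      by (simp add: Q_def fps_mult_nth sum_distrib_left)
    finally show ?thesis .
  qed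
  have Q: "fps_nth (Q j) l = (\<Sum>i\<le>l. en (l - i) (- a k) (- b k) * (\<Sum>is\<in>Lst d M. c j is * coef i X (a j) (b j) is))" for j l
  proof -
    have "Q j = (P j * Eg (a j) (b j)) * Eg (- a k) (- b k)"
      unfolding Q_def using Eg_add[of "a j" "- a k" "b j" "- b k"] by (simp add: mult.assoc)
    thus ?thesis by (simp add: fps_mult_nth sum_coef_eq P_def mult.commute[of "en _ _ _"] flip: atLeast0AtMost)
  qed
  have Ft: "(\<Sum>j\<le>k. fps_nth (Q j) l) = Ft l X" for l
    unfolding Q Ft_def F_def a_def[symmetric] b_def[symmetric] sum_distrib_left
    by (subst sum.swap) simp
  have "W 0 n X s = (\<Sum>j\<le>k. fps_nth (PP d M (\<lambda>is. poly (D j 0 is) s) X * Eg (a k + s * (a j - a k)) (b k + s\<^sup>2 * (b j - b k))) n)"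
    unfolding W_def symsum_def mp_def Sp_def lin_pm qd_pS a_def[symmetric] b_def[symmetric]
    by (simp add: sum_coef_eq)
  also have "\<dots> = (\<Sum>j\<le>k. fps_nth ((PP d M (\<lambda>is. poly (D j 0 is) s) X * Eg (s * (a j - a k)) (s\<^sup>2 * (b j - b k))) * Eg (a k) (b k)) n)"
    by (simp add: Eg_add mult_ac)
  also have "\<dots> = (\<Sum>j\<le>k. \<Sum>l\<le>n. s ^ l * fps_nth (Q j) l * en (n - l) (a k) (b k))"
    unfolding fps_mult_nth[of "_ * _"] sc Eg_nth atLeast0AtMost ..
  also have "\<dots> = (\<Sum>l\<le>n. \<Sum>j\<le>k. s ^ l * fps_nth (Q j) l * en (n - l) (a k) (b k))"
    by (rule sum.swap)
  also have "\<dots> = (\<Sum>l\<le>n. en (n - l) (a k) (b k) * (s ^ l * Ft l X))"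
    by (simp add: Ft[symmetric] sum_distrib_left mult_ac)
  also have "\<dots> = Rf 0 n X s"
    by (simp add: Rf_def a_def b_def poly_monom)
  finally show ?thesis .
qed

text \<open>Both families consist of successive derivatives of the same function. Generating
  functions make sense for every real s, positive covariance or not, so two-sided derivatives can be
  compared.\<close>

lemma W_eq: "W i n X = Rf i n X"
proof (induction i)
  case 0
  show ?case using W_0_eq by blast
next
  case (Suc i)
  show ?case
  proof
    fix s
    have "((\<lambda>s. W i n X s) has_real_derivative Rf (Suc i) n X s) (at s)"
      using Rf_derivative[of i n X s] Suc by simp
    thus "W (Suc i) n X s = Rf (Suc i) n X s"
      using DERIV_unique W_derivative by blast
  qed
qed

lemma form_bound_Ft:
  assumes "\<And>i. i \<le> l \<Longrightarrow> form_bound d i (F i) \<epsilon>"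
  shows "form_bound d l (Ft l) (real (Suc l) * (1 + \<alpha>) ^ l * \<epsilon>)"
  unfolding Ft_def[abs_def]
proof (rule form_bound_convolution)
  show "form_bound d i (\<lambda>X. en i (- lin d (\<mu> k) X) (- qd d (S k) X)) ((1 + \<alpha>) ^ i)" for i
    by (rule form_bound_en) (rule reg_form_bound[OF reg[OF order_refl]])+
  show "1 \<le> 1 + \<alpha>" using reg_nonneg[OF reg[OF order_refl]] by simp
qed (use assms in simp)

text \<open>Degree n of the product involves the parts of H up to degree n only, and on [0,1] the
  i-th derivative of s^l is at most l^i.\<close>

lemma form_bound_W:
  assumes Ft: "\<And>l. l \<le> n \<Longrightarrow> form_bound d l (Ft l) e" and s: "s \<in> {0..1}" and K: "real n ^ i \<le> K"
  shows "form_bound d n (\<lambda>X. W i n X s) (real (Suc n) * (1 + \<alpha>) ^ n * (K * e))"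
  unfolding W_eq Rf_def
proof (rule form_bound_convolution)
  show "form_bound d i (\<lambda>X. en i (lin d (\<mu> k) X) (qd d (S k) X)) ((1 + \<alpha>) ^ i)" for i
    by (rule form_bound_en) (rule reg_form_bound[OF reg[OF order_refl]])+
  show "1 \<le> 1 + \<alpha>" using reg_nonneg[OF reg[OF order_refl]] by simp
  fix l assume l: "l \<le> n"
  obtain r where r: "(pderiv ^^ i) (monom 1 l) = monom r (l - i)" "0 \<le> r" "r \<le> real l ^ i"
    using pderiv_power_monom by blast
  have "\<bar>poly ((pderiv ^^ i) (monom 1 l)) s\<bar> \<le> K"
  proof -
    have "\<bar>poly ((pderiv ^^ i) (monom 1 l)) s\<bar> = r * s ^ (l - i)"
      using r s by (simp add: poly_monom abs_mult)
    also have "\<dots> \<le> real l ^ i * 1" using r s by (intro mult_mono power_le_one) auto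
    also have "\<dots> \<le> real n ^ i" using l by (simp add: power_mono)
    finally show ?thesis using K by simp
  qed
  thus "form_bound d l (\<lambda>X. poly ((pderiv ^^ i) (monom 1 l)) s * Ft l X) (K * e)"
    using form_bound_nonneg[OF Ft[OF l]]
    by (intro form_bound_mono[OF form_bound_scale[OF Ft[OF l]]] mult_right_mono) auto
qed

text \<open>At s = 0 the i-th derivative of s^l survives only for l = i, so the generating function
  of \<open>G i 0\<close> is a multiple of \<open>Ft i\<close> times exp E_k. The symbol U of
  \<open>G i 0\<close> itself has no useful bound; it may be traded for the small tensor T of the
  same form, because Hermite functions are symmetric in their indices.\<close>

lemma G_0_form:
  assumes "form_bound d i (Ft i) e"
  shows "\<exists>T. tnorm d i T \<le> real i ^ i * e \<and> (\<forall>x. G i 0 x = (\<Sum>is\<in>idx d i. T is * hg d (\<mu> k) (S k) is x))"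
proof -
  \<comment> \<open>\<kappa> is i!, here estimated by i^i.\<close>
  obtain \<kappa> where \<kappa>: "(pderiv ^^ i) (monom 1 i) = monom \<kappa> (i - i)" "0 \<le> \<kappa>" "\<kappa> \<le> real i ^ i"
    using pderiv_power_monom by blast
  have e: "0 \<le> e" by (rule form_bound_nonneg[OF assms])
  from form_bound_scale[OF assms, of \<kappa>] obtain T where
    T: "\<And>X. tensor_pair d i T X = \<kappa> * Ft i X" "tnorm d i T \<le> \<bar>\<kappa>\<bar> * e"
    unfolding form_bound_def by blast
  define U where "U is = (\<Sum>j\<le>k. poly (D j i is) 0)" for "is"
  have ends: "mp j 0 = \<mu> k" "Sp j 0 = S k" for j by (simp_all add: mp_def Sp_def pS_pm_ends)
  have tp: "tensor_pair d r U X = (if r = i then \<kappa> * Ft i X else 0)" if r: "r \<le> M + 2 * i" for r X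
  proof -
    let ?E = "Eg (lin d (\<mu> k) X) (qd d (S k) X)"
    have "PP d (M + 2 * i) U X * ?E = fps_const (\<kappa> * Ft i X) * fps_X ^ i * ?E"
    proof (rule fps_ext)
      fix n
      have "fps_nth (PP d (M + 2 * i) U X * ?E) n = W i n X 0"
        unfolding W_def symsum_def ends U_def sum_coef_eq[symmetric] sum_distrib_right by (rule sum.swap)
      also have "\<dots> = (\<Sum>l\<le>n. en (n - l) (lin d (\<mu> k) X) (qd d (S k) X) * (poly ((pderiv ^^ i) (monom 1 l)) 0 * Ft l X))"
        unfolding W_eq Rf_def ..
      also have "\<dots> = (\<Sum>l\<le>n. if l = i then en (n - i) (lin d (\<mu> k) X) (qd d (S k) X) * (\<kappa> * Ft i X) else 0)"
      proof (rule sum.cong[OF refl])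
        fix l
        obtain r where r: "(pderiv ^^ i) (monom 1 l) = monom r (l - i)" "l < i \<longrightarrow> r = (0::real)"
          using pderiv_power_monom by blast
        have "poly ((pderiv ^^ i) (monom 1 l)) 0 = (if l = i then \<kappa> else 0)"
        proof (cases "l = i")
          case True
          thus ?thesis using \<kappa>(1) by (simp add: poly_monom)
        next
          case False
          thus ?thesis using r by (cases "l < i") (auto simp: poly_monom)
        qed
        thus "en (n - l) (lin d (\<mu> k) X) (qd d (S k) X) * (poly ((pderiv ^^ i) (monom 1 l)) 0 * Ft l X)
          = (if l = i then en (n - i) (lin d (\<mu> k) X) (qd d (S k) X) * (\<kappa> * Ft i X) else 0)" by simp
      qed
      also have "\<dots> = fps_nth (fps_const (\<kappa> * Ft i X) * fps_X ^ i * ?E) n"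
        by (simp add: mult.assoc fps_X_power_mult_nth)
      finally show "fps_nth (PP d (M + 2 * i) U X * ?E) n = fps_nth (fps_const (\<kappa> * Ft i X) * fps_X ^ i * ?E) n" .
    qed
    \<comment> \<open>Power series form an integral domain, so the factor exp E_k cancels and the
      symbol U is left with a single nonzero degree.\<close>
    moreover have "?E \<noteq> 0"
    proof
      assume "?E = 0"
      hence "fps_nth ?E 0 = 0" by simp
      thus False by simp
    qed
    ultimately have "PP d (M + 2 * i) U X = fps_const (\<kappa> * Ft i X) * fps_X ^ i" by simp
    hence "fps_nth (PP d (M + 2 * i) U X) r = fps_nth (fps_const (\<kappa> * Ft i X) * fps_X ^ i) r" by simp
    thus ?thesis using r by (simp add: PP_def)
  qed
  have "G i 0 x = (\<Sum>is\<in>idx d i. T is * hg d (\<mu> k) (S k) is x)" for x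
  proof -
    let ?h = "\<lambda>is. hg d (\<mu> k) (S k) is x"
    have sym: "?h is = ?h js" if "is \<in> idx d r" "mset is = mset js" for r "is" js
      using that herm_perm[OF minv_spec(4)[OF pdm[OF order_refl]], of "is" d js] by (simp add: hg_def idx_def)
    have "G i 0 x = (\<Sum>is\<in>Lst d (M + 2 * i). U is * ?h is)"
      unfolding G_def symsum_def ends U_def sum_distrib_right by (rule sum.swap)
    also have "\<dots> = (\<Sum>r\<le>M + 2 * i. \<Sum>is\<in>idx d r. U is * ?h is)" by (rule sum_Lst)
    also have "\<dots> = (\<Sum>r\<le>M + 2 * i. if r = i then (\<Sum>is\<in>idx d i. T is * ?h is) else 0)"
    proof (rule sum.cong[OF refl])
      fix r assume "r \<in> {..M + 2 * i}"
      hence r: "r \<le> M + 2 * i" by simp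
      show "(\<Sum>is\<in>idx d r. U is * ?h is) = (if r = i then (\<Sum>is\<in>idx d i. T is * ?h is) else 0)"
      proof (cases "r = i")
        case True
        \<comment> \<open>U and T have the same form, hence the same pairing with the symmetric
          family of Hermite functions.\<close>
        have "(\<Sum>is\<in>idx d i. (U is - T is) * ?h is) = 0"
        proof (rule tensor_pair_zero_symmetric)
          show "tensor_pair d i (\<lambda>is. U is - T is) X = 0" for X
            using tp[of i X] T(1)[of X] by (simp add: tensor_pair_mon left_diff_distrib sum_subtractf)
        qed (rule sym)
        thus ?thesis using True by (simp add: left_diff_distrib sum_subtractf)
      next
        case False
        have "(\<Sum>is\<in>idx d r. U is * ?h is) = 0"
        proof (rule tensor_pair_zero_symmetric)
          show "tensor_pair d r U X = 0" for X using tp[OF r] False by simp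
        qed (rule sym)
        thus ?thesis using False by simp
      qed
    qed
    also have "\<dots> = (\<Sum>is\<in>idx d i. T is * ?h is)" by simp
    finally show ?thesis .
  qed
  moreover have "tnorm d i T \<le> real i ^ i * e"
  proof -
    have "\<bar>\<kappa>\<bar> * e \<le> real i ^ i * e" using \<kappa> e by (intro mult_right_mono) auto
    thus ?thesis using T(2) by linarith
  qed
  ultimately show ?thesis by blast
qed

lemma set_Lst: "is \<in> Lst d N \<Longrightarrow> set is \<subseteq> {..<d}"
  by (simp add: Lst_def)

lemma G_integrable:
  assumes "s \<in> {0..1}"
  shows "integrable (lebd d) (G i s)"
  unfolding G_def[abs_def] symsum_def mp_def Sp_def
  using integrable_hg[OF pdm_pS[OF pdm pdm assms] set_Lst]
  by (intro Bochner_Integration.integrable_sum Bochner_Integration.integrable_mult_right) auto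

lemma G_measurable: "(\<lambda>\<omega>. G i (clamp01 (fst \<omega>)) (snd \<omega>)) \<in> borel_measurable (lborel \<Otimes>\<^sub>M lebd d)"
proof -
  have p: "(\<lambda>\<omega>. poly q (clamp01 (fst \<omega>))) \<in> borel_measurable (lborel \<Otimes>\<^sub>M lebd d)" for q :: "real poly"
  proof -
    have "continuous_on UNIV (\<lambda>s. poly q (clamp01 s))"
      by (intro continuous_intros clamp01(3))
    hence "(\<lambda>s. poly q (clamp01 s)) \<in> borel_measurable lborel" by (simp add: borel_measurable_continuous_onI)
    thus ?thesis by (rule measurable_compose[OF measurable_fst])
  qed
  show ?thesis
    unfolding G_def symsum_def mp_def Sp_def
    by (intro borel_measurable_sum borel_measurable_times p hg_pS_measurable[OF pdm pdm set_Lst]) auto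
qed

lemma G_0_1: "G 0 1 x = (\<Sum>j\<le>k. \<Sum>is\<in>Lst d M. c j is * hg d (\<mu> j) (S j) is x)"
  by (auto simp: G_def symsum_def mp_def Sp_def pS_pm_ends D_def sym0_def Lst_def poly_monom intro!: sum.cong)

end

section \<open>The induction on the number of Gaussians\<close>

lemma sqrt_fact_power_le:
  assumes "0 \<le> \<beta>" "\<beta> \<le> E" "1 \<le> E" "i \<le> M"
  shows "sqrt (fact i * \<beta> ^ i) \<le> fact M * E ^ M"
proof -
  have u: "fact i * \<beta> ^ i \<le> fact M * E ^ M"
    using assms by (intro mult_mono fact_mono order_trans[OF power_mono power_increasing]) auto
  have "1 * 1 \<le> fact M * E ^ M" using assms by (intro mult_mono) auto
  hence "fact M * E ^ M \<le> (fact M * E ^ M)\<^sup>2"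
    using self_le_power[of "fact M * E ^ M" 2] by simp
  thus ?thesis using u assms by (intro real_le_lsqrt) auto
qed

text \<open>M is universally quantified in the induction, because eliminating a Gaussian takes M + 1
  derivatives in s and each raises the length of the symbols by two. C is chosen before the
  dimension, the Gaussians and the coefficients.\<close>

lemma mixture_L1_bound:
  fixes k M :: nat
  shows "\<exists>C::nat. \<forall>d \<alpha> \<beta> \<epsilon> \<mu> S c.
     (\<forall>j<k. reg d \<alpha> \<beta> (\<mu> j) (S j)) \<longrightarrow>
     (\<forall>n\<le>C. form_bound d n (\<lambda>X. \<Sum>j<k. \<Sum>is\<in>Lst d M. c j is * coef n X (lin d (\<mu> j) X) (qd d (S j) X) is) \<epsilon>) \<longrightarrow>
     (\<integral>x. \<bar>\<Sum>j<k. \<Sum>is\<in>Lst d M. c j is * hg d (\<mu> j) (S j) is x\<bar> \<partial>lebd d) \<le> (2 + \<alpha> + \<beta>) ^ C * \<epsilon>"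
proof (induction k arbitrary: M)
  case 0
  \<comment> \<open>The integral is zero, and the bound in degree 0 forces \<epsilon> \<ge>
    0.\<close>
  show ?case by (rule exI[of _ 0]) (auto dest: form_bound_nonneg)
next
  case (Suc k)
  define N where "N = Suc M"
  from Suc[of "M + 2 * N"] obtain C' where IH: "\<forall>d \<alpha> \<beta> \<epsilon> \<mu> S c.
     (\<forall>j<k. reg d \<alpha> \<beta> (\<mu> j) (S j)) \<longrightarrow>
     (\<forall>n\<le>C'. form_bound d n (\<lambda>X. \<Sum>j<k. \<Sum>is\<in>Lst d (M + 2 * N). c j is * coef n X (lin d (\<mu> j) X) (qd d (S j) X) is) \<epsilon>) \<longrightarrow>
     (\<integral>x. \<bar>\<Sum>j<k. \<Sum>is\<in>Lst d (M + 2 * N). c j is * hg d (\<mu> j) (S j) is x\<bar> \<partial>lebd d) \<le> (2 + \<alpha> + \<beta>) ^ C' * \<epsilon>" ..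
  \<comment> \<open>The highest degree in which H has to be bounded: M for the Taylor coefficients
    at 0, C' for the induction hypothesis.\<close>
  define C0 where "C0 = max C' M"
  \<comment> \<open>Factors of the Taylor part: number of terms, the L2 bound of a Hermite form, the
    bound on i!, and the convolution of F with exp (-E_k). In Q2: the convolution with exp E_k, the
    N-fold derivative of s^l, and again the convolution of F.\<close>
  define Q1 where "Q1 = Suc M * (fact M * (Suc M ^ M * Suc C0))"
  define Q2 where "Q2 = Suc C' * (Suc C' ^ N * Suc C0)"
  \<comment> \<open>Q1 + Q2 becomes a power of E, and M + 2 * C' + C0 exceeds both exponents of E.
    Since C \<ge> C0, the moments required for bounding H are available.\<close>
  define C where "C = Q1 + Q2 + M + 2 * C' + C0"
  show ?case
  proof (intro exI[of _ C] allI impI)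
    fix d \<alpha> \<beta> \<epsilon> \<mu> S and c :: "nat \<Rightarrow> nat list \<Rightarrow> real"
    assume H1: "\<forall>j<Suc k. reg d \<alpha> \<beta> (\<mu> j) (S j)"
    assume H2: "\<forall>n\<le>C. form_bound d n (\<lambda>X. \<Sum>j<Suc k. \<Sum>is\<in>Lst d M. c j is * coef n X (lin d (\<mu> j) X) (qd d (S j) X) is) \<epsilon>"
    interpret elimination d k M \<alpha> \<beta> \<mu> S c
      by standard (use H1 in auto)
    define E where "E = 2 + \<alpha> + \<beta>"
    have \<alpha>0: "0 \<le> \<alpha>" by (rule reg_nonneg[OF reg[OF order_refl]])
    have \<beta>0: "0 < \<beta>" using pdm[OF order_refl] by (simp add: pdm_def)
    have E2: "2 \<le> E" and E1: "1 + \<alpha> \<le> E" and E0: "1 \<le> E" and Eb: "\<beta> \<le> E"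
      using \<alpha>0 \<beta>0 by (simp_all add: E_def)
    have Fb: "form_bound d n (F n) \<epsilon>" if "n \<le> C" for n
      using H2 that by (simp add: F_def[abs_def] lessThan_Suc_atMost)
    have \<epsilon>0: "0 \<le> \<epsilon>" using form_bound_nonneg[OF Fb[of 0]] by simp
    have pw: "(1 + \<alpha>) ^ l \<le> E ^ n" if "l \<le> n" for l n
      using that E1 E0 \<alpha>0 by (intro order_trans[OF power_mono power_increasing]) auto
    define e1 where "e1 = real (Suc C0) * E ^ C0 * \<epsilon>"
    have Ftb: "form_bound d l (Ft l) e1" if l: "l \<le> C0" for l
    proof (rule form_bound_mono[OF form_bound_Ft])
      show "real (Suc l) * (1 + \<alpha>) ^ l * \<epsilon> \<le> e1"
        unfolding e1_def using l \<epsilon>0 \<alpha>0 pw[OF l] E0 by (intro mult_right_mono mult_mono) auto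
    qed (use l in \<open>auto simp: C_def intro!: Fb\<close>)
    have e10: "0 \<le> e1" by (rule form_bound_nonneg[OF Ftb[of 0]]) simp
    define e2 where "e2 = real (Suc C') * E ^ C' * (real (Suc C') ^ N * e1)"
    have GN: "(\<integral>x. \<bar>G (Suc M) s x\<bar> \<partial>lebd d) \<le> E ^ C' * e2" if s: "s \<in> {0..1}" for s
    proof -
      have "(\<integral>x. \<bar>\<Sum>j<k. \<Sum>is\<in>Lst d (M + 2 * N). poly (D j N is) s * hg d (mp j s) (Sp j s) is x\<bar> \<partial>lebd d) \<le> (2 + \<alpha> + \<beta>) ^ C' * e2"
      proof (rule IH[THEN spec, THEN spec, THEN spec, THEN spec, THEN spec, THEN spec, THEN spec, THEN mp, THEN mp])
        show "\<forall>j<k. reg d \<alpha> \<beta> (mp j s) (Sp j s)"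
          unfolding mp_def Sp_def using reg s by (auto intro!: reg_path)
        show "\<forall>n\<le>C'. form_bound d n (\<lambda>X. \<Sum>j<k. \<Sum>is\<in>Lst d (M + 2 * N). poly (D j N is) s * coef n X (lin d (mp j s) X) (qd d (Sp j s) X) is) e2"
        proof (intro allI impI)
          fix n assume n: "n \<le> C'"
          have "form_bound d n (\<lambda>X. W N n X s) (real (Suc n) * (1 + \<alpha>) ^ n * (real (Suc C') ^ N * e1))"
            using n by (intro form_bound_W Ftb s power_mono) (auto simp: C0_def)
          moreover have "real (Suc n) * (1 + \<alpha>) ^ n * (real (Suc C') ^ N * e1) \<le> e2"
            unfolding e2_def using n e10 \<alpha>0 pw[OF n] E0 by (intro mult_right_mono mult_mono) auto
          moreover have "W N n X s = (\<Sum>j<k. \<Sum>is\<in>Lst d (M + 2 * N). poly (D j N is) s * coef n X (lin d (mp j s) X) (qd d (Sp j s) X) is)" for X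
            \<comment> \<open>\<open>D_k\<close> deletes the summand j = k, leaving k Gaussians for
              the induction hypothesis.\<close>
            unfolding W_def symsum_def lessThan_Suc_atMost[symmetric] sum.lessThan_Suc by (simp add: N_def D_k)
          ultimately show "form_bound d n (\<lambda>X. \<Sum>j<k. \<Sum>is\<in>Lst d (M + 2 * N). poly (D j N is) s * coef n X (lin d (mp j s) X) (qd d (Sp j s) X) is) e2"
            using form_bound_mono by simp
        qed
      qed
      moreover have "G (Suc M) s x = (\<Sum>j<k. \<Sum>is\<in>Lst d (M + 2 * N). poly (D j N is) s * hg d (mp j s) (Sp j s) is x)" for x
        unfolding G_def symsum_def lessThan_Suc_atMost[symmetric] sum.lessThan_Suc by (simp add: N_def D_k)
      ultimately show ?thesis by (simp add: E_def)
    qed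
    define a where "a = fact M * E ^ M * (real (Suc M) ^ M * e1)"
    have G0: "(\<integral>x. \<bar>G i 0 x\<bar> \<partial>lebd d) \<le> a" if i: "i \<le> M" for i
    proof -
      have "i \<le> C0" using i by (simp add: C0_def)
      from G_0_form[OF Ftb[OF this]] obtain T where T: "tnorm d i T \<le> real i ^ i * e1"
        "\<And>x. G i 0 x = (\<Sum>is\<in>idx d i. T is * hg d (\<mu> k) (S k) is x)" by blast
      have "(\<integral>x. \<bar>G i 0 x\<bar> \<partial>lebd d) \<le> sqrt (fact i * \<beta> ^ i) * tnorm d i T"
        unfolding T(2) by (rule hermite_form_L1_bound[OF pdm[OF order_refl]])
      also have "\<dots> \<le> (fact M * E ^ M) * (real (Suc M) ^ M * e1)"
      proof (intro mult_mono)
        show "sqrt (fact i * \<beta> ^ i) \<le> fact M * E ^ M"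
          using \<beta>0 Eb E0 i by (intro sqrt_fact_power_le) auto
        have "real i ^ i \<le> real (Suc M) ^ M"
          using i by (intro order_trans[OF power_mono power_increasing]) auto
        thus "tnorm d i T \<le> real (Suc M) ^ M * e1"
          using T(1) mult_right_mono[OF _ e10] by (meson order_trans)
      qed (use E0 in \<open>auto simp: tnorm_def L2_set_nonneg\<close>)
      finally show ?thesis by (simp add: a_def)
    qed
    have "(\<integral>x. \<bar>G 0 1 x\<bar> \<partial>lebd d) \<le> real (Suc M) * a + E ^ C' * e2"
      by (rule Taylor_L1_bound[where G = G, OF pair_sigma_finite_lebd G_derivative G_integrable G_measurable G0 GN])
    also have "\<dots> \<le> E ^ C * \<epsilon>"
    proof -
      have q: "real Q * E ^ p * \<epsilon> \<le> real Q * E ^ r * \<epsilon>" if "p \<le> r" for Q p r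
        using that E0 \<epsilon>0 by (intro mult_right_mono mult_left_mono power_increasing) auto
      have "real (Suc M) * a = real Q1 * E ^ (M + C0) * \<epsilon>"
        unfolding a_def e1_def Q1_def by (simp add: power_add mult_ac del: of_nat_Suc mult_Suc mult_Suc_right)
      moreover have "E ^ C' * e2 = real Q2 * E ^ (2 * C' + C0) * \<epsilon>"
      proof -
        have "E ^ (2 * C' + C0) = E ^ C' * E ^ C' * E ^ C0" by (simp add: power_add mult_2)
        thus ?thesis unfolding e2_def e1_def Q2_def by (simp add: mult_ac del: of_nat_Suc mult_Suc mult_Suc_right)
      qed
      ultimately have "real (Suc M) * a + E ^ C' * e2 \<le> real Q1 * E ^ (M + 2 * C' + C0) * \<epsilon> + real Q2 * E ^ (M + 2 * C' + C0) * \<epsilon>"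
        using q[of "M + C0" "M + 2 * C' + C0" Q1] q[of "2 * C' + C0" "M + 2 * C' + C0" Q2] by linarith
      also have "\<dots> = real (Q1 + Q2) * E ^ (M + 2 * C' + C0) * \<epsilon>" by (simp add: algebra_simps)
      also have "\<dots> \<le> E ^ (Q1 + Q2) * E ^ (M + 2 * C' + C0) * \<epsilon>"
      proof (intro mult_right_mono)
        \<comment> \<open>Here E \<ge> 2 is used, the reason for the 2 in 2 + \<alpha> +
          \<beta>.\<close>
        have "real (Q1 + Q2) \<le> 2 ^ (Q1 + Q2)" by (intro less_imp_le of_nat_less_two_power)
        also have "\<dots> \<le> E ^ (Q1 + Q2)" using E2 by (intro power_mono) auto
        finally show "real (Q1 + Q2) \<le> E ^ (Q1 + Q2)" .
      qed (use E0 \<epsilon>0 in auto)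
      also have "\<dots> = E ^ C * \<epsilon>" by (simp add: C_def power_add mult_ac)
      finally show ?thesis .
    qed
    finally show "(\<integral>x. \<bar>\<Sum>j<Suc k. \<Sum>is\<in>Lst d M. c j is * hg d (\<mu> j) (S j) is x\<bar> \<partial>lebd d) \<le> (2 + \<alpha> + \<beta>) ^ C * \<epsilon>"
      unfolding G_0_1 lessThan_Suc_atMost E_def .
  qed
qed

subsection \<open>Polynomials as combinations of Hermite functions\<close>

definition hspan :: "nat \<Rightarrow> (nat \<Rightarrow> real) \<Rightarrow> (nat \<Rightarrow> nat \<Rightarrow> real) \<Rightarrow> nat \<Rightarrow> ((nat \<Rightarrow> real) \<Rightarrow> real) \<Rightarrow> bool" where
  "hspan d \<mu> S N f \<longleftrightarrow> (\<exists>c. \<forall>x. f x = (\<Sum>is\<in>Lst d N. c is * herm d (minv d S) (yv d \<mu> S x) is))"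

lemma hspan_mult: "hspan d \<mu> S N f \<Longrightarrow> hspan d \<mu> S N (\<lambda>x. r * f x)"
proof -
  assume "hspan d \<mu> S N f"
  then obtain c where "\<And>x. f x = (\<Sum>is\<in>Lst d N. c is * herm d (minv d S) (yv d \<mu> S x) is)"
    unfolding hspan_def by blast
  thus ?thesis unfolding hspan_def
    by (intro exI[of _ "\<lambda>is. r * c is"]) (simp add: sum_distrib_left mult.assoc)
qed

lemma hspan_add: "hspan d \<mu> S N f \<Longrightarrow> hspan d \<mu> S N g \<Longrightarrow> hspan d \<mu> S N (\<lambda>x. f x + g x)"
proof -
  assume "hspan d \<mu> S N f" "hspan d \<mu> S N g"
  then obtain c c' where "\<And>x. f x = (\<Sum>is\<in>Lst d N. c is * herm d (minv d S) (yv d \<mu> S x) is)"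
    "\<And>x. g x = (\<Sum>is\<in>Lst d N. c' is * herm d (minv d S) (yv d \<mu> S x) is)"
    unfolding hspan_def by blast
  thus ?thesis unfolding hspan_def
    by (intro exI[of _ "\<lambda>is. c is + c' is"]) (simp add: sum.distrib distrib_right)
qed

lemma hspan_zero: "hspan d \<mu> S N (\<lambda>x. 0)"
  unfolding hspan_def by (rule exI[of _ "\<lambda>_. 0"]) simp

lemma hspan_sum: "(\<And>a. a \<in> A \<Longrightarrow> hspan d \<mu> S N (f a)) \<Longrightarrow> hspan d \<mu> S N (\<lambda>x. \<Sum>a\<in>A. f a x)"
  by (induction A rule: infinite_finite_induct) (auto intro: hspan_zero hspan_add)

lemma hspan_herm: "is \<in> Lst d N \<Longrightarrow> hspan d \<mu> S N (\<lambda>x. herm d (minv d S) (yv d \<mu> S x) is)"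
  unfolding hspan_def
  by (intro exI[of _ "\<lambda>js. if js = is then 1 else 0"]) (simp add: if_distrib[of "\<lambda>u. u * _"] cong: if_cong)

lemma hspan_mono:
  assumes "hspan d \<mu> S N f" "N \<le> N'"
  shows "hspan d \<mu> S N' f"
proof -
  obtain c where c: "\<And>x. f x = (\<Sum>is\<in>Lst d N. c is * herm d (minv d S) (yv d \<mu> S x) is)"
    using assms(1) unfolding hspan_def by blast
  have "hspan d \<mu> S N' (\<lambda>x. \<Sum>is\<in>Lst d N. c is * herm d (minv d S) (yv d \<mu> S x) is)"
    using assms(2) by (intro hspan_sum hspan_mult hspan_herm) (auto simp: Lst_def)
  thus ?thesis by (simp add: c[abs_def])
qed

text \<open>x = \<mu> + S y, and the recursion of \<open>herm\<close> read backwards expresses y_a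
  times a Hermite polynomial by one of length one more and shorter ones.\<close>

lemma hspan_coord_mult:
  assumes p: "pdm d \<beta> S" and i: "i < d" and f: "hspan d \<mu> S N f"
  shows "hspan d \<mu> S (Suc N) (\<lambda>x. x i * f x)"
proof -
  let ?B = "minv d S" and ?H = "\<lambda>is x. herm d (minv d S) (yv d \<mu> S x) is"
  obtain c where c: "\<And>x. f x = (\<Sum>is\<in>Lst d N. c is * ?H is x)"
    using f unfolding hspan_def by blast
  have "hspan d \<mu> S (Suc N) (\<lambda>x. x i * ?H is x)" if L: "is \<in> Lst d N" for "is"
  proof -
    have "x i * ?H is x = \<mu> i * ?H is x + (\<Sum>a<d. S i a * (?H (a # is) x + (\<Sum>b<d. (real (count_list is b) * ?B a b) * ?H (remove1 b is) x)))" for x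
    proof -
      have "x i - \<mu> i = (\<Sum>a<d. S i a * yv d \<mu> S x a)"
        using mv_minv[OF p i, of "\<lambda>i. x i - \<mu> i"] by (simp add: yv_def mv_def[of d S])
      hence "(x i - \<mu> i) * ?H is x = (\<Sum>a<d. S i a * (yv d \<mu> S x a * ?H is x))"
        by (simp add: sum_distrib_right mult.assoc)
      thus ?thesis by (simp add: herm.simps(2) left_diff_distrib)
    qed
    moreover have "hspan d \<mu> S (Suc N) (\<lambda>x. \<mu> i * ?H is x + (\<Sum>a<d. S i a * (?H (a # is) x + (\<Sum>b<d. (real (count_list is b) * ?B a b) * ?H (remove1 b is) x))))"
      using L set_remove1_le[of "is" d]
      by (intro hspan_add hspan_mult hspan_sum hspan_herm) (auto simp: Lst_def length_remove1)
    ultimately show ?thesis by simp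
  qed
  hence "hspan d \<mu> S (Suc N) (\<lambda>x. \<Sum>is\<in>Lst d N. c is * (x i * ?H is x))"
    by (intro hspan_sum hspan_mult)
  thus ?thesis by (simp add: c sum_distrib_left mult_ac)
qed

lemma hspan_monomial:
  assumes p: "pdm d \<beta> S" and "j \<le> d"
  shows "hspan d \<mu> S (\<Sum>i<j. e i) (\<lambda>x. \<Prod>i<j. x i ^ e i)"
  using assms(2)
proof (induction j)
  case 0
  show ?case using hspan_herm[of "[]" d 0 \<mu> S] by (simp add: Lst_def)
next
  case (Suc j)
  have "hspan d \<mu> S ((\<Sum>i<j. e i) + n) (\<lambda>x. x j ^ n * (\<Prod>i<j. x i ^ e i))" for n
  proof (induction n)
    case (Suc n)
    show ?case using hspan_coord_mult[OF p _ Suc, of j] \<open>Suc j \<le> d\<close> by (simp add: mult.assoc)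
  qed (use Suc in simp)
  from this[of "e j"] show ?case by (simp add: mult.commute)
qed

lemma poly_eval_hermite:
  assumes p: "pdm d \<beta> S"
  shows "\<exists>c'. \<forall>x. poly_eval d m c x * gd d \<mu> S x = (\<Sum>is\<in>Lst d m. c' is * hg d \<mu> S is x)"
proof -
  have "hspan d \<mu> S m (poly_eval d m c)"
    unfolding poly_eval_def[abs_def]
    by (intro hspan_sum hspan_mult hspan_mono[OF hspan_monomial[OF p order_refl]]) (simp add: mono_exps_def)
  then obtain c' where "\<And>x. poly_eval d m c x = (\<Sum>is\<in>Lst d m. c' is * herm d (minv d S) (yv d \<mu> S x) is)"
    unfolding hspan_def by blast
  thus ?thesis by (intro exI[of _ c']) (simp add: hg_def sum_distrib_right mult.assoc)
qed

section \<open>From the norm of the moment tensor to the generating function\<close>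

lemma qd_eq: "qd d S X = quadform d S X - (\<Sum>i<d. (X i)\<^sup>2)"
proof -
  have "qd d S X = quadform d S X - quadform d idm X"
    by (simp add: qd_def quadform_def algebra_simps sum_subtractf)
  also have "quadform d idm X = (\<Sum>i<d. (X i)\<^sup>2)"
    by (simp add: quadform_mv mv_def power2_eq_square)
  finally show ?thesis .
qed

lemma hermite_moment_mixture:
  assumes "\<And>j. j < k \<Longrightarrow> pdm d \<beta> (S j)"
  shows "hermite_moment d n (\<lambda>x. \<Sum>j<k. \<Sum>is\<in>Lst d M. c j is * hg d (\<mu> j) (S j) is x) X =
    fact n * (\<Sum>j<k. \<Sum>is\<in>Lst d M. c j is * coef n X (lin d (\<mu> j) X) (qd d (S j) X) is)"
proof -
  let ?q = "hermite_multi d n X"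
  have int: "integrable (lebd d) (\<lambda>z. c j is * (?q z * hg d (\<mu> j) (S j) is z))" if "j \<in> {..<k}" "is \<in> Lst d M" for j "is"
    using integrable_pgrow_hg[OF pgrow_hermite_multi assms] that by (auto simp: Lst_def)
  have "hermite_moment d n (\<lambda>x. \<Sum>j<k. \<Sum>is\<in>Lst d M. c j is * hg d (\<mu> j) (S j) is x) X
     = (\<integral>z. (\<Sum>j<k. \<Sum>is\<in>Lst d M. c j is * (?q z * hg d (\<mu> j) (S j) is z)) \<partial>lebd d)"
    unfolding hermite_moment_def by (simp add: sum_distrib_left sum_distrib_right mult_ac)
  also have "\<dots> = (\<Sum>j<k. \<Sum>is\<in>Lst d M. \<integral>z. c j is * (?q z * hg d (\<mu> j) (S j) is z) \<partial>lebd d)"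
    by (rule integral_sum2(1)[OF int])
  also have "\<dots> = (\<Sum>j<k. \<Sum>is\<in>Lst d M. fact n * (c j is * coef n X (lin d (\<mu> j) X) (qd d (S j) X) is))"
    by (intro sum.cong refl) (auto simp: hermite_moment_hg[OF assms] Lst_def coef_def lin_def qd_eq)
  finally show ?thesis by (simp add: sum_distrib_left)
qed

text \<open>Provides some tensor for each summand of a Hermite moment, so that
  \<open>tensor_of\<close> is meaningful there; the assumed bound \<epsilon> then takes the place of
  e.\<close>

lemma form_bound_coef:
  assumes "reg d \<alpha> \<beta> \<mu> S" "set is \<subseteq> {..<d}"
  shows "\<exists>e. form_bound d n (\<lambda>X. coef n X (lin d \<mu> X) (qd d S X) is) e"
proof (cases "length is \<le> n")
  case True
  have "form_bound d (length is + (n - length is)) (\<lambda>X. mon X is * en (n - length is) (lin d \<mu> X) (qd d S X)) (1 * (1 + \<alpha>) ^ (n - length is))"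
    by (rule form_bound_mult[OF form_bound_mon[OF assms(2)] form_bound_en[OF reg_form_bound(1,2)[OF assms(1)]]])
  thus ?thesis using True by (auto simp: coef_def)
qed (use form_bound_zero in \<open>auto simp: coef_def\<close>)

theorem theorem5p1:
  fixes k m :: nat
  assumes "0 < k" and "0 < m"
  shows "\<exists>C::nat. \<forall>(d::nat) (\<alpha>::real) (\<beta>::real) (\<epsilon>::real)
            (mu :: nat \<Rightarrow> nat \<Rightarrow> real) (Sig :: nat \<Rightarrow> nat \<Rightarrow> nat \<Rightarrow> real)
            (c :: nat \<Rightarrow> (nat \<Rightarrow> nat) \<Rightarrow> real).
     0 < \<beta> \<longrightarrow>
     (\<forall>j<k. regular_form d \<alpha> \<beta> (mu j) (Sig j)) \<longrightarrow>
     (let g = (\<lambda>x. \<Sum>j<k. poly_eval d m (c j) x * gauss_density d (mu j) (Sig j) x) in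
      (\<forall>j\<le>C. vnorm_poly d j (hermite_moment d j g) \<le> \<epsilon>) \<longrightarrow>
      (\<integral>x. \<bar>g x\<bar> \<partial>lebd d) \<le> (2 + \<alpha> + \<beta>) ^ C * \<epsilon>)"
proof -
  from mixture_L1_bound[of k m] obtain C where C: "\<forall>d \<alpha> \<beta> \<epsilon> \<mu> S c.
     (\<forall>j<k. reg d \<alpha> \<beta> (\<mu> j) (S j)) \<longrightarrow>
     (\<forall>n\<le>C. form_bound d n (\<lambda>X. \<Sum>j<k. \<Sum>is\<in>Lst d m. c j is * coef n X (lin d (\<mu> j) X) (qd d (S j) X) is) \<epsilon>) \<longrightarrow>
     (\<integral>x. \<bar>\<Sum>j<k. \<Sum>is\<in>Lst d m. c j is * hg d (\<mu> j) (S j) is x\<bar> \<partial>lebd d) \<le> (2 + \<alpha> + \<beta>) ^ C * \<epsilon>" ..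
  show ?thesis
  proof (intro exI[of _ C] allI impI, unfold Let_def, intro impI)
    fix d \<alpha> \<beta> \<epsilon> and mu :: "nat \<Rightarrow> nat \<Rightarrow> real" and Sig :: "nat \<Rightarrow> nat \<Rightarrow> nat \<Rightarrow> real" and c
    assume b: "0 < \<beta>" and r: "\<forall>j<k. regular_form d \<alpha> \<beta> (mu j) (Sig j)"
    define S where "S j i l = idm i l + Sig j i l" for j i l
    let ?g = "\<lambda>x. \<Sum>j<k. poly_eval d m (c j) x * gauss_density d (mu j) (Sig j) x"
    assume h: "\<forall>j\<le>C. vnorm_poly d j (hermite_moment d j ?g) \<le> \<epsilon>"
    have reg: "reg d \<alpha> \<beta> (mu j) (S j)" if "j < k" for j
    proof -
      have "idm i l = idm l i" for i l by (simp add: idm_def)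
      thus ?thesis using r that b unfolding regular_form_def reg_def pdm_def S_def by simp
    qed
    hence pdm: "pdm d \<beta> (S j)" if "j < k" for j using that by (simp add: reg_def)
    have gS: "gauss_density d (mu j) (Sig j) = gd d (mu j) (S j)" for j
      by (simp add: gauss_density_gd S_def[abs_def])
    have "\<exists>c'. \<forall>x. poly_eval d m (c j) x * gd d (mu j) (S j) x = (\<Sum>is\<in>Lst d m. c' is * hg d (mu j) (S j) is x)"
      if "j < k" for j using poly_eval_hermite[OF pdm[OF that]] by blast
    then obtain c' where c': "\<And>j x. j < k \<Longrightarrow> poly_eval d m (c j) x * gd d (mu j) (S j) x = (\<Sum>is\<in>Lst d m. c' j is * hg d (mu j) (S j) is x)"
      by metis
    have g: "?g = (\<lambda>x. \<Sum>j<k. \<Sum>is\<in>Lst d m. c' j is * hg d (mu j) (S j) is x)"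
      using c' by (simp add: gS)
    have Fb: "form_bound d n (\<lambda>X. \<Sum>j<k. \<Sum>is\<in>Lst d m. c' j is * coef n X (lin d (mu j) X) (qd d (S j) X) is) \<epsilon>"
      if n: "n \<le> C" for n
    proof -
      define F where "F = (\<lambda>X. \<Sum>j<k. \<Sum>is\<in>Lst d m. c' j is * coef n X (lin d (mu j) X) (qd d (S j) X) is)"
      have hm: "hermite_moment d n ?g = (\<lambda>X. fact n * F X)"
        unfolding g F_def using hermite_moment_mixture[OF pdm] by (intro ext)
      define e where "e j is = (SOME e. form_bound d n (\<lambda>X. coef n X (lin d (mu j) X) (qd d (S j) X) is) e)" for j "is"
      have "form_bound d n (\<lambda>X. coef n X (lin d (mu j) X) (qd d (S j) X) is) (e j is)" if "j < k" "is \<in> Lst d m" for j "is"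
      proof -
        have "set is \<subseteq> {..<d}" using that(2) by (simp add: Lst_def)
        thus ?thesis unfolding e_def by (rule someI_ex[OF form_bound_coef[OF reg[OF that(1)]]])
      qed
      hence "form_bound d n F (\<Sum>j<k. \<Sum>is\<in>Lst d m. \<bar>c' j is\<bar> * e j is)"
        unfolding F_def by (intro form_bound_sum form_bound_scale) auto
      hence "form_bound d n (hermite_moment d n ?g) (\<bar>fact n\<bar> * (\<Sum>j<k. \<Sum>is\<in>Lst d m. \<bar>c' j is\<bar> * e j is))"
        unfolding hm by (rule form_bound_scale)
      moreover have "vnorm_poly d n (hermite_moment d n ?g) \<le> \<epsilon>" using h n by blast
      ultimately have hb: "form_bound d n (\<lambda>X. fact n * F X) \<epsilon>"
        unfolding hm by (rule form_bound_vnorm_poly)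
      have "form_bound d n F (\<bar>1 / fact n\<bar> * \<epsilon>)"
        using form_bound_scale[OF hb, of "1 / fact n"] by simp
      \<comment> \<open>Passing from the n-th Hermite moment to the degree n part divides by n!,
        which only improves the bound.\<close>
      moreover have "\<bar>1 / fact n\<bar> * \<epsilon> \<le> 1 * \<epsilon>"
        using form_bound_nonneg[OF hb] by (intro mult_right_mono) (simp_all add: divide_le_eq)
      ultimately have "form_bound d n F \<epsilon>" using form_bound_mono by simp
      thus ?thesis by (simp only: F_def)
    qed
    have "(\<integral>x. \<bar>\<Sum>j<k. \<Sum>is\<in>Lst d m. c' j is * hg d (mu j) (S j) is x\<bar> \<partial>lebd d) \<le> (2 + \<alpha> + \<beta>) ^ C * \<epsilon>"
      by (rule C[THEN spec, THEN spec, THEN spec, THEN spec, THEN spec, THEN spec, THEN spec, THEN mp, THEN mp])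
        (use reg Fb in blast)+
    thus "(\<integral>x. \<bar>?g x\<bar> \<partial>lebd d) \<le> (2 + \<alpha> + \<beta>) ^ C * \<epsilon>"
      by (simp only: fun_cong[OF g])
  qed
qed

end
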